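(* Let $\gamma>1$, $\lambda_+>2$, $0<\delta_{1,+}\le\delta_{2,+}$, $\delta_{3,+}>0$ and $0<l_+\le1$. Assume that $f_+\in C^4([0,l_+])$ satisfies $$\delta_{1,+}x^{\lambda_+}\le f_+''(x)\le\delta_{2,+}x^{\lambda_+},\quad f_+'''(x)\ge0,\quad|f_+'''(x)|\le\delta_{3,+}x^{\lambda_+-1},\quad0\le x\le l_+.$$ Then, for any given positive constants $C_{1,+}$ and $C_{2,+}$, the sonic-supersonic flow problem (P$_+$) (defined in the context) admits at most one weak solution $Q\in C^{0,1}([0,\zeta_+]\times[0,m])$ satisfying, for $(\varphi,\psi)\in(0,\zeta_+)\times(0,m)$, $$-C_{2,+}\varphi^{\lambda_++2}\le Q(\varphi,\psi)\le-C_{1,+}\varphi^{\lambda_++2},$$ $$-C_{2,+}\varphi^{\lambda_++1}\le Q_\varphi(\varphi,\psi)\le-C_{1,+}\varphi^{\lambda_++1},\quad|Q_\psi(\varphi,\psi)|\le C_{2,+}\varphi^{3\lambda_+/2+1}.$$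
   Context: Gas law: $\gamma>1$, $q_{max}=(2/(\gamma-1))^{1/2}$, $\rho(q^2)=\big(1-\frac{\gamma-1}2q^2\big)^{1/(\gamma-1)}$ for $0<q<q_{max}$ ($\rho'$ is the derivative with respect to the argument $q^2$), $c_*=(2/(\gamma+1))^{1/2}$, $$A(q)=\int_{c_*}^q\frac{\rho(s^2)+2s^2\rho'(s^2)}{s\rho^2(s^2)}ds,\quad B(q)=\int_{c_*}^q\frac{\rho(s^2)}sds,\quad0<q<q_{max}.$$ $A$ is strictly decreasing on $[c_*,q_{max})$ with $A(c_* )=0$; $A_+^{-1}$ denotes the inverse of $A|_{[c_*,q_{max})}$. For $s<0$ set $K(s)=B(A_+^{-1}(s))$ and $b(s)=-K'(s)>0$ (so $b(s)\to+\infty$ as $s\to0^-$). Nozzle: $y=f_+(x)$, $0\le x\le l_+$, is the upper wall of the divergent part; standing assumptions: $f_+(0)>0$, $f_+'(0)=0$, $f_+'>0$ on $(0,l_+]$. Set $m=f_+(0)\,c_*^{1+2/(\gamma-1)}$ and $\Theta_+(x)=\arctan f_+'(x)$. For a given positive function $\mathscr Q_+$ on $[0,l_+]$ (speed on the wall) set $$\Phi_+(x)=\int_0^x\frac{\mathscr Q_+(s)}{\cos\Theta_+(s)}ds,\quad\zeta_+=\Phi_+(l_+),\quad X_+=\Phi_+^{-1}:[0,\zeta_+]\to[0,l_+].$$ Problem (P$_+$): find $Q$ (with $\mathscr Q_+$, hence $\zeta_+,X_+$, determined through the last condition) such that $$\begin{aligned} &Q_{\varphi\varphi}-(b(Q)Q_\psi)_\psi=0,&&(\varphi,\psi)\in(0,\zeta_+)\times(0,m),\\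 &Q(0,\psi)=0,\quad Q_\varphi(0,\psi)=0,&&\psi\in(0,m),\\ &Q_\psi(\varphi,0)=0,\quad Q_\psi(\varphi,m)=-\frac{\Theta_+'(X_+(\varphi))\cos\Theta_+(X_+(\varphi))}{b(Q(\varphi,m))\,A_+^{-1}(Q(\varphi,m))},&&\varphi\in(0,\zeta_+),\\ &\mathscr Q_+(x)=A_+^{-1}(Q(\Phi_+(x),m)),&&x\in[0,l_+]. \end{aligned}$$ A weak solution of (P$_+$) is a $Q\in C^{0,1}([0,\zeta_+]\times[0,m])$ satisfying the last condition, $Q(0,\psi)=0$ for $\psi\in(0,m)$, and $$\int_0^{\zeta_+}\!\int_0^m\big(Q_\varphi\xi_\varphi-b(Q)Q_\psi\xi_\psi\big)d\psi d\varphi-\int_0^{\zeta_+}\frac{\Theta_+'(X_+(\varphi))\cos\Theta_+(X_+(\varphi))}{A_+^{-1}(Q(\varphi,m))}\xi(\varphi,m)d\varphi=0$$ for every $\xi\in C^1([0,\zeta_+]\times[0,m])$ with $\xi(\zeta_+,\cdot)=0$ on $(0,m)$. *)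

theory Defs
  imports "HOL-Analysis.Analysis"
begin

section \<open>Gas law\<close>

definition q_max :: "real \<Rightarrow> real" where
  "q_max \<gamma> = sqrt (2 / (\<gamma> - 1))"

definition c_star :: "real \<Rightarrow> real" where
  "c_star \<gamma> = sqrt (2 / (\<gamma> + 1))"

text \<open>The argument of the density is the squared speed, so \<open>deriv (\<rho> \<gamma>)\<close> is the derivative with
  respect to the squared speed.\<close>

definition \<rho> :: "real \<Rightarrow> real \<Rightarrow> real" where
  "\<rho> \<gamma> t = (1 - (\<gamma> - 1) / 2 * t) powr (1 / (\<gamma> - 1))"

definition A :: "real \<Rightarrow> real \<Rightarrow> real" where
  "A \<gamma> q = (LBINT s=c_star \<gamma>..q.
     (\<rho> \<gamma> (s\<^sup>2) + 2 * s\<^sup>2 * deriv (\<rho> \<gamma>) (s\<^sup>2)) / (s * (\<rho> \<gamma> (s\<^sup>2))\<^sup>2))"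

definition B :: "real \<Rightarrow> real \<Rightarrow> real" where
  "B \<gamma> q = (LBINT s=c_star \<gamma>..q. \<rho> \<gamma> (s\<^sup>2) / s)"

text \<open>\<open>A \<gamma>\<close> maps \<open>[c\<^sub>*, q\<^sub>m\<^sub>a\<^sub>x)\<close> bijectively onto the nonpositive reals; \<open>A_plus_inv \<gamma> s\<close> is
  meaningful for \<open>s \<le> 0\<close>, and \<open>b \<gamma> s\<close> for \<open>s < 0\<close>.\<close>

definition A_plus_inv :: "real \<Rightarrow> real \<Rightarrow> real" where
  "A_plus_inv \<gamma> = the_inv_into {c_star \<gamma>..<q_max \<gamma>} (A \<gamma>)"

definition K :: "real \<Rightarrow> real \<Rightarrow> real" where
  "K \<gamma> s = B \<gamma> (A_plus_inv \<gamma> s)"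

definition b :: "real \<Rightarrow> real \<Rightarrow> real" where
  "b \<gamma> s = - deriv (K \<gamma>) s"

section \<open>Nozzle wall\<close>

text \<open>The \<open>k\<close>-th derivative on the closed interval \<open>[0, l]\<close>, one-sided at the two end points.\<close>

definition deriv_Icc :: "real \<Rightarrow> nat \<Rightarrow> (real \<Rightarrow> real) \<Rightarrow> real \<Rightarrow> real" where
  "deriv_Icc l k f = ((\<lambda>g x. vector_derivative g (at x within {0..l})) ^^ k) f"

definition C_Icc :: "nat \<Rightarrow> real \<Rightarrow> (real \<Rightarrow> real) \<Rightarrow> bool" where
  "C_Icc k l f \<longleftrightarrow>
     (\<forall>j<k. deriv_Icc l j f differentiable_on {0..l}) \<and> continuous_on {0..l} (deriv_Icc l k f)"

definition flux :: "real \<Rightarrow> (real \<Rightarrow> real) \<Rightarrow> real" where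
  "flux \<gamma> f = f 0 * c_star \<gamma> powr (1 + 2 / (\<gamma> - 1))"

definition \<Theta> :: "real \<Rightarrow> (real \<Rightarrow> real) \<Rightarrow> real \<Rightarrow> real" where
  "\<Theta> l f x = arctan (deriv_Icc l 1 f x)"

text \<open>Throughout, \<open>w\<close> is the speed on the wall, and \<open>X\<close> inverts the potential on the wall.\<close>

definition \<Phi> :: "real \<Rightarrow> (real \<Rightarrow> real) \<Rightarrow> (real \<Rightarrow> real) \<Rightarrow> real \<Rightarrow> real" where
  "\<Phi> l f w x = integral {0..x} (\<lambda>s. w s / cos (\<Theta> l f s))"

definition \<zeta> :: "real \<Rightarrow> (real \<Rightarrow> real) \<Rightarrow> (real \<Rightarrow> real) \<Rightarrow> real" where
  "\<zeta> l f w = \<Phi> l f w l"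

definition X :: "real \<Rightarrow> (real \<Rightarrow> real) \<Rightarrow> (real \<Rightarrow> real) \<Rightarrow> real \<Rightarrow> real" where
  "X l f w = the_inv_into {0..l} (\<Phi> l f w)"

section \<open>Weak solutions\<close>

definition D_phi :: "(real \<times> real \<Rightarrow> real) \<Rightarrow> real \<Rightarrow> real \<Rightarrow> real" where
  "D_phi u \<phi> \<psi> = deriv (\<lambda>t. u (t, \<psi>)) \<phi>"

definition D_psi :: "(real \<times> real \<Rightarrow> real) \<Rightarrow> real \<Rightarrow> real \<Rightarrow> real" where
  "D_psi u \<phi> \<psi> = deriv (\<lambda>t. u (\<phi>, t)) \<psi>"

text \<open>Continuous differentiability on a closed set \<open>R\<close>, up to its boundary; \<open>G\<close> is the gradient.\<close>

definition C1_closed :: "(real \<times> real) set \<Rightarrow> (real \<times> real \<Rightarrow> real) \<Rightarrow> bool" where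
  "C1_closed R u \<longleftrightarrow>
     (\<exists>G. continuous_on R G \<and> (\<forall>p\<in>R. (u has_derivative (\<lambda>h. G p \<bullet> h)) (at p within R)))"

definition interior_integrand ::
  "real \<Rightarrow> (real \<times> real \<Rightarrow> real) \<Rightarrow> (real \<times> real \<Rightarrow> real) \<Rightarrow> real \<times> real \<Rightarrow> real" where
  "interior_integrand \<gamma> Q \<xi> = (\<lambda>(\<phi>, \<psi>).
     D_phi Q \<phi> \<psi> * D_phi \<xi> \<phi> \<psi> - b \<gamma> (Q (\<phi>, \<psi>)) * D_psi Q \<phi> \<psi> * D_psi \<xi> \<phi> \<psi>)"

definition wall_integrand ::
  "real \<Rightarrow> real \<Rightarrow> (real \<Rightarrow> real) \<Rightarrow> (real \<Rightarrow> real) \<Rightarrow>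
   (real \<times> real \<Rightarrow> real) \<Rightarrow> (real \<times> real \<Rightarrow> real) \<Rightarrow> real \<Rightarrow> real" where
  "wall_integrand \<gamma> l f w Q \<xi> \<phi> =
     deriv_Icc l 1 (\<Theta> l f) (X l f w \<phi>) * cos (\<Theta> l f (X l f w \<phi>))
       / A_plus_inv \<gamma> (Q (\<phi>, flux \<gamma> f)) * \<xi> (\<phi>, flux \<gamma> f)"

text \<open>The domain of \<open>Q\<close> depends on the unknown wall speed \<open>w\<close>, so a solution is the pair \<open>(w, Q)\<close>.
  The integrability requirements only say that the integrals occurring in the problem exist.
  The partial derivatives of the Lipschitz function \<open>Q\<close> exist almost everywhere.\<close>

definition weak_solution ::
  "real \<Rightarrow> real \<Rightarrow> (real \<Rightarrow> real) \<Rightarrow> (real \<Rightarrow> real) \<Rightarrow> (real \<times> real \<Rightarrow> real) \<Rightarrow> bool" where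
  "weak_solution \<gamma> l f w Q \<longleftrightarrow>
     (let m = flux \<gamma> f; z = \<zeta> l f w in
       (\<forall>x\<in>{0..l}. 0 < w x) \<and>
       (\<lambda>s. w s / cos (\<Theta> l f s)) integrable_on {0..l} \<and>
       (\<exists>L. L-lipschitz_on ({0..z} \<times> {0..m}) Q) \<and>
       (\<forall>x\<in>{0..l}. w x = A_plus_inv \<gamma> (Q (\<Phi> l f w x, m))) \<and>
       (\<forall>\<psi>\<in>{0<..<m}. Q (0, \<psi>) = 0) \<and>
       (\<forall>\<xi>. C1_closed ({0..z} \<times> {0..m}) \<xi> \<and> (\<forall>\<psi>\<in>{0<..<m}. \<xi> (z, \<psi>) = 0) \<longrightarrow>
          interior_integrand \<gamma> Q \<xi> absolutely_integrable_on ({0<..<z} \<times> {0<..<m}) \<and>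
          wall_integrand \<gamma> l f w Q \<xi> integrable_on {0..z} \<and>
          integral ({0<..<z} \<times> {0<..<m}) (interior_integrand \<gamma> Q \<xi>)
            - integral {0..z} (wall_integrand \<gamma> l f w Q \<xi>) = 0))"

text \<open>Since \<open>Q\<close> is only Lipschitz, the bounds on its partial derivatives are understood almost
  everywhere, at points where these exist (which is almost every point, by Rademacher's theorem).\<close>

definition growth_bounds ::
  "real \<Rightarrow> real \<Rightarrow> real \<Rightarrow> real \<Rightarrow> real \<Rightarrow> (real \<times> real \<Rightarrow> real) \<Rightarrow> bool" where
  "growth_bounds lam C1 C2 z m Q \<longleftrightarrow>
     (\<forall>\<phi>\<in>{0<..<z}. \<forall>\<psi>\<in>{0<..<m}.
        - C2 * \<phi> powr (lam + 2) \<le> Q (\<phi>, \<psi>) \<and> Q (\<phi>, \<psi>) \<le> - C1 * \<phi> powr (lam + 2)) \<and>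
     (AE (\<phi>, \<psi>) in lebesgue. (\<phi>, \<psi>) \<in> {0<..<z} \<times> {0<..<m} \<longrightarrow>
        (\<lambda>t. Q (t, \<psi>)) differentiable at \<phi> \<and> (\<lambda>t. Q (\<phi>, t)) differentiable at \<psi> \<and>
        - C2 * \<phi> powr (lam + 1) \<le> D_phi Q \<phi> \<psi> \<and> D_phi Q \<phi> \<psi> \<le> - C1 * \<phi> powr (lam + 1) \<and>
        \<bar>D_psi Q \<phi> \<psi>\<bar> \<le> C2 * \<phi> powr (3 * lam / 2 + 1))"

end

theory Submission
  imports Defs
begin

text \<open>
  Write \<open>\<Lambda> = - K(Q)\<close>, so that the equation reads \<open>Q\<^sub>\<phi>\<^sub>\<phi> = \<Lambda>\<^sub>\<psi>\<^sub>\<psi>\<close>. For two solutions let \<open>u\<close> and \<open>y\<close> be the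
  differences of \<open>Q\<close> and of \<open>\<Lambda>\<close>; then \<open>u\<^sub>\<phi>\<^sub>\<phi> = y\<^sub>\<psi>\<^sub>\<psi>\<close>, a linear wave equation without lower order terms,
  coupled by the pointwise relation \<open>y = a u\<close> with a positive mean value \<open>a\<close> of \<open>b\<close>. The coefficient is singular
  at \<open>\<phi> = 0\<close>, and only first derivatives of \<open>Q\<close> are available. Both difficulties disappear for the
  multiplier \<open>y\<close>, that is, for the test function \<open>\<xi>(\<phi>, \<psi>) = \<integral> y ds\<close> over \<open>[\<phi>, \<tau>]\<close>: the term with \<open>\<Lambda>\<close> becomes half the
  square of \<open>P(\<psi>) = \<integral> y\<^sub>\<psi> ds\<close> over \<open>[0, \<tau>]\<close>, and the term with \<open>u\<^sub>\<phi> y\<close> is at least half of \<open>u y\<close> at \<open>\<phi> = \<tau>\<close>, because \<open>- K\<close>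
  is convex and both flows accelerate (\<open>energy_identity\<close>, \<open>energy_inequality\<close>). The test function is only
  Lipschitz; it is approximated by continuously differentiable ones (\<open>smeared\<close>).

  What remains is the contribution of the wall, the integral of \<open>- (g\<^sub>1 - g\<^sub>2)(V(\<tau>) - V(\<phi>))\<close>, where \<open>V\<close> is the
  primitive of \<open>y\<close> along the wall and \<open>g\<close> is the curvature of the wall at the current position divided by the
  speed. The energy controls \<open>V\<close> on the wall through a trace estimate, but not \<open>y\<close> itself. The position on the wall
  is determined by the integral of the slowness, and the difference of the slownesses is \<open>slope * y\<close> with a
  bounded factor that increases with \<open>\<phi>\<close> (\<open>chord_slope_mono\<close>, \<open>inverse_speed_diff\<close>). The second mean value theorem
  therefore expresses everything by \<open>V\<close> (\<open>pos_diff\<close>, \<open>wall_estimate\<close>). As the curvature vanishes at the throat at the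
  rate \<open>lam\<close>, the wall contributes at most a multiple of \<open>\<tau> powr (lam - 1) * (\<tau> - T) * N\<^sup>2\<close>, where \<open>V\<close> vanishes on
  \<open>[0, T]\<close> and \<open>N\<close> bounds \<open>V\<close> on \<open>[0, \<tau>]\<close>. This power outweighs the blow-up of \<open>b\<close>, which is of order \<open>lam / 2 + 1\<close>,
  so \<open>V(\<tau>)\<^sup>2\<close> is at most a constant times \<open>(\<tau> - T) * N\<^sup>2\<close> (\<open>trace_bound\<close>). Hence \<open>V\<close> vanishes step by step
  (\<open>V_zero\<close>), and with it the energy. The solutions agree on the shorter range of the potential; there the
  positions on the wall agree as well, so both flows reach the end of the wall at the same potential.
\<close>

section \<open>Almost everywhere arguments, slices and Lipschitz functions\<close>

lemma AE_lborel_negligible: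
  fixes P :: "'a::euclidean_space \<Rightarrow> bool"
  assumes "AE x in lborel. P x"
  obtains N where "negligible N" "\<And>x. x \<notin> N \<Longrightarrow> P x"
proof -
  have "AE x in lebesgue. P x" using assms by (rule AE_completion)
  then obtain N where "N \<in> null_sets lebesgue" "{x \<in> space lebesgue. \<not> P x} \<subseteq> N"
    unfolding eventually_ae_filter by blast
  then show thesis by (intro that[of N]) (auto simp: negligible_iff_null_sets)
qed

lemma integral_cong_AE_lborel:
  fixes f g :: "'a::euclidean_space \<Rightarrow> real"
  assumes "AE x in lborel. x \<in> S \<longrightarrow> f x = g x"
  shows "integral S f = integral S g"
proof -
  obtain N where N: "negligible N" "\<And>x. x \<notin> N \<Longrightarrow> x \<in> S \<longrightarrow> f x = g x"
    using AE_lborel_negligible[OF assms] by blast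
  show ?thesis by (rule integral_spike[OF N(1)]) (use N(2) in auto)
qed

lemma integrable_cong_AE_lborel:
  fixes f g :: "'a::euclidean_space \<Rightarrow> real"
  assumes "AE x in lborel. x \<in> S \<longrightarrow> f x = g x" "f integrable_on S"
  shows "g integrable_on S"
proof -
  obtain N where N: "negligible N" "\<And>x. x \<notin> N \<Longrightarrow> x \<in> S \<longrightarrow> f x = g x"
    using AE_lborel_negligible[OF assms(1)] by blast
  show ?thesis by (rule integrable_spike[OF assms(2) N(1)]) (use N(2) in auto)
qed

lemma bounded_borel_set_integrable:
  fixes f :: "'a::euclidean_space \<Rightarrow> real"
  assumes "f \<in> borel_measurable borel" "compact S" "\<And>x. x \<in> S \<Longrightarrow> \<bar>f x\<bar> \<le> C"
  shows "set_integrable lborel S f"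
proof -
  have S: "S \<in> sets borel" "emeasure lborel S < \<infinity>"
    using assms(2) by (auto simp: compact_imp_closed dest: emeasure_compact_finite)
  have "integrable lborel (\<lambda>x. indicator S x * C)"
    using S by (intro integrable_mult_left integrable_real_indicator) auto
  then show ?thesis unfolding set_integrable_def
    by (rule Bochner_Integration.integrable_bound)
      (use assms S in \<open>auto simp: indicator_def split: if_splits intro: order_trans[OF _ abs_ge_self]\<close>)
qed

lemma bounded_borel_integrable_on:
  fixes f :: "'a::euclidean_space \<Rightarrow> real"
  assumes "f \<in> borel_measurable borel" "compact S" "\<And>x. x \<in> S \<Longrightarrow> \<bar>f x\<bar> \<le> C"
  shows "f integrable_on S"
  using bounded_borel_set_integrable[OF assms] by (rule set_borel_integral_eq_integral)

lemma bounded_convergence_AE: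
  fixes f :: "nat \<Rightarrow> 'a::euclidean_space \<Rightarrow> real"
  assumes "\<And>n. f n integrable_on S" "compact S" "\<And>n x. x \<in> S \<Longrightarrow> \<bar>f n x\<bar> \<le> C"
    and "AE x in lborel. x \<in> S \<longrightarrow> (\<lambda>n. f n x) \<longlonglongrightarrow> g x"
  shows "g integrable_on S" "(\<lambda>n. integral S (f n)) \<longlonglongrightarrow> integral S g"
proof -
  obtain N where N: "negligible N" "\<And>x. x \<notin> N \<Longrightarrow> x \<in> S \<longrightarrow> (\<lambda>n. f n x) \<longlonglongrightarrow> g x"
    using AE_lborel_negligible[OF assms(4)] by blast
  have sub: "negligible {x \<in> S - (S - N). h x \<noteq> 0}" "negligible {x \<in> S - N - S. h x \<noteq> 0}" for h :: "'a \<Rightarrow> real"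
    by (auto intro: negligible_subset[OF N(1)])
  have eq: "h integrable_on (S - N) \<longleftrightarrow> h integrable_on S" "integral (S - N) h = integral S h" for h :: "'a \<Rightarrow> real"
    using sub[of h] by (auto intro: integrable_spike_set integral_spike_set)
  have c: "(\<lambda>x. C) integrable_on S"
    using assms(2) by (intro integrable_on_const) (simp add: lmeasurable_compact)
  have fi: "f n integrable_on (S - N)" and ci: "(\<lambda>x. C) integrable_on (S - N)" for n
    using assms(1) c eq(1) by blast+
  have le: "norm (f n x) \<le> C" if "x \<in> S - N" for n x
    using assms(3) that by simp
  have tends: "(\<lambda>n. f n x) \<longlonglongrightarrow> g x" if "x \<in> S - N" for x
    using N(2) that by blast
  have "g integrable_on (S - N)" "(\<lambda>n. integral (S - N) (f n)) \<longlonglongrightarrow> integral (S - N) g"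
    using dominated_convergence[OF fi ci le tends] by blast+
  then show "g integrable_on S" "(\<lambda>n. integral S (f n)) \<longlonglongrightarrow> integral S g"
    by (simp_all add: eq)
qed

text \<open>Every null set is contained in a Borel null set, for which the order of the two quantifiers can be exchanged.\<close>

lemma AE_slices:
  assumes "AE p in (lborel :: (real \<times> real) measure). P p"
  shows "AE x in lborel. AE y in lborel. P (x, y)" "AE y in lborel. AE x in lborel. P (x, y)"
proof -
  have 1: "AE p in (lborel \<Otimes>\<^sub>M lborel :: (real \<times> real) measure). P p"
    using assms unfolding lborel_prod .
  show "AE x in lborel. AE y in lborel. P (x, y)" by (rule lborel_pair.AE_pair[OF 1])
  obtain N where N: "N \<in> null_sets (lborel :: (real \<times> real) measure)" "{p \<in> space lborel. \<not> P p} \<subseteq> N"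
    using assms unfolding eventually_ae_filter by blast
  have N': "AE p in (lborel \<Otimes>\<^sub>M lborel :: (real \<times> real) measure). p \<notin> N"
    using AE_not_in[OF N(1)] unfolding lborel_prod .
  have "AE x in lborel. AE y in lborel. (x, y) \<notin> N" by (rule lborel_pair.AE_pair[OF N'])
  moreover have "{x \<in> space (lborel \<Otimes>\<^sub>M lborel). (fst x, snd x) \<notin> N} \<in> sets (lborel \<Otimes>\<^sub>M lborel)"
  proof -
    have "{x \<in> space (lborel \<Otimes>\<^sub>M lborel). (fst x, snd x) \<notin> N} = space (lborel \<Otimes>\<^sub>M lborel) - N" by auto
    moreover have "N \<in> sets (lborel \<Otimes>\<^sub>M lborel)" using N(1) unfolding lborel_prod by (rule null_setsD2)
    ultimately show ?thesis by (metis sets.compl_sets)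
  qed
  ultimately have "AE y in lborel. AE x in lborel. (x, y) \<notin> N"
    using lborel_pair.AE_commute[of "\<lambda>x y. (x,y) \<notin> N"] by blast
  then show "AE y in lborel. AE x in lborel. P (x, y)"
    using N(2) by (auto elim!: eventually_mono)
qed

lemma Fubini_rectangle:
  fixes f :: "real \<times> real \<Rightarrow> real" and a b c d :: real
  assumes f[measurable]: "f \<in> borel_measurable borel"
    and C: "\<And>p. p \<in> {a..b} \<times> {c..d} \<Longrightarrow> \<bar>f p\<bar> \<le> C"
  shows "f integrable_on ({a..b} \<times> {c..d})"
    and "integral ({a..b} \<times> {c..d}) f = integral {a..b} (\<lambda>x. integral {c..d} (\<lambda>y. f (x, y)))"
    and "integral ({a..b} \<times> {c..d}) f = integral {c..d} (\<lambda>y. integral {a..b} (\<lambda>x. f (x, y)))"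
    and "(\<lambda>x. integral {c..d} (\<lambda>y. f (x, y))) integrable_on {a..b}"
    and "(\<lambda>y. integral {a..b} (\<lambda>x. f (x, y))) integrable_on {c..d}"
proof -
  have si: "set_integrable lborel ({a..b} \<times> {c..d}) f"
    by (rule bounded_borel_set_integrable[OF f _ C]) (auto intro: compact_Times)
  show int: "f integrable_on ({a..b} \<times> {c..d})"
    by (rule set_borel_integral_eq_integral[OF si])
  have box: "{a..b} \<times> {c..d} = cbox (a, c) (b, d)" by (simp add: cbox_Pair_eq)
  let ?F = "\<lambda>p. indicator ({a..b} \<times> {c..d}) p * f p"
  have i: "integrable (lborel \<Otimes>\<^sub>M lborel) (\<lambda>(x, y). ?F (x, y))"
    using si by (simp add: set_integrable_def lborel_prod case_prod_beta')
  have sl1: "integral {c..d} (\<lambda>y. f (x, y)) = (\<integral>y. indicator {c..d} y * f (x, y) \<partial>lborel)" if "x \<in> {a..b}" for x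
  proof -
    have "set_integrable lborel {c..d} (\<lambda>y. f (x, y))"
      by (rule bounded_borel_set_integrable[where C=C]) (use C that in \<open>auto intro: measurable_compose[OF _ f]\<close>)
    from set_borel_integral_eq_integral(2)[OF this] show ?thesis by (simp add: set_lebesgue_integral_def)
  qed
  have sl2: "integral {a..b} (\<lambda>x. f (x, y)) = (\<integral>x. indicator {a..b} x * f (x, y) \<partial>lborel)" if "y \<in> {c..d}" for y
  proof -
    have "set_integrable lborel {a..b} (\<lambda>x. f (x, y))"
      by (rule bounded_borel_set_integrable[where C=C]) (use C that in \<open>auto intro: measurable_compose[OF _ f]\<close>)
    from set_borel_integral_eq_integral(2)[OF this] show ?thesis by (simp add: set_lebesgue_integral_def)
  qed
  have e: "integral ({a..b} \<times> {c..d}) f = (\<integral>p. ?F p \<partial>(lborel \<Otimes>\<^sub>M lborel))"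
    using set_borel_integral_eq_integral(2)[OF si] by (simp add: set_lebesgue_integral_def lborel_prod)
  have 1: "integrable lborel (\<lambda>x. \<integral>y. ?F (x, y) \<partial>lborel)"
    using lborel_pair.integrable_fst[OF i] by simp
  have 2: "integrable lborel (\<lambda>y. \<integral>x. ?F (x, y) \<partial>lborel)"
    using lborel_pair.integrable_snd[OF i] by simp
  have e1: "(\<integral>y. ?F (x, y) \<partial>lborel) = indicator {a..b} x * integral {c..d} (\<lambda>y. f (x, y))" for x
    using sl1[of x] by (cases "x \<in> {a..b}") (auto simp: indicator_times intro!: Bochner_Integration.integral_cong)
  have e2: "(\<integral>x. ?F (x, y) \<partial>lborel) = indicator {c..d} y * integral {a..b} (\<lambda>x. f (x, y))" for y
    using sl2[of y] by (cases "y \<in> {c..d}") (auto simp: indicator_times intro!: Bochner_Integration.integral_cong)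
  have s1: "set_integrable lborel {a..b} (\<lambda>x. integral {c..d} (\<lambda>y. f (x, y)))"
    using 1 by (simp add: e1 set_integrable_def)
  have s2: "set_integrable lborel {c..d} (\<lambda>y. integral {a..b} (\<lambda>x. f (x, y)))"
    using 2 by (simp add: e2 set_integrable_def)
  show "(\<lambda>x. integral {c..d} (\<lambda>y. f (x, y))) integrable_on {a..b}"
    "(\<lambda>y. integral {a..b} (\<lambda>x. f (x, y))) integrable_on {c..d}"
    using set_borel_integral_eq_integral(1)[OF s1] set_borel_integral_eq_integral(1)[OF s2] by auto
  show "integral ({a..b} \<times> {c..d}) f = integral {a..b} (\<lambda>x. integral {c..d} (\<lambda>y. f (x, y)))"
    using set_borel_integral_eq_integral(2)[OF s1] lborel_pair.integral_fst[OF i] e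
    by (simp add: e1 set_lebesgue_integral_def case_prod_beta')
  show "integral ({a..b} \<times> {c..d}) f = integral {c..d} (\<lambda>y. integral {a..b} (\<lambda>x. f (x, y)))"
    using set_borel_integral_eq_integral(2)[OF s2] lborel_pair.integral_snd[OF i] e
    by (simp add: e2 set_lebesgue_integral_def case_prod_beta')
qed

lemma borel_measurable_parametric_integral:
  fixes f :: "'a::euclidean_space \<times> real \<Rightarrow> real" and a b :: real
  assumes f: "f \<in> borel_measurable borel" and C: "\<And>p. \<bar>f p\<bar> \<le> C"
  shows "(\<lambda>p. integral {a..b} (\<lambda>s. f (p, s))) \<in> borel_measurable borel"
proof -
  have pr: "(\<lambda>s. f (p, s)) \<in> borel_measurable borel" for p
    by (rule measurable_compose[OF _ f]) (auto intro: borel_measurable_continuous_onI continuous_intros)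
  have "(\<lambda>p. integral {a..b} (\<lambda>s. f (p, s))) = (\<lambda>p. \<integral>s. indicator {a..b} s * f (p, s) \<partial>lborel)"
  proof
    fix p
    have "set_integrable lborel {a..b} (\<lambda>s. f (p, s))"
      by (rule bounded_borel_set_integrable[OF pr _ C]) simp
    from set_borel_integral_eq_integral(2)[OF this]
    show "integral {a..b} (\<lambda>s. f (p, s)) = (\<integral>s. indicator {a..b} s * f (p, s) \<partial>lborel)"
      by (simp add: set_lebesgue_integral_def)
  qed
  also have "\<dots> \<in> borel_measurable borel"
  proof -
    have sn: "(snd :: 'a \<times> real \<Rightarrow> real) \<in> borel_measurable borel"
      by (intro borel_measurable_continuous_onI continuous_intros)
    have "(\<lambda>q. indicator {a..b} (snd q) * f q) \<in> borel_measurable borel"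
      by (intro borel_measurable_times f measurable_compose[OF sn]) simp
    moreover have "sets (borel \<Otimes>\<^sub>M lborel :: ('a \<times> real) measure) = sets borel"
      using sets_pair_measure_cong[OF refl sets_lborel, of "borel :: 'a measure"] unfolding borel_prod .
    ultimately have "(\<lambda>(p, s). indicator {a..b} s * f (p, s)) \<in> borel_measurable (borel \<Otimes>\<^sub>M lborel)"
      by (subst measurable_cong_sets[OF _ refl]) (auto simp: case_prod_beta')
    from lborel.borel_measurable_lebesgue_integral[OF this] show ?thesis by simp
  qed
  finally show ?thesis .
qed

lemma borel_measurable_slice_integral:
  fixes f :: "real \<times> real \<Rightarrow> real" and a b :: real
  assumes f: "f \<in> borel_measurable borel" and C: "\<And>p. \<bar>f p\<bar> \<le> C"
  shows "(\<lambda>y. integral {a..b} (\<lambda>x. f (x, y))) \<in> borel_measurable borel"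
proof -
  have "(\<lambda>q::real \<times> real. f (snd q, fst q)) \<in> borel_measurable borel"
    by (rule measurable_compose[OF _ f]) (intro borel_measurable_continuous_onI continuous_intros)
  from borel_measurable_parametric_integral[OF this C] show ?thesis by simp
qed

text \<open>The difference quotients of \<open>f\<close> are bounded by the Lipschitz constant and converge to \<open>f'\<close> almost
  everywhere, so their integrals converge to that of \<open>f'\<close>; by telescoping they also converge to the
  increment of \<open>f\<close>.\<close>

lemma Lipschitz_FTC:
  fixes f f' :: "real \<Rightarrow> real" and a b :: real
  assumes ab: "a \<le> b" and L: "L-lipschitz_on {a..b} f"
    and d: "AE x in lborel. x \<in> {a<..<b} \<longrightarrow> (f has_real_derivative f' x) (at x)"
  shows "(f' has_integral (f b - f a)) {a..b}"
proof -
  define e where "e = (\<lambda>x. f (max a (min b x)))"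
  have ce: "\<bar>e x - e y\<bar> \<le> L * \<bar>x - y\<bar>" for x y
  proof -
    have "\<bar>e x - e y\<bar> \<le> L * \<bar>max a (min b x) - max a (min b y)\<bar>"
      using lipschitz_onD[OF L, of "max a (min b x)" "max a (min b y)"] ab
      by (simp add: e_def dist_real_def)
    also have "\<dots> \<le> L * \<bar>x - y\<bar>"
      using lipschitz_on_nonneg[OF L] by (intro mult_left_mono) (auto simp: max_def min_def)
    finally show ?thesis .
  qed
  have "L-lipschitz_on UNIV e" using ce lipschitz_on_nonneg[OF L] by (auto intro!: lipschitz_onI simp: dist_real_def)
  then have cont: "continuous_on UNIV e" by (rule lipschitz_on_continuous_on)
  obtain G where G: "\<And>x. x \<in> {a-1..b+1} \<Longrightarrow> (G has_vector_derivative e x) (at x within {a-1..b+1})"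
    using antiderivative_continuous[of "a-1" "b+1" e] continuous_on_subset[OF cont] by blast
  have G': "(G has_real_derivative e x) (at x)" if "x \<in> {a-1<..<b+1}" for x
    using G[of x] that at_within_Icc_at[of "a-1" x "b+1"]
    by (auto simp: has_real_derivative_iff_has_vector_derivative)
  define h where "h n = inverse (real (Suc (Suc n)))" for n
  have h: "0 < h n" "h n < 1" for n by (auto simp: h_def field_simps)
  have h0: "h \<longlonglongrightarrow> 0" unfolding h_def using LIMSEQ_Suc[OF LIMSEQ_inverse_real_of_nat] .
  have hat: "filterlim h (at 0) sequentially"
    unfolding filterlim_at using h0 h(1) by (auto intro!: always_eventually less_imp_neq[symmetric])
  define g where "g n x = (e (x + h n) - e x) / h n" for n x
  have lim: "AE x in lborel. x \<in> {a..b} \<longrightarrow> (\<lambda>n. g n x) \<longlonglongrightarrow> f' x"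
  proof -
    have "AE x in lborel. x \<noteq> a" "AE x in lborel. x \<noteq> b" by (auto intro: AE_lborel_singleton)
    with d show ?thesis
    proof eventually_elim
      case (elim x)
      show ?case
      proof
        assume "x \<in> {a..b}"
        with elim have x: "x \<in> {a<..<b}" by auto
        with elim have "(f has_real_derivative f' x) (at x)" by blast
        then have "(e has_real_derivative f' x) (at x)"
          by (rule has_field_derivative_transform_within_open[where S = "{a<..<b}"])
            (use x in \<open>auto simp: e_def min_def max_def\<close>)
        then have "((\<lambda>h. (e (x + h) - e x) / h) \<longlongrightarrow> f' x) (at 0)" by (simp add: DERIV_def)
        from filterlim_compose[OF this hat] show "(\<lambda>n. g n x) \<longlonglongrightarrow> f' x" by (simp add: g_def)
      qed
    qed
  qed
  have gI: "(g n has_integral ((G (b + h n) - G b) / h n - (G (a + h n) - G a) / h n)) {a..b}" for n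
  proof -
    have "((\<lambda>x. (G (x + h n) - G x) / h n) has_real_derivative g n x) (at x within {a..b})" if "x \<in> {a..b}" for x
    proof -
      have "((\<lambda>x. G (x + h n)) has_real_derivative e (x + h n)) (at x)"
        using G'[of "x + h n"] h[of n] that by (simp add: DERIV_shift)
      moreover have "(G has_real_derivative e x) (at x)" using G' that by auto
      ultimately have "((\<lambda>x. (G (x + h n) - G x) / h n) has_real_derivative g n x) (at x)"
        unfolding g_def by (intro DERIV_cdivide DERIV_diff)
      then show ?thesis by (rule has_field_derivative_at_within)
    qed
    from fundamental_theorem_of_calculus[OF ab, of "\<lambda>x. (G (x + h n) - G x) / h n" "g n"] this
    show ?thesis by (simp add: has_real_derivative_iff_has_vector_derivative diff_divide_distrib algebra_simps)
  qed
  have gb: "\<bar>g n x\<bar> \<le> L" for n x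
    using ce[of "x + h n" x] h[of n] by (simp add: g_def abs_divide field_simps)
  note bc = bounded_convergence_AE[of g "{a..b}", OF has_integral_integrable[OF gI] compact_Icc gb lim]
  have q: "(\<lambda>n. (G (c + h n) - G c) / h n) \<longlonglongrightarrow> e c" if "c \<in> {a..b}" for c
  proof -
    have "(G has_real_derivative e c) (at c)" using G' that by auto
    then have "((\<lambda>h. (G (c + h) - G c) / h) \<longlongrightarrow> e c) (at 0)" by (simp add: DERIV_def)
    from filterlim_compose[OF this hat] show ?thesis .
  qed
  have "(\<lambda>n. integral {a..b} (g n)) \<longlonglongrightarrow> e b - e a"
    unfolding integral_unique[OF gI] by (intro tendsto_diff q) (use ab in auto)
  then have "integral {a..b} f' = e b - e a" using bc(2) LIMSEQ_unique by blast
  then have "integral {a..b} f' = f b - f a" using ab by (simp add: e_def)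
  with integrable_integral[OF bc(1)] show ?thesis by simp
qed

lemma Lipschitz_bound_from_AE_deriv:
  fixes f f' :: "real \<Rightarrow> real" and a b :: real
  assumes "a \<le> b" "L-lipschitz_on {a..b} f"
    and "AE x in lborel. x \<in> {a<..<b} \<longrightarrow> (f has_real_derivative f' x) (at x) \<and> f' x \<le> C"
  shows "f b - f a \<le> C * (b - a)"
proof -
  have 1: "(f' has_integral (f b - f a)) {a..b}"
    by (rule Lipschitz_FTC[OF assms(1,2)]) (use assms(3) in \<open>auto elim: eventually_mono\<close>)
  obtain N where N: "negligible N" "\<And>x. x \<notin> N \<Longrightarrow> x \<in> {a<..<b} \<longrightarrow> f' x \<le> C"
    using AE_lborel_negligible[of "\<lambda>x. x \<in> {a<..<b} \<longrightarrow> f' x \<le> C"] assms(3)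
    by (smt (verit, ccfv_threshold) eventually_mono)
  have "((\<lambda>x. if x \<in> N \<union> {a, b} then C else f' x) has_integral (f b - f a)) {a..b}"
    by (rule has_integral_spike[OF _ _ 1, of "N \<union> {a,b}"]) (use N(1) in auto)
  moreover have "((\<lambda>x. C) has_integral C * (b - a)) {a..b}"
    using has_integral_const_real[of C a b] assms(1) by (simp add: mult.commute)
  ultimately show ?thesis
    by (rule has_integral_le) (use N(2) in force)
qed

text \<open>The integrand is the integral of the symmetric function \<open>u x * u s\<close> over one of the two triangles into
  which the diagonal divides the square, hence half of the integral over the square.\<close>

lemma integral_square_triangle:
  fixes u :: "real \<Rightarrow> real" and a b :: real
  assumes u[measurable]: "u \<in> borel_measurable borel" and C: "\<And>x. \<bar>u x\<bar> \<le> C" and ab: "a \<le> b"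
  shows "integral {a..b} (\<lambda>x. u x * integral {x..b} u) = (integral {a..b} u)\<^sup>2 / 2"
proof -
  have ui: "u integrable_on {c..d}" for c d :: real
    by (rule bounded_borel_integrable_on[OF u _ C]) simp
  define f where "f = (\<lambda>p::real \<times> real. if fst p \<le> snd p then u (fst p) * u (snd p) else 0)"
  have cm: "(\<lambda>p::real\<times>real. fst p) \<in> borel_measurable borel" "(\<lambda>p::real\<times>real. snd p) \<in> borel_measurable borel"
    by (intro borel_measurable_continuous_onI continuous_intros)+
  have fm: "f \<in> borel_measurable borel"
  proof -
    have "(\<lambda>p::real \<times> real. u (fst p) * u (snd p)) \<in> borel_measurable borel"
      by (intro borel_measurable_times measurable_compose[OF cm(1) u] measurable_compose[OF cm(2) u])
    moreover have "{p::real\<times>real. fst p \<le> snd p} \<in> sets borel"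
      by (intro borel_closed closed_Collect_le continuous_intros)
    ultimately show ?thesis unfolding f_def by (intro measurable_If) auto
  qed
  have fb: "\<bar>f p\<bar> \<le> C * C" for p
    using C[of "fst p"] C[of "snd p"] by (auto simp: f_def abs_mult intro!: mult_mono)
  have i1: "integral {a..b} (\<lambda>y. f (x, y)) = u x * integral {x..b} u" if "x \<in> {a..b}" for x
  proof -
    have "integral {a..b} (\<lambda>y. f (x, y)) = integral {a..b} (\<lambda>y. if y \<in> {x..b} then u x * u y else 0)"
      by (rule Henstock_Kurzweil_Integration.integral_cong) (auto simp: f_def)
    also have "\<dots> = integral ({x..b} \<inter> {a..b}) (\<lambda>y. u x * u y)"
      by (rule integral_restrict_Int)
    also have "{x..b} \<inter> {a..b} = {x..b}" using that by auto
    finally show ?thesis by simp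
  qed
  have i2: "integral {a..b} (\<lambda>x. f (x, y)) = u y * (integral {a..b} u - integral {y..b} u)" if "y \<in> {a..b}" for y
  proof -
    have "integral {a..b} (\<lambda>x. f (x, y)) = integral {a..b} (\<lambda>x. if x \<in> {a..y} then u x * u y else 0)"
      by (rule Henstock_Kurzweil_Integration.integral_cong) (auto simp: f_def)
    also have "\<dots> = integral ({a..y} \<inter> {a..b}) (\<lambda>x. u x * u y)"
      by (rule integral_restrict_Int)
    also have "{a..y} \<inter> {a..b} = {a..y}" using that by auto
    also have "integral {a..y} (\<lambda>x. u x * u y) = u y * integral {a..y} u" by simp
    also have "integral {a..y} u = integral {a..b} u - integral {y..b} u"
      using Henstock_Kurzweil_Integration.integral_combine[of a y b u] ui that by simp
    finally show ?thesis .
  qed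
  note F = Fubini_rectangle[OF fm, of a b a b, OF fb]
  let ?I = "integral {a..b} (\<lambda>x. u x * integral {x..b} u)"
  have J: "(\<lambda>x. u x * integral {x..b} u) integrable_on {a..b}"
    using F(4) by (rule integrable_eq) (use i1 in auto)
  have "?I = integral ({a..b} \<times> {a..b}) f"
    unfolding F(2) by (rule Henstock_Kurzweil_Integration.integral_cong) (use i1 in auto)
  also have "\<dots> = integral {a..b} (\<lambda>y. u y * integral {a..b} u - u y * integral {y..b} u)"
    unfolding F(3) by (rule Henstock_Kurzweil_Integration.integral_cong) (use i2 in \<open>auto simp: algebra_simps\<close>)
  also have "\<dots> = integral {a..b} u * integral {a..b} u - ?I"
    using J ui by (simp add: Henstock_Kurzweil_Integration.integral_diff integrable_on_mult_left)
  finally show ?thesis by (simp add: power2_eq_square)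
qed

text \<open>The Cauchy--Schwarz inequality against a constant: the variance of \<open>f\<close> is nonnegative.\<close>

lemma integral_power2_le:
  fixes f :: "real \<Rightarrow> real" and a b :: real
  assumes ab: "a \<le> b" and f: "f integrable_on {a..b}" and f2: "(\<lambda>x. (f x)\<^sup>2) integrable_on {a..b}"
  shows "(integral {a..b} f)\<^sup>2 \<le> (b - a) * integral {a..b} (\<lambda>x. (f x)\<^sup>2)"
proof (cases "a = b")
  case False
  with ab have "a < b" by simp
  define m where "m = integral {a..b} f / (b - a)"
  have c: "((\<lambda>x. m\<^sup>2) has_integral m\<^sup>2 * (b - a)) {a..b}"
    using has_integral_const_real[of "m\<^sup>2" a b] ab by (simp add: mult.commute)
  have "((\<lambda>x. (f x)\<^sup>2 - 2 * m * f x + m\<^sup>2) has_integral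
      (integral {a..b} (\<lambda>x. (f x)\<^sup>2) - 2 * m * integral {a..b} f + m\<^sup>2 * (b - a))) {a..b}"
    using f f2 c by (intro has_integral_add has_integral_diff has_integral_mult_right integrable_integral) auto
  moreover have "((\<lambda>x. (f x)\<^sup>2 - 2 * m * f x + m\<^sup>2) = (\<lambda>x. (f x - m)\<^sup>2))"
    by (auto simp: power2_eq_square algebra_simps)
  ultimately have "0 \<le> integral {a..b} (\<lambda>x. (f x)\<^sup>2) - 2 * m * integral {a..b} f + m\<^sup>2 * (b - a)"
    by (auto intro: has_integral_nonneg)
  then have "0 \<le> (b - a) * (integral {a..b} (\<lambda>x. (f x)\<^sup>2) - 2 * m * integral {a..b} f + m\<^sup>2 * (b - a))"
    using ab by simp
  also have "\<dots> = (b - a) * integral {a..b} (\<lambda>x. (f x)\<^sup>2) - (integral {a..b} f)\<^sup>2"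
  proof -
    have I: "integral {a..b} f = m * (b - a)" using \<open>a < b\<close> by (simp add: m_def)
    show ?thesis unfolding I by (simp add: power2_eq_square algebra_simps)
  qed
  finally show ?thesis by simp
qed simp

section \<open>Primitives on a rectangle\<close>

text \<open>Rescaling the interval of integration to \<open>[0, 1]\<close> turns the variable end point into a parameter of the
  integrand.\<close>

lemma continuous_on_integral_upper:
  fixes g :: "real \<times> 'a::topological_space \<Rightarrow> real"
  assumes g: "continuous_on UNIV g"
  shows "continuous_on ({0..} \<times> UNIV) (\<lambda>p. integral {0..fst p} (\<lambda>s. g (s, snd p)))"
proof -
  have "integral {0..x} (\<lambda>s. g (s, y)) = x * integral {0..1} (\<lambda>t. g (x * t, y))" if "0 \<le> x" for x :: real and y
  proof (cases "x = 0")
    case False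
    then have "0 < x" using that by simp
    have "continuous_on {0..x} (\<lambda>s. g (s, y))"
      by (rule continuous_on_compose2[OF g]) (auto intro!: continuous_intros)
    then have "((\<lambda>s. g (s, y)) has_integral integral {0..x} (\<lambda>s. g (s, y))) (cbox 0 x)"
      using integrable_continuous_real integrable_integral by fastforce
    from has_integral_affinity[OF this, of x 0]
    have "((\<lambda>t. g (x * t, y)) has_integral (1 / x) * integral {0..x} (\<lambda>s. g (s, y))) {0..1}"
      using \<open>0 < x\<close> by (simp add: image_divide_atLeastAtMost mult.commute)
    from integral_unique[OF this] show ?thesis using \<open>0 < x\<close> by (simp add: field_simps)
  qed simp
  moreover have "continuous_on ({0..} \<times> UNIV) (\<lambda>p::real\<times>'a. fst p * integral (cbox 0 1) (\<lambda>t. g (fst p * t, snd p)))"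
    by (intro continuous_intros integral_continuous_on_param continuous_on_compose2[OF g])
      (auto intro!: continuous_intros continuous_on_compose2[OF g] simp: split_beta)
  ultimately show ?thesis
    by (auto elim!: continuous_on_eq)
qed

lemma integral_upper_has_derivative:
  fixes g :: "real \<Rightarrow> real"
  assumes "continuous_on UNIV g" "0 \<le> x"
  shows "((\<lambda>x. integral {0..x} g) has_real_derivative g x) (at x within {0..})"
proof -
  have "((\<lambda>x. integral {0..x} g) has_real_derivative g x) (at x within {0..x+1})"
    by (rule integral_has_real_derivative) (use assms in \<open>auto intro: continuous_on_subset\<close>)
  moreover have "at x within {0..x+1} = at x within {0..}"
    by (rule at_within_nhd[of x "{..<x+1}"]) auto
  ultimately show ?thesis by simp
qed

lemma rectangle_primitive_has_derivative:
  fixes g :: "real \<times> real \<Rightarrow> real"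
  assumes g: "continuous_on UNIV g" and xy: "0 \<le> x" "0 \<le> y"
  shows "((\<lambda>p. integral {0..fst p} (\<lambda>s. integral {0..snd p} (\<lambda>t. g (s, t)))) has_derivative
    (\<lambda>h. integral {0..y} (\<lambda>t. g (x, t)) * fst h + integral {0..x} (\<lambda>s. g (s, y)) * snd h))
    (at (x, y) within {0..} \<times> {0..})"
proof -
  let ?F = "\<lambda>x y. integral {0..x} (\<lambda>s. integral {0..y} (\<lambda>t. g (s, t)))"
  have g1: "continuous_on UNIV (\<lambda>s. g (s, y))" for y
    by (rule continuous_on_compose2[OF g]) (auto intro!: continuous_intros)
  have g2: "continuous_on UNIV (\<lambda>t. g (s, t))" for s
    by (rule continuous_on_compose2[OF g]) (auto intro!: continuous_intros)
  have swap: "?F x y = integral {0..y} (\<lambda>t. integral {0..x} (\<lambda>s. g (s, t)))" for x y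
    using integral_swap_continuous[of 0 0 x y "\<lambda>s t. g (s, t)"] continuous_on_subset[OF g] by simp
  have c1: "continuous_on UNIV (\<lambda>s. integral {0..y} (\<lambda>t. g (s, t)))" for y
  proof -
    have "continuous_on UNIV (\<lambda>s. integral (cbox 0 y) (\<lambda>t. g (s, t)))"
      by (intro integral_continuous_on_param) (auto intro: continuous_on_subset[OF g] simp: case_prod_beta')
    then show ?thesis by simp
  qed
  have c2: "continuous_on UNIV (\<lambda>t. integral {0..x} (\<lambda>s. g (s, t)))" for x
  proof -
    have "continuous_on UNIV (\<lambda>t. integral (cbox 0 x) (\<lambda>s. g (s, t)))"
      by (intro integral_continuous_on_param) (auto intro!: continuous_on_compose2[OF g] continuous_intros simp: case_prod_beta')
    then show ?thesis by simp
  qed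
  have d1: "((\<lambda>x. ?F x y) has_derivative (*) (integral {0..y} (\<lambda>t. g (x, t)))) (at x within {0..})"
    using integral_upper_has_derivative[OF c1 xy(1), of y] by (simp add: has_field_derivative_def)
  define D where "D = (\<lambda>x y. blinfun_mult_right (integral {0..x} (\<lambda>s. g (s, y))))"
  have d2: "((\<lambda>y. ?F x y) has_derivative blinfun_apply (D x y)) (at y within {0..})" if "y \<in> {0..}" for x y
    using integral_upper_has_derivative[OF c2, of y x] that
    by (simp add: swap has_field_derivative_def D_def blinfun_mult_right.rep_eq)
  have Dc: "continuous (at (x, y) within {0..} \<times> {0..}) (\<lambda>(x, y). D x y)"
  proof -
    have "continuous_on ({0..} \<times> {0..}) (\<lambda>p::real\<times>real. blinfun_mult_right (integral {0..fst p} (\<lambda>s. g (s, snd p))))"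
      by (intro bounded_linear.continuous_on[OF bounded_linear_blinfun_mult_right]
          continuous_on_subset[OF continuous_on_integral_upper[OF g]]) auto
    then show ?thesis using xy
      by (auto simp: continuous_on_eq_continuous_within D_def case_prod_beta')
  qed
  have "((\<lambda>(x, y). ?F x y) has_derivative (\<lambda>(tx, ty). integral {0..y} (\<lambda>t. g (x, t)) * tx + D x y ty))
     (at (x, y) within {0..} \<times> {0..})"
    by (rule has_derivative_partialsI[OF d1 d2 Dc]) (use xy in auto)
  then show ?thesis by (simp add: case_prod_beta' D_def blinfun_mult_right.rep_eq)
qed

section \<open>Slopes of chords\<close>

text \<open>The slope of the chord of the curve \<open>(\<beta>, \<alpha>)\<close> between two parameters; on the diagonal it is the slope
  \<open>n\<close> of the tangent.\<close>

definition chord_slope :: "(real \<Rightarrow> real) \<Rightarrow> (real \<Rightarrow> real) \<Rightarrow> (real \<Rightarrow> real) \<Rightarrow> real \<Rightarrow> real \<Rightarrow> real" where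
  "chord_slope \<alpha> \<beta> n u v = (if u = v then n u else (\<alpha> u - \<alpha> v) / (\<beta> u - \<beta> v))"

text \<open>When the slope of the tangent increases, the curve is the graph of a convex function, and the slope of a
  chord of a convex function increases with both end points. Cauchy's mean value theorem places each
  slope between the slopes of the tangents at the ends; the slope of a long chord is a weighted mean of
  the slopes of its parts.\<close>

lemma chord_slope_mono:
  fixes \<alpha> \<beta> \<beta>' n :: "real \<Rightarrow> real" and I :: "real set"
  assumes I: "\<And>u v x. u \<in> I \<Longrightarrow> v \<in> I \<Longrightarrow> u \<le> x \<Longrightarrow> x \<le> v \<Longrightarrow> x \<in> I"
    and \<beta>: "\<And>x. x \<in> I \<Longrightarrow> (\<beta> has_real_derivative \<beta>' x) (at x)" "\<And>x. x \<in> I \<Longrightarrow> 0 < \<beta>' x"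
    and \<alpha>: "\<And>x. x \<in> I \<Longrightarrow> (\<alpha> has_real_derivative n x * \<beta>' x) (at x)"
    and n: "\<And>x y. x \<in> I \<Longrightarrow> y \<in> I \<Longrightarrow> x \<le> y \<Longrightarrow> n x \<le> n y"
    and u: "u \<in> I" "u' \<in> I" "u \<le> u'" and v: "v \<in> I" "v' \<in> I" "v \<le> v'"
  shows "chord_slope \<alpha> \<beta> n u v \<le> chord_slope \<alpha> \<beta> n u' v'"
proof -
  let ?e = "chord_slope \<alpha> \<beta> n"
  have pos: "\<beta> x < \<beta> y" if "x \<in> I" "y \<in> I" "x < y" for x y
  proof (rule DERIV_pos_imp_increasing[OF that(3)])
    fix z assume "x \<le> z" "z \<le> y"
    then have "z \<in> I" by (rule I[OF that(1,2)])
    then show "\<exists>d. (\<beta> has_real_derivative d) (at z) \<and> 0 < d" using \<beta> by blast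
  qed
  have inc: "\<alpha> y - \<alpha> x = ?e x y * (\<beta> y - \<beta> x)" if "x \<in> I" "y \<in> I" "x \<le> y" for x y
    using pos[OF that(1,2)] that(3) by (cases "x = y") (auto simp: chord_slope_def field_simps)
  have mid: "n x \<le> ?e x y" "?e x y \<le> n y" if "x \<in> I" "y \<in> I" "x \<le> y" for x y
  proof -
    have "n x \<le> ?e x y \<and> ?e x y \<le> n y"
    proof (cases "x = y")
      case False
      with that have xy: "x < y" by simp
      have J: "z \<in> I" if "x \<le> z" "z \<le> y" for z using I[OF \<open>x \<in> I\<close> \<open>y \<in> I\<close> that] .
      have "\<exists>z>x. z < y \<and> (\<beta> y - \<beta> x) * (n z * \<beta>' z) = (\<alpha> y - \<alpha> x) * \<beta>' z"
      proof (rule GMVT'[where f = \<beta> and g = \<alpha> and g' = "\<lambda>z. n z * \<beta>' z" and f' = \<beta>', OF xy])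
        fix z assume "x \<le> z" "z \<le> y"
        then have "z \<in> I" by (rule J)
        then show "isCont \<alpha> z" "isCont \<beta> z" by (rule DERIV_isCont[OF \<alpha>], rule DERIV_isCont[OF \<beta>(1)])
      next
        fix z assume "x < z" "z < y"
        then have "z \<in> I" using J by simp
        then show "(\<beta> has_real_derivative \<beta>' z) (at z)" "(\<alpha> has_real_derivative n z * \<beta>' z) (at z)"
          by (rule \<beta>(1), rule \<alpha>)
      qed
      then obtain z where z: "x < z" "z < y" "(\<beta> y - \<beta> x) * (n z * \<beta>' z) = (\<alpha> y - \<alpha> x) * \<beta>' z"
        by blast
      have zI: "z \<in> I" using J[of z] z by simp
      have "(\<beta> y - \<beta> x) * n z * \<beta>' z = (\<alpha> y - \<alpha> x) * \<beta>' z" using z(3) by (simp only: mult.assoc)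
      then have "(\<beta> y - \<beta> x) * n z = \<alpha> y - \<alpha> x" using \<beta>(2)[OF zI] by simp
      then have "(\<beta> y - \<beta> x) * n z = (\<beta> y - \<beta> x) * ?e x y" using inc[OF that] by (simp only: mult.commute)
      then have "?e x y = n z" using pos[OF that(1,2) xy] by simp
      then show ?thesis using n[OF that(1) zI] n[OF zI that(2)] z by simp
    qed (simp add: chord_slope_def)
    then show "n x \<le> ?e x y" "?e x y \<le> n y" by (rule conjunct1, rule conjunct2)
  qed
  have sym: "?e x y = ?e y x" for x y
    using minus_divide_divide[of "\<alpha> x - \<alpha> y" "\<beta> x - \<beta> y"] by (simp add: chord_slope_def)
  have one: "?e x v \<le> ?e y v" if xy: "x \<in> I" "y \<in> I" "x \<le> y" and v: "v \<in> I" for x y v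
  proof -
    consider "v \<le> x" | "x \<le> v" "v \<le> y" | "y \<le> v" by linarith
    then show ?thesis
    proof cases
      case 1
      have s: "v \<le> y" using 1 xy by simp
      have "?e v x * (\<beta> y - \<beta> v) \<le> ?e v y * (\<beta> y - \<beta> v)"
      proof -
        have "?e v x * (\<beta> y - \<beta> x) \<le> ?e x y * (\<beta> y - \<beta> x)"
          using mid(2)[OF v xy(1) 1] mid(1)[OF xy] pos[OF xy(1,2)] xy(3)
          by (intro mult_right_mono) (auto simp: le_less)
        then show ?thesis using inc[OF v xy(1) 1] inc[OF xy] inc[OF v xy(2) s] by (simp add: algebra_simps)
      qed
      then have "?e v x \<le> ?e v y"
        using pos[OF v xy(2)] s 1 xy by (cases "v = y") auto
      then show ?thesis by (simp add: sym[of _ v])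
    next
      case 2
      then show ?thesis using mid(2)[of x v] mid(1)[of v y] sym[of y v] xy v by simp
    next
      case 3
      have s: "x \<le> v" using 3 xy by simp
      have "?e x v * (\<beta> v - \<beta> x) \<le> ?e y v * (\<beta> v - \<beta> x)"
      proof -
        have "?e x y * (\<beta> y - \<beta> x) \<le> ?e y v * (\<beta> y - \<beta> x)"
          using mid(1)[OF xy(2) v 3] mid(2)[OF xy] pos[OF xy(1,2)] xy(3)
          by (intro mult_right_mono) (auto simp: le_less)
        then show ?thesis using inc[OF xy(2) v 3] inc[OF xy] inc[OF xy(1) v s] by (simp add: algebra_simps)
      qed
      then show ?thesis using pos[OF xy(1) v] s 3 xy by (cases "x = v") auto
    qed
  qed
  have "?e u v \<le> ?e u' v" using one u v by blast
  also have "\<dots> = ?e v u'" by (rule sym)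
  also have "\<dots> \<le> ?e v' u'" using one u v by blast
  finally show ?thesis by (simp add: sym)
qed

section \<open>The gas law\<close>

locale gas_law =
  fixes \<gamma> :: real
  assumes gamma: "\<gamma> > 1"
begin

abbreviation "c \<equiv> c_star \<gamma>"
abbreviation "qm \<equiv> q_max \<gamma>"

text \<open>The squared speed of sound: \<open>bernoulli q = dens q powr (\<gamma> - 1)\<close>.\<close>

definition bernoulli :: "real \<Rightarrow> real" where
  "bernoulli q = 1 - (\<gamma> - 1) / 2 * q\<^sup>2"

definition dens :: "real \<Rightarrow> real" where
  "dens q = bernoulli q powr (1 / (\<gamma> - 1))"

text \<open>Positive exactly at supersonic speeds.\<close>

definition excess :: "real \<Rightarrow> real" where
  "excess q = (\<gamma> + 1) / 2 * q\<^sup>2 - 1"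

lemma c_pos: "0 < c" and c2: "c\<^sup>2 = 2 / (\<gamma> + 1)"
  and qm_pos: "0 < qm" and qm2: "qm\<^sup>2 = 2 / (\<gamma> - 1)" and c_less_qm: "c < qm"
  using gamma by (auto simp: c_star_def q_max_def field_simps)

lemma bernoulli_pos: "0 \<le> q \<Longrightarrow> q < qm \<Longrightarrow> 0 < bernoulli q"
proof -
  assume "0 \<le> q" "q < qm"
  then have "q\<^sup>2 < 2 / (\<gamma> - 1)" unfolding qm2[symmetric] by (intro power_strict_mono) auto
  then show ?thesis using gamma by (simp add: bernoulli_def field_simps)
qed

lemma bernoulli_le_1: "bernoulli q \<le> 1" using gamma by (simp add: bernoulli_def)

lemma bernoulli_antimono: "0 \<le> p \<Longrightarrow> p \<le> q \<Longrightarrow> bernoulli q \<le> bernoulli p"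
  using gamma by (auto simp: bernoulli_def intro!: mult_left_mono power_mono)

lemma dens_pos: "0 \<le> q \<Longrightarrow> q < qm \<Longrightarrow> 0 < dens q"
  using bernoulli_pos[of q] by (simp add: dens_def)

lemma dens_le_1: "0 \<le> q \<Longrightarrow> q < qm \<Longrightarrow> dens q \<le> 1"
  using bernoulli_pos[of q] bernoulli_le_1[of q] gamma by (auto simp: dens_def intro!: powr_le1)

lemma dens_antimono: "0 \<le> p \<Longrightarrow> p \<le> q \<Longrightarrow> q < qm \<Longrightarrow> dens q \<le> dens p"
  using bernoulli_pos[of q] bernoulli_antimono[of p q] gamma by (auto simp: dens_def intro!: powr_mono2)

lemma rho_sq: "\<rho> \<gamma> (q\<^sup>2) = dens q"
  by (simp add: \<rho>_def dens_def bernoulli_def)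

lemma excess_factor: "excess q = (\<gamma> + 1) / 2 * (q - c) * (q + c)"
proof -
  have "(q - c) * (q + c) = q\<^sup>2 - c\<^sup>2" by (simp add: power2_eq_square algebra_simps)
  then have "(\<gamma> + 1) / 2 * (q - c) * (q + c) = (\<gamma> + 1) / 2 * (q\<^sup>2 - c\<^sup>2)" by (simp add: mult.assoc)
  also have "\<dots> = excess q" unfolding c2 using gamma by (simp add: excess_def right_diff_distrib)
  finally show ?thesis by simp
qed

lemma excess_pos: "c < q \<Longrightarrow> 0 < excess q" and excess_nonneg: "c \<le> q \<Longrightarrow> 0 \<le> excess q"
  using gamma c_pos by (auto simp: excess_factor)

lemma excess_mono: "0 \<le> p \<Longrightarrow> p \<le> q \<Longrightarrow> excess p \<le> excess q"
  using gamma by (auto simp: excess_def intro!: mult_left_mono power_mono)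

lemma bernoulli_deriv: "(bernoulli has_real_derivative - ((\<gamma> - 1) * q)) (at q)"
  unfolding bernoulli_def by (auto intro!: derivative_eq_intros)

lemma dens_deriv:
  assumes "0 \<le> q" "q < qm"
  shows "(dens has_real_derivative - q * dens q / bernoulli q) (at q)"
proof -
  have bp: "0 < bernoulli q" by (rule bernoulli_pos[OF assms])
  have "(dens has_real_derivative 1 / (\<gamma> - 1) * bernoulli q powr (1 / (\<gamma> - 1) - 1) * - ((\<gamma> - 1) * q)) (at q)"
    unfolding dens_def by (rule DERIV_chain2[OF has_real_derivative_powr[OF bp] bernoulli_deriv])
  then show ?thesis using bp gamma unfolding powr_diff by (simp add: dens_def mult.commute)
qed

text \<open>The negative of the derivative of \<open>A\<close>, which vanishes at the sonic speed to first order only.\<close>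

definition dA :: "real \<Rightarrow> real" where
  "dA q = excess q / (q * bernoulli q * dens q)"

lemma A_integrand:
  assumes "0 < q" "q < qm"
  shows "(\<rho> \<gamma> (q\<^sup>2) + 2 * q\<^sup>2 * deriv (\<rho> \<gamma>) (q\<^sup>2)) / (q * (\<rho> \<gamma> (q\<^sup>2))\<^sup>2) = - dA q"
proof -
  have bp: "0 < bernoulli q" using bernoulli_pos assms by simp
  have "(\<rho> \<gamma> has_real_derivative - (dens q / (2 * bernoulli q))) (at (q\<^sup>2))"
  proof -
    have bp': "0 < 1 - (\<gamma> - 1) / 2 * q\<^sup>2" using bp by (simp add: bernoulli_def)
    have "((\<lambda>t. 1 - (\<gamma> - 1) / 2 * t) has_real_derivative - ((\<gamma> - 1) / 2)) (at (q\<^sup>2))"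
      by (auto intro!: derivative_eq_intros)
    then have "(\<rho> \<gamma> has_real_derivative 1 / (\<gamma> - 1) * (1 - (\<gamma> - 1) / 2 * q\<^sup>2) powr (1 / (\<gamma> - 1) - 1) * - ((\<gamma> - 1) / 2))
        (at (q\<^sup>2))"
      unfolding \<rho>_def[abs_def] by (rule DERIV_chain2[where g = "\<lambda>t. 1 - (\<gamma> - 1) / 2 * t", OF has_real_derivative_powr[OF bp']])
    then show ?thesis using bp gamma unfolding powr_diff bernoulli_def[symmetric] dens_def by (simp add: mult.commute)
  qed
  then have d: "deriv (\<rho> \<gamma>) (q\<^sup>2) = - (dens q / (2 * bernoulli q))" by (rule DERIV_imp_deriv)
  have dp: "0 < dens q" using dens_pos assms by simp
  have "bernoulli q - q\<^sup>2 = - excess q" by (simp add: bernoulli_def excess_def field_simps)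
  moreover have "dens q + 2 * q\<^sup>2 * - (dens q / (2 * bernoulli q)) = dens q * (bernoulli q - q\<^sup>2) / bernoulli q"
    using bp by (simp add: field_simps)
  ultimately have N: "dens q + 2 * q\<^sup>2 * - (dens q / (2 * bernoulli q)) = - (dens q * excess q / bernoulli q)"
    by simp
  have "(dens q * excess q / bernoulli q) / (q * (dens q)\<^sup>2) = dA q"
    using dp by (simp add: dA_def power2_eq_square field_simps)
  then show ?thesis unfolding rho_sq d N by simp
qed

lemma continuous_on_bernoulli: "continuous_on S bernoulli"
  unfolding bernoulli_def by (intro continuous_intros)

lemma continuous_on_dens: "S \<subseteq> {0..<qm} \<Longrightarrow> continuous_on S dens"
  by (intro continuous_at_imp_continuous_on ballI DERIV_isCont[OF dens_deriv]) auto

lemma interval_primitive_deriv: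
  assumes f: "continuous_on {0<..<qm} f" and q: "0 < q" "q < qm"
  shows "((\<lambda>q. LBINT s=c..q. f s) has_real_derivative f q) (at q)"
proof -
  define u v where "u = min q c / 2" and "v = (max q c + qm) / 2"
  have uv: "0 < u" "v < qm" "u < q" "q < v" "u < c" "c < v"
    using q c_pos c_less_qm by (auto simp: u_def v_def)
  have cf: "continuous_on {u..v} f" by (rule continuous_on_subset[OF f]) (use uv in auto)
  have "((\<lambda>q. LBINT s=c..q. f s) has_vector_derivative f q) (at q within {u..v})"
    by (rule interval_integral_FTC2[OF _ _ cf]) (use uv in auto)
  then show ?thesis using uv at_within_Icc_at[of u q v]
    by (simp add: has_real_derivative_iff_has_vector_derivative)
qed

lemma A_deriv: "0 < q \<Longrightarrow> q < qm \<Longrightarrow> (A \<gamma> has_real_derivative - dA q) (at q)"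
proof -
  assume q: "0 < q" "q < qm"
  let ?F = "\<lambda>q. (\<rho> \<gamma> (q\<^sup>2) + 2 * q\<^sup>2 * deriv (\<rho> \<gamma>) (q\<^sup>2)) / (q * (\<rho> \<gamma> (q\<^sup>2))\<^sup>2)"
  have "continuous_on {0<..<qm} (\<lambda>q. - dA q)"
    unfolding dA_def excess_def
  proof (intro continuous_intros continuous_on_bernoulli continuous_on_dens ballI)
    fix x assume "x \<in> {0<..<qm}"
    then show "x * bernoulli x * dens x \<noteq> 0" using bernoulli_pos[of x] dens_pos[of x] by simp
  qed auto
  then have "continuous_on {0<..<qm} ?F" by (rule continuous_on_eq) (simp add: A_integrand)
  from interval_primitive_deriv[OF this q] show ?thesis
    using A_integrand[OF q] by (simp add: A_def[abs_def])
qed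

lemma B_deriv: "0 < q \<Longrightarrow> q < qm \<Longrightarrow> (B \<gamma> has_real_derivative dens q / q) (at q)"
proof -
  assume q: "0 < q" "q < qm"
  have "continuous_on {0<..<qm} (\<lambda>q. dens q / q)"
    by (intro continuous_intros continuous_on_dens) auto
  from interval_primitive_deriv[OF this q] show ?thesis
    by (simp add: B_def[abs_def] rho_sq)
qed

lemma A_c: "A \<gamma> c = 0" by (simp add: A_def)

lemma dA_pos: "c < q \<Longrightarrow> q < qm \<Longrightarrow> 0 < dA q"
  using excess_pos[of q] bernoulli_pos[of q] dens_pos[of q] c_pos by (simp add: dA_def)

lemma A_strict_antimono: "c \<le> p \<Longrightarrow> p < q \<Longrightarrow> q < qm \<Longrightarrow> A \<gamma> q < A \<gamma> p"
proof -
  assume h: "c \<le> p" "p < q" "q < qm"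
  have "\<exists>y. (A \<gamma> has_real_derivative y) (at x) \<and> y < 0" if "p < x" "x < q" for x
    using A_deriv[of x] dA_pos[of x] h that c_pos by (intro exI[of _ "- dA x"]) auto
  moreover have "continuous_on {p..q} (A \<gamma>)"
    using h c_pos by (intro continuous_at_imp_continuous_on ballI DERIV_isCont[OF A_deriv]) auto
  ultimately show ?thesis using DERIV_neg_imp_decreasing_open[OF h(2), of "A \<gamma>"] by blast
qed

lemma A_continuous: "continuous_on {c..<qm} (A \<gamma>)"
  using c_pos by (intro continuous_at_imp_continuous_on ballI DERIV_isCont[OF A_deriv]) auto

text \<open>Near the maximal speed the derivative of \<open>A\<close> is at most a negative multiple of \<open>q / bernoulli q\<close>, which is the
  derivative of a multiple of \<open>- ln (bernoulli q)\<close>, and the logarithm is unbounded.\<close>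

lemma A_unbounded: "\<exists>q. c \<le> q \<and> q < qm \<and> A \<gamma> q \<le> s"
proof -
  define q0 where "q0 = (c + qm) / 2"
  have q0: "c < q0" "q0 < qm" "0 < q0" using c_less_qm c_pos by (auto simp: q0_def)
  define k where "k = excess q0 / qm\<^sup>2"
  have k: "0 < k" using excess_pos[OF q0(1)] qm_pos by (simp add: k_def)
  have key: "A \<gamma> q - k / (\<gamma> - 1) * ln (bernoulli q) \<le> A \<gamma> q0 - k / (\<gamma> - 1) * ln (bernoulli q0)"
    if q: "q0 \<le> q" "q < qm" for q
  proof (rule DERIV_nonpos_imp_nonincreasing[OF q(1)])
    fix x assume x: "q0 \<le> x" "x \<le> q"
    have bp: "0 < bernoulli x" "bernoulli x \<le> 1" "0 < dens x" "dens x \<le> 1"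
      using bernoulli_pos[of x] bernoulli_le_1 dens_pos[of x] dens_le_1[of x] x q q0 by auto
    have "((\<lambda>q. A \<gamma> q - k / (\<gamma> - 1) * ln (bernoulli q)) has_real_derivative
        - dA x - k / (\<gamma> - 1) * (1 / bernoulli x * - ((\<gamma> - 1) * x))) (at x)"
      using bp x q q0 by (intro DERIV_diff A_deriv DERIV_cmult DERIV_chain2[OF DERIV_ln_divide bernoulli_deriv]) auto
    moreover have "- dA x - k / (\<gamma> - 1) * (1 / bernoulli x * - ((\<gamma> - 1) * x)) \<le> 0"
    proof -
      have "k * x / bernoulli x \<le> dA x"
      proof -
        have "k * x * x \<le> excess q0"
        proof -
          have "x * x \<le> qm\<^sup>2" using x q q0 by (auto simp: power2_eq_square intro!: mult_mono)
          then have "k * (x * x) \<le> k * qm\<^sup>2" using k by (intro mult_left_mono) auto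
          then show ?thesis using qm_pos by (simp add: k_def mult.assoc)
        qed
        also have "\<dots> \<le> excess x" using excess_mono x q0 by simp
        also have "\<dots> \<le> excess x / dens x"
          using bp excess_nonneg[of x] x q0 by (simp add: pos_le_divide_eq mult_left_le)
        finally have "k * x * x / (x * bernoulli x) \<le> (excess x / dens x) / (x * bernoulli x)"
          using bp x q0 by (intro divide_right_mono) auto
        moreover have "k * x * x / (x * bernoulli x) = k * x / bernoulli x" using x q0 by simp
        moreover have "(excess x / dens x) / (x * bernoulli x) = dA x"
          by (simp add: dA_def mult_ac)
        ultimately show ?thesis by simp
      qed
      moreover have "k / (\<gamma> - 1) * (1 / bernoulli x * - ((\<gamma> - 1) * x)) = - (k * x / bernoulli x)"
        using gamma by simp
      ultimately show ?thesis by linarith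
    qed
    ultimately show "\<exists>y. ((\<lambda>q. A \<gamma> q - k / (\<gamma> - 1) * ln (bernoulli q)) has_real_derivative y) (at x) \<and> y \<le> 0"
      by blast
  qed
  define t where "t = max 0 ((A \<gamma> q0 - s) * (\<gamma> - 1) / k)"
  define d where "d = bernoulli q0 * exp (- t)"
  have b0: "0 < bernoulli q0" using bernoulli_pos q0 by simp
  have d: "0 < d" "d \<le> bernoulli q0" using b0 by (auto simp: d_def t_def)
  define q where "q = sqrt ((1 - d) * 2 / (\<gamma> - 1))"
  have d1: "d \<le> 1" using d bernoulli_le_1[of q0] by simp
  have q2: "q\<^sup>2 = (1 - d) * 2 / (\<gamma> - 1)" using d1 gamma by (simp add: q_def)
  have bq: "bernoulli q = d" 
  proof -
    have "1 - g / 2 * ((1 - d) * 2 / g) = d" if "g \<noteq> 0" for g :: real using that by simp (simp add: diff_divide_distrib)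
    moreover have "\<gamma> - 1 \<noteq> 0" using gamma by simp
    ultimately show ?thesis unfolding bernoulli_def q2 by blast
  qed
  have "q < qm"
  proof -
    have "(1 - d) * 2 / (\<gamma> - 1) < 2 / (\<gamma> - 1)" using d gamma by (intro divide_strict_right_mono) auto
    then show ?thesis by (simp add: q_def q_max_def)
  qed
  moreover have "q0 \<le> q"
  proof -
    have "q0\<^sup>2 \<le> q\<^sup>2" using d(2) gamma unfolding bq[symmetric] by (simp add: bernoulli_def)
    moreover have "0 \<le> q" using d1 gamma by (simp add: q_def)
    ultimately show ?thesis using power2_le_imp_le by blast
  qed
  moreover have "A \<gamma> q \<le> s"
  proof -
    have "ln (bernoulli q) = ln (bernoulli q0) - t" unfolding bq d_def using b0 by (simp add: ln_mult)
    with key[of q] calculation have "A \<gamma> q \<le> A \<gamma> q0 - k / (\<gamma> - 1) * t" by (simp add: algebra_simps)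
    moreover have "A \<gamma> q0 - s \<le> k / (\<gamma> - 1) * t"
    proof -
      have "k / (\<gamma> - 1) * ((A \<gamma> q0 - s) * (\<gamma> - 1) / k) \<le> k / (\<gamma> - 1) * t"
        using k gamma by (intro mult_left_mono) (auto simp: t_def)
      then show ?thesis using k gamma by simp
    qed
    ultimately show ?thesis by simp
  qed
  moreover have "c \<le> q" using q0 \<open>q0 \<le> q\<close> by linarith
  ultimately show ?thesis by blast
qed

lemma A_inj: "inj_on (A \<gamma>) {c..<qm}"
proof (rule linorder_inj_onI)
  fix x y assume "x < y" "x \<in> {c..<qm}" "y \<in> {c..<qm}"
  then show "A \<gamma> x \<noteq> A \<gamma> y" using A_strict_antimono[of x y] by simp
qed auto

lemma A_image: "A \<gamma> ` {c..<qm} = {..0}"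
proof (intro equalityI subsetI)
  fix s assume "s \<in> A \<gamma> ` {c..<qm}"
  then obtain q where "s = A \<gamma> q" "c \<le> q" "q < qm" by auto
  then show "s \<in> {..0}" using A_strict_antimono[of c q] A_c by (cases "q = c") simp_all
next
  fix s :: real assume s: "s \<in> {..0}"
  obtain q where q: "c \<le> q" "q < qm" "A \<gamma> q \<le> s" using A_unbounded by blast
  have "\<exists>x\<ge>c. x \<le> q \<and> A \<gamma> x = s"
    by (rule IVT2') (use q s A_c in \<open>auto intro: continuous_on_subset[OF A_continuous]\<close>)
  then show "s \<in> A \<gamma> ` {c..<qm}" using q by auto
qed

abbreviation "q_of \<equiv> A_plus_inv \<gamma>"

lemma A_q_of: "s \<le> 0 \<Longrightarrow> A \<gamma> (q_of s) = s"
  unfolding A_plus_inv_def by (rule f_the_inv_into_f[OF A_inj]) (simp add: A_image)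

lemma q_of_range: 
  assumes "s \<le> 0" shows "c \<le> q_of s" "q_of s < qm"
proof -
  have "q_of s \<in> {c..<qm}"
    unfolding A_plus_inv_def using assms by (intro the_inv_into_into[OF A_inj]) (auto simp: A_image)
  then show "c \<le> q_of s" "q_of s < qm" by simp_all
qed

lemma q_of_pos: "s \<le> 0 \<Longrightarrow> 0 < q_of s"
  using q_of_range(1)[of s] c_pos by linarith

lemma q_of_A: "c \<le> q \<Longrightarrow> q < qm \<Longrightarrow> q_of (A \<gamma> q) = q"
  unfolding A_plus_inv_def by (rule the_inv_into_f_f[OF A_inj]) auto

lemma q_of_antimono: "s \<le> t \<Longrightarrow> t \<le> 0 \<Longrightarrow> q_of t \<le> q_of s"
proof (rule ccontr)
  assume h: "s \<le> t" "t \<le> 0" and "\<not> q_of t \<le> q_of s"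
  then have s0: "s \<le> 0" and less: "q_of s < q_of t" by linarith+
  have "A \<gamma> (q_of t) < A \<gamma> (q_of s)"
    by (rule A_strict_antimono[OF q_of_range(1)[OF s0] less q_of_range(2)[OF h(2)]])
  then show False using h A_q_of[of s] A_q_of[of t] by linarith
qed

lemma q_of_neg: "s < 0 \<Longrightarrow> c < q_of s"
  using A_q_of[of s] q_of_range(1)[of s] A_c by (metis less_eq_real_def order_less_irrefl)

lemma q_of_continuous: "continuous_on {s..0} q_of"
proof (cases "s \<le> 0")
  case True
  have "continuous_on (A \<gamma> ` {c..q_of s}) q_of"
    by (rule continuous_on_inv[OF continuous_on_subset[OF A_continuous]])
      (use q_of_range[OF True] q_of_A in auto)
  moreover have "{s..0} \<subseteq> A \<gamma> ` {c..q_of s}"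
  proof
    fix t assume t: "t \<in> {s..0}"
    then show "t \<in> A \<gamma> ` {c..q_of s}"
      using A_q_of[of t] q_of_range[of t] q_of_antimono[of s t] by (intro image_eqI[of _ _ "q_of t"]) auto
  qed
  ultimately show ?thesis by (rule continuous_on_subset)
qed simp

lemma q_of_deriv: "s < 0 \<Longrightarrow> (q_of has_real_derivative - inverse (dA (q_of s))) (at s)"
proof -
  assume s: "s < 0"
  have r: "c < q_of s" "q_of s < qm" using q_of_neg[OF s] q_of_range(2)[of s] s by auto
  have "continuous_on {s - 1<..<0} q_of"
    by (rule continuous_on_subset[OF q_of_continuous[of "s - 1"]]) auto
  then have cont: "isCont q_of s" using s by (auto simp: continuous_on_eq_continuous_at)
  have "(q_of has_real_derivative inverse (- dA (q_of s))) (at s)"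
  proof (rule DERIV_inverse_function[where f = "A \<gamma>" and a = "s - 1" and b = 0])
    show "(A \<gamma> has_real_derivative - dA (q_of s)) (at (q_of s))" using A_deriv r c_pos by simp
  qed (use s dA_pos[OF r] cont A_q_of in auto)
  then show ?thesis by (simp add: inverse_minus_eq)
qed

text \<open>The value of \<open>b\<close> as a function of the speed.\<close>

definition tan_slope :: "real \<Rightarrow> real" where
  "tan_slope q = (dens q)\<^sup>2 * bernoulli q / excess q"

lemma K_deriv: assumes s: "s < 0" shows "(K \<gamma> has_real_derivative - tan_slope (q_of s)) (at s)"
proof -
  have r: "c < q_of s" "q_of s < qm" using q_of_neg[OF s] q_of_range(2)[of s] s by auto
  have "(K \<gamma> has_real_derivative dens (q_of s) / q_of s * - inverse (dA (q_of s))) (at s)"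
    unfolding K_def[abs_def]
    by (rule DERIV_chain2[OF B_deriv q_of_deriv[OF s]]) (use r c_pos in auto)
  moreover have "dens (q_of s) / q_of s * - inverse (dA (q_of s)) = - tan_slope (q_of s)"
    using excess_pos[OF r(1)] dens_pos[OF _ r(2)] bernoulli_pos[OF _ r(2)] r c_pos
    by (simp add: dA_def tan_slope_def power2_eq_square field_simps)
  ultimately show ?thesis by simp
qed

lemma b_eq: "s < 0 \<Longrightarrow> b \<gamma> s = tan_slope (q_of s)"
  unfolding b_def by (simp add: DERIV_imp_deriv[OF K_deriv])

lemma K_has_deriv_b: "s < 0 \<Longrightarrow> (K \<gamma> has_real_derivative - b \<gamma> s) (at s)"
  using K_deriv by (simp add: b_eq)

lemma b_pos: assumes "s < 0" shows "0 < b \<gamma> s"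
  using q_of_neg[OF assms] q_of_range(2)[of s] assms excess_pos[of "q_of s"] bernoulli_pos[of "q_of s"]
    dens_pos[of "q_of s"] c_pos by (simp add: b_eq tan_slope_def)

text \<open>In terms of the speed \<open>b\<close> is a quotient of a decreasing and an increasing function, and the speed
  decreases with \<open>s\<close>. Hence \<open>- K\<close> is convex, on which the sign of the energy rests.\<close>

lemma b_mono: assumes st: "s \<le> t" "t < 0" shows "b \<gamma> s \<le> b \<gamma> t"
proof -
  have r: "c < q_of t" "q_of t \<le> q_of s" "q_of s < qm"
    using q_of_neg[OF st(2)] q_of_antimono[OF st(1)] q_of_range(2)[of s] st by auto
  have 1: "0 \<le> q_of t" using r c_pos by simp
  have "(dens (q_of s))\<^sup>2 * bernoulli (q_of s) \<le> (dens (q_of t))\<^sup>2 * bernoulli (q_of t)"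
    using dens_antimono[OF 1 r(2,3)] bernoulli_antimono[OF 1 r(2)] bernoulli_pos[of "q_of s"] dens_pos[of "q_of s"] r 1
    by (intro mult_mono power_mono) auto
  then show ?thesis unfolding b_eq[OF st(2)] b_eq[OF le_less_trans[OF st]] tan_slope_def
    using excess_mono[OF 1 r(2)] excess_pos[OF r(1)] bernoulli_pos[of "q_of t"] r 1
    by (intro frac_le) auto
qed

lemma K_continuous: "continuous_on {s..0} (K \<gamma>)"
proof -
  have "continuous_on {c..<qm} (B \<gamma>)"
    using c_pos by (intro continuous_at_imp_continuous_on ballI DERIV_isCont[OF B_deriv]) auto
  then show ?thesis unfolding K_def[abs_def]
    by (rule continuous_on_compose2[OF _ q_of_continuous]) (use q_of_range in auto)
qed

lemma K_mono_diff:
  assumes "s < t" "t < 0"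
  obtains x where "s < x" "x < t" "K \<gamma> s - K \<gamma> t = b \<gamma> x * (t - s)"
proof -
  obtain x where x: "s < x" "x < t" "K \<gamma> t - K \<gamma> s = (t - s) * - b \<gamma> x"
    using MVT2[OF assms(1), of "K \<gamma>" "\<lambda>x. - b \<gamma> x"] K_has_deriv_b assms by auto
  then show thesis by (intro that[of x]) (auto simp: algebra_simps)
qed

text \<open>At the sonic speed \<open>A\<close> vanishes to second order and the denominator of \<open>b\<close> to first order, so \<open>b\<close> blows up
  like the inverse square root.\<close>

lemma b_bound:
  obtains Cb where "0 < Cb" "\<And>s. S \<le> s \<Longrightarrow> s < 0 \<Longrightarrow> b \<gamma> s \<le> Cb / sqrt (- s)"
proof -
  define S' where "S' = min S 0"
  define v where "v = q_of S'"
  have v: "c \<le> v" "v < qm" "0 < v" unfolding v_def using q_of_range[of S'] q_of_pos[of S'] by (auto simp: S'_def)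
  define Ca where "Ca = (\<gamma> + 1) / (bernoulli v * dens v)"
  have Ca: "0 < Ca" using bernoulli_pos[of v] dens_pos[of v] v gamma by (simp add: Ca_def)
  have main: "b \<gamma> s \<le> (sqrt Ca / ((\<gamma> + 1) * c)) / sqrt (- s)" if s: "S \<le> s" "s < 0" for s
  proof -
    define q where "q = q_of s"
    have q: "c < q" "q \<le> v" "q < qm" "0 < q"
      using q_of_neg[of s] q_of_antimono[of S' s] q_of_range(2)[of s] q_of_pos[of s] s
      by (auto simp: q_def v_def S'_def)
    have da: "dA x \<le> Ca * (x - c)" if x: "c < x" "x < q" for x
    proof -
      have x0: "0 < x" "x < qm" "x \<le> v" using x c_pos q by auto
      have p: "0 < bernoulli x" "0 < dens x" "bernoulli v \<le> bernoulli x" "dens v \<le> dens x" "0 < bernoulli v" "0 < dens v"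
        using bernoulli_pos[of x] dens_pos[of x] bernoulli_antimono[of x v] dens_antimono[of x v] x0 v
          bernoulli_pos[of v] dens_pos[of v] by auto
      have "(x + c) / x \<le> 2" using x x0 by (simp add: field_simps)
      then have "excess x / x \<le> (\<gamma> + 1) * (x - c)"
      proof -
        have "excess x / x = (\<gamma> + 1) / 2 * (x - c) * ((x + c) / x)" by (simp add: excess_factor)
        also have "\<dots> \<le> (\<gamma> + 1) / 2 * (x - c) * 2"
          using \<open>(x + c) / x \<le> 2\<close> gamma x by (intro mult_left_mono) auto
        finally show ?thesis by simp
      qed
      moreover have "bernoulli v * dens v \<le> bernoulli x * dens x" using p by (intro mult_mono) auto
      ultimately have "(excess x / x) / (bernoulli x * dens x) \<le> ((\<gamma> + 1) * (x - c)) / (bernoulli v * dens v)"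
        using p gamma x by (intro frac_le) auto
      then show ?thesis by (simp add: dA_def Ca_def mult.assoc)
    qed
    have "\<exists>z. c < z \<and> z < q \<and> A \<gamma> q - A \<gamma> c = (q - c) * - dA z"
      by (rule MVT2[OF q(1)]) (use A_deriv q c_pos in auto)
    then obtain z where z: "c < z" "z < q" "A \<gamma> q = (q - c) * - dA z" by (auto simp: A_c)
    have "- s = (q - c) * dA z" using z(3) A_q_of[of s] s by (simp add: q_def)
    also have "\<dots> \<le> (q - c) * (Ca * (q - c))"
    proof -
      have "Ca * (z - c) \<le> Ca * (q - c)" using z Ca by simp
      with da[OF z(1,2)] show ?thesis using q by (intro mult_left_mono) auto
    qed
    finally have "- s \<le> Ca * (q - c)\<^sup>2" by (simp add: power2_eq_square algebra_simps)
    then have "sqrt (- s) \<le> sqrt (Ca * (q - c)\<^sup>2)" by simp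
    also have "\<dots> = sqrt Ca * (q - c)" using q by (simp add: real_sqrt_mult)
    finally have sq: "sqrt (- s) \<le> sqrt Ca * (q - c)" .
    have "b \<gamma> s = (dens q)\<^sup>2 * bernoulli q / excess q" using b_eq[OF s(2)] by (simp add: tan_slope_def q_def)
    also have "\<dots> \<le> 1 / ((\<gamma> + 1) * c * (q - c))"
    proof (rule frac_le)
      show "(dens q)\<^sup>2 * bernoulli q \<le> 1"
        using dens_le_1[of q] dens_pos[of q] bernoulli_le_1[of q] bernoulli_pos[of q] q
        by (intro mult_le_one) (auto simp: power_le_one)
      have "(\<gamma> + 1) * c * (q - c) = (\<gamma> + 1) / 2 * (q - c) * (2 * c)" by simp
      also have "\<dots> \<le> (\<gamma> + 1) / 2 * (q - c) * (q + c)"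
        using q gamma by (intro mult_left_mono) auto
      finally show "(\<gamma> + 1) * c * (q - c) \<le> excess q" by (simp only: excess_factor)
    qed (use gamma c_pos q in auto)
    also have "\<dots> \<le> (sqrt Ca / ((\<gamma> + 1) * c)) / sqrt (- s)"
    proof -
      have "1 / (M * d) \<le> R / M / r" if "0 < M" "0 < d" "0 < r" "r \<le> R * d" for M d R r :: real
        using that by (simp add: field_simps)
      then show ?thesis using sq gamma c_pos q s by simp
    qed
    finally show ?thesis .
  qed
  show thesis by (rule that[of "sqrt Ca / ((\<gamma> + 1) * c)"]) (use main Ca gamma c_pos in auto)
qed

text \<open>The mean slope of the slowness against \<open>K\<close> between two states. It links the difference of the
  positions on the wall to the difference of \<open>K\<close>, and it is finite at the sonic state, unlike the slopes
  of both quantities against the unknown itself.\<close>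

definition wall_slope :: "real \<Rightarrow> real \<Rightarrow> real" where
  "wall_slope s t = chord_slope (\<lambda>q. - 1 / q) (B \<gamma>) (\<lambda>q. 1 / (q * dens q)) (q_of s) (q_of t)"

text \<open>At supersonic speeds the mass flux \<open>q * dens q\<close> decreases; its reciprocal is the slope of the tangent of
  the curve \<open>(B q, - 1 / q)\<close>, which is therefore convex.\<close>

lemma mass_flux_antimono:
  assumes "c \<le> p" "p \<le> q" "q < qm"
  shows "q * dens q \<le> p * dens p"
proof (rule DERIV_nonpos_imp_nonincreasing[OF assms(2)])
  fix x assume x: "p \<le> x" "x \<le> q"
  have r: "0 \<le> x" "x < qm" "c \<le> x" using x assms c_pos by auto
  have "((\<lambda>q. q * dens q) has_real_derivative 1 * dens x + (- x * dens x / bernoulli x) * x) (at x)"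
    by (rule DERIV_mult[OF DERIV_ident dens_deriv[OF r(1,2)]])
  moreover have "1 * dens x + (- x * dens x / bernoulli x) * x = - (dens x * excess x / bernoulli x)"
    using bernoulli_pos[OF r(1,2)] by (simp add: field_simps) (simp add: bernoulli_def excess_def power2_eq_square field_simps)
  moreover have "0 \<le> dens x * excess x / bernoulli x"
    using dens_pos[OF r(1,2)] bernoulli_pos[OF r(1,2)] excess_nonneg[OF r(3)] by simp
  ultimately show "\<exists>y. ((\<lambda>q. q * dens q) has_real_derivative y) (at x) \<and> y \<le> 0"
    by (metis neg_le_0_iff_le)
qed

lemma wall_slope_antimono:
  assumes "s' \<le> s" "s \<le> 0" "t' \<le> t" "t \<le> 0"
  shows "wall_slope s t \<le> wall_slope s' t'"
  unfolding wall_slope_def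
proof (rule chord_slope_mono[where I = "{c..<qm}" and \<beta>' = "\<lambda>q. dens q / q"])
  show "(B \<gamma> has_real_derivative dens x / x) (at x)" if "x \<in> {c..<qm}" for x
    using B_deriv that c_pos by simp
  show "0 < dens x / x" if "x \<in> {c..<qm}" for x using dens_pos[of x] that c_pos by simp
  show "((\<lambda>q. - 1 / q) has_real_derivative 1 / (x * dens x) * (dens x / x)) (at x)" if "x \<in> {c..<qm}" for x
    using that c_pos dens_pos[of x] by (auto intro!: derivative_eq_intros simp: power2_eq_square)
  show "1 / (x * dens x) \<le> 1 / (y * dens y)" if "x \<in> {c..<qm}" "y \<in> {c..<qm}" "x \<le> y" for x y
    using mass_flux_antimono[of x y] that dens_pos[of y] dens_pos[of x] c_pos by (intro divide_left_mono) auto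
qed (use assms q_of_range q_of_antimono in auto)

lemma wall_slope_nonneg:
  assumes "s \<le> 0" "t \<le> 0" shows "0 \<le> wall_slope s t"
proof -
  have "0 \<le> wall_slope 0 0" using q_of_pos[of 0] dens_pos[of "q_of 0"] q_of_range(2)[of 0]
    by (simp add: wall_slope_def chord_slope_def)
  then show ?thesis using wall_slope_antimono[of s 0 t 0] assms by simp
qed

lemma B_strict_mono: "c \<le> p \<Longrightarrow> p < q \<Longrightarrow> q < qm \<Longrightarrow> B \<gamma> p < B \<gamma> q"
proof (rule DERIV_pos_imp_increasing[of p q])
  fix x assume h: "c \<le> p" "q < qm" "p \<le> x" "x \<le> q"
  have "0 < dens x / x" using h c_pos dens_pos[of x] by simp
  moreover have "(B \<gamma> has_real_derivative dens x / x) (at x)" using B_deriv[of x] h c_pos by simp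
  ultimately show "\<exists>d. (B \<gamma> has_real_derivative d) (at x) \<and> 0 < d" by blast
qed

lemma inverse_speed_diff:
  assumes "s \<le> 0" "t \<le> 0"
  shows "1 / q_of s - 1 / q_of t = wall_slope s t * (K \<gamma> t - K \<gamma> s)"
proof (cases "q_of s = q_of t")
  case False
  then have "B \<gamma> (q_of s) \<noteq> B \<gamma> (q_of t)"
    using B_strict_mono[of "q_of s" "q_of t"] B_strict_mono[of "q_of t" "q_of s"] q_of_range assms
    by (cases "q_of s" "q_of t" rule: linorder_cases) auto
  then have "(- 1 / q_of s - - 1 / q_of t) / (B \<gamma> (q_of s) - B \<gamma> (q_of t)) * (B \<gamma> (q_of s) - B \<gamma> (q_of t))
      = - 1 / q_of s - - 1 / q_of t" by simp
  then have "wall_slope s t * (K \<gamma> s - K \<gamma> t) = - 1 / q_of s - - 1 / q_of t"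
    unfolding wall_slope_def chord_slope_def K_def using False by (simp only: if_False)
  then show ?thesis by (simp add: algebra_simps)
qed (simp add: K_def)

end

section \<open>The energy identity for a vertical primitive\<close>

lemma borel_slices:
  fixes f :: "real \<times> real \<Rightarrow> real"
  assumes f: "f \<in> borel_measurable borel"
  shows "(\<lambda>s. f (s, y)) \<in> borel_measurable borel" "(\<lambda>t. f (x, t)) \<in> borel_measurable borel"
  by (rule measurable_compose[OF _ f], intro borel_measurable_continuous_onI continuous_intros)+

lemma abs_integral_le:
  fixes f :: "real \<Rightarrow> real" and a b :: real
  assumes ab: "a \<le> b" and f: "f integrable_on {a..b}" and M: "\<And>x. x \<in> {a..b} \<Longrightarrow> \<bar>f x\<bar> \<le> M"
  shows "\<bar>integral {a..b} f\<bar> \<le> M * (b - a)"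
proof -
  have 1: "\<bar>f a\<bar> \<le> M" using ab M by simp
  then have "0 \<le> M" by linarith
  have "norm (integral {a..b} f) \<le> M * Henstock_Kurzweil_Integration.content {a..b}"
    by (rule has_integral_bound_real[OF \<open>0 \<le> M\<close> finite.emptyI integrable_integral[OF f]]) (use M in auto)
  then show ?thesis using ab by simp
qed

lemma AE_snd:
  assumes "AE t in lborel. Q t"
  shows "AE p in (lborel :: (real \<times> real) measure). Q (snd p)"
proof -
  obtain N where N: "N \<in> null_sets (lborel :: real measure)" "{t \<in> space lborel. \<not> Q t} \<subseteq> N"
    using assms unfolding eventually_ae_filter by blast
  have "AE p in (lborel \<Otimes>\<^sub>M lborel :: (real \<times> real) measure). snd p \<notin> N"
  proof (rule lborel_pair.AE_pair_measure)
    have "N \<in> sets borel" using N(1) by auto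
    moreover have "(snd :: real \<times> real \<Rightarrow> real) \<in> borel_measurable borel"
      by (intro borel_measurable_continuous_onI continuous_intros)
    ultimately have "snd -` (- N) \<inter> space borel \<in> sets (borel :: (real \<times> real) measure)"
      by (intro measurable_sets[of snd borel borel]) auto
    then have "{x :: real \<times> real. snd x \<notin> N} \<in> sets borel" by (simp add: vimage_def)
    then show "{x \<in> space (lborel \<Otimes>\<^sub>M lborel). snd x \<notin> N} \<in> sets (lborel \<Otimes>\<^sub>M lborel :: (real \<times> real) measure)"
      unfolding lborel_prod by simp
    show "AE x in lborel. AE y in lborel. snd (x :: real, y) \<notin> N"
      using AE_not_in[OF N(1)] by simp
  qed
  then have "AE p in (lborel :: (real \<times> real) measure). snd p \<notin> N" unfolding lborel_prod .
  then show ?thesis by eventually_elim (use N(2) in auto)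
qed

text \<open>A function \<open>y\<close> on the strip whose vertical derivative is \<open>D\<close> almost everywhere on the rectangle. It
  is constant above the top, so that averages over short vertical segments make sense up to the wall.
  One constant \<open>C\<close> bounds everything.\<close>

locale vertical_primitive =
  fixes y D :: "real \<times> real \<Rightarrow> real" and \<tau> m C :: real
  assumes pos: "0 < \<tau>" "0 < m"
    and y_cont: "continuous_on UNIV y"
    and y_bound: "\<And>p. \<bar>y p\<bar> \<le> C"
    and y_lip: "\<And>s t t'. s \<in> {0..\<tau>} \<Longrightarrow> \<bar>y (s, t) - y (s, t')\<bar> \<le> C * \<bar>t - t'\<bar>"
    and y_top: "\<And>s t. m \<le> t \<Longrightarrow> y (s, t) = y (s, m)"
    and D_borel: "D \<in> borel_measurable borel"
    and D_bound: "\<And>p. \<bar>D p\<bar> \<le> C"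
    and D_deriv: "AE p in lborel. p \<in> {0<..<\<tau>} \<times> {0<..<m} \<longrightarrow>
      ((\<lambda>t. y (fst p, t)) has_real_derivative D p) (at (snd p))"
begin

abbreviation "R \<equiv> {0..\<tau>} \<times> {0..m}"
abbreviation "P \<equiv> \<lambda>t. integral {0..\<tau>} (\<lambda>s. D (s, t))"

lemma C_nonneg: "0 \<le> C" using y_bound[of "(0,0)"] by linarith

lemma y_borel: "y \<in> borel_measurable borel"
  by (rule borel_measurable_continuous_onI[OF y_cont])

lemma y_slice_cont: "continuous_on S (\<lambda>s. y (s, t))" "continuous_on S (\<lambda>t. y (s, t))"
  by (rule continuous_on_compose2[OF y_cont]; auto intro!: continuous_intros)+

lemma D_slice_integrable: "(\<lambda>s. D (s, t)) integrable_on {u..v}" "(\<lambda>t. D (s, t)) integrable_on {u..v}"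
  by (rule bounded_borel_integrable_on[OF borel_slices(1)[OF D_borel] _ D_bound], simp,
      rule bounded_borel_integrable_on[OF borel_slices(2)[OF D_borel] _ D_bound], simp)

lemma P_borel: "P \<in> borel_measurable borel"
  by (rule borel_measurable_slice_integral[OF D_borel D_bound])

lemma P_bound: "\<bar>P t\<bar> \<le> C * \<tau>"
  using abs_integral_le[OF _ D_slice_integrable(1) D_bound, of 0 \<tau> t] pos by simp

lemma vertical_increment:
  assumes t: "t \<in> {0..m}"
  shows "integral {0..\<tau>} (\<lambda>s. y (s, m)) - integral {0..\<tau>} (\<lambda>s. y (s, t)) = integral {t..m} P"
proof -
  have ii: "(\<lambda>s. y (s, t)) integrable_on {0..\<tau>}" for t
    by (intro integrable_continuous_real y_slice_cont)
  have "integral {0..\<tau>} (\<lambda>s. y (s, m)) - integral {0..\<tau>} (\<lambda>s. y (s, t))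
      = integral {0..\<tau>} (\<lambda>s. y (s, m) - y (s, t))"
    by (simp add: Henstock_Kurzweil_Integration.integral_diff ii)
  also have "\<dots> = integral {0..\<tau>} (\<lambda>s. integral {t..m} (\<lambda>t. D (s, t)))"
  proof (rule integral_cong_AE_lborel)
    have "AE s in lborel. AE t in lborel. (s, t) \<in> {0<..<\<tau>} \<times> {0<..<m} \<longrightarrow>
        ((\<lambda>t. y (s, t)) has_real_derivative D (s, t)) (at t)"
      using AE_slices(1)[OF D_deriv] by simp
    moreover have "AE s in lborel. s \<noteq> 0" "AE s in lborel. s \<noteq> \<tau>" by (auto intro: AE_lborel_singleton)
    ultimately show "AE s in lborel. s \<in> {0..\<tau>} \<longrightarrow> y (s, m) - y (s, t) = integral {t..m} (\<lambda>t. D (s, t))"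
    proof eventually_elim
      case (elim s)
      show ?case
      proof
        assume s: "s \<in> {0..\<tau>}"
        have L: "C-lipschitz_on {t..m} (\<lambda>t. y (s, t))"
          by (rule lipschitz_onI) (use y_lip[OF s] C_nonneg in \<open>auto simp: dist_real_def\<close>)
        have "AE x in lborel. x \<in> {t<..<m} \<longrightarrow> ((\<lambda>t. y (s, t)) has_real_derivative D (s, x)) (at x)"
          using elim(1) by eventually_elim (use s t elim(2,3) in auto)
        from Lipschitz_FTC[OF _ L this] t
        show "y (s, m) - y (s, t) = integral {t..m} (\<lambda>t. D (s, t))" by (simp add: integral_unique)
      qed
    qed
  qed
  also have "\<dots> = integral {t..m} P"
    using Fubini_rectangle(2,3)[OF D_borel, of 0 \<tau> t m, OF D_bound] by simp
  finally show ?thesis .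
qed

text \<open>The value at the top is the value at height \<open>t\<close> plus the integral of the derivative between them; square,
  and average over \<open>t\<close>.\<close>

lemma trace_estimate:
  "m * (integral {0..\<tau>} (\<lambda>s. y (s, m)))\<^sup>2
    \<le> 2 * integral {0..m} (\<lambda>t. (integral {0..\<tau>} (\<lambda>s. y (s, t)))\<^sup>2) + 2 * m\<^sup>2 * integral {0..m} (\<lambda>t. (P t)\<^sup>2)"
proof -
  let ?V = "\<lambda>t. integral {0..\<tau>} (\<lambda>s. y (s, t))"
  have P2: "(\<lambda>t. (P t)\<^sup>2) integrable_on {u..v}" for u v
    by (rule bounded_borel_integrable_on[where C = "(C * \<tau>)\<^sup>2"])
      (use P_borel P_bound in \<open>auto simp: abs_le_square_iff[symmetric] intro!: order_trans[OF P_bound]\<close>)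
  have P1: "P integrable_on {u..v}" for u v
    by (rule bounded_borel_integrable_on[OF P_borel _ P_bound]) simp
  have Vc: "continuous_on UNIV ?V"
  proof -
    have "continuous_on UNIV (\<lambda>t. integral (cbox 0 \<tau>) (\<lambda>s. y (s, t)))"
      by (intro integral_continuous_on_param)
        (auto intro!: continuous_on_compose2[OF y_cont] continuous_intros simp: case_prod_beta')
    then show ?thesis by simp
  qed
  have pt: "(?V m)\<^sup>2 \<le> 2 * (?V t)\<^sup>2 + 2 * m * integral {0..m} (\<lambda>t. (P t)\<^sup>2)" if t: "t \<in> {0..m}" for t
  proof -
    have "(integral {t..m} P)\<^sup>2 \<le> (m - t) * integral {t..m} (\<lambda>t. (P t)\<^sup>2)"
      by (rule integral_power2_le) (use t P1 P2 in auto)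
    also have "\<dots> \<le> m * integral {0..m} (\<lambda>t. (P t)\<^sup>2)"
      by (intro mult_mono integral_subset_le P2 Henstock_Kurzweil_Integration.integral_nonneg) (use t in auto)
    finally have I: "(integral {t..m} P)\<^sup>2 \<le> m * integral {0..m} (\<lambda>t. (P t)\<^sup>2)" .
    have "?V m = ?V t + integral {t..m} P" using vertical_increment[OF t] by simp
    moreover have "(u + v)\<^sup>2 \<le> 2 * u\<^sup>2 + 2 * v\<^sup>2" for u v :: real
      using zero_le_power2[of "u - v"] by (simp add: power2_eq_square algebra_simps)
    ultimately have "(?V m)\<^sup>2 \<le> 2 * (?V t)\<^sup>2 + 2 * (integral {t..m} P)\<^sup>2" by simp
    with I show ?thesis by simp
  qed
  have "integral {0..m} (\<lambda>t. (?V m)\<^sup>2) \<le> integral {0..m} (\<lambda>t. 2 * (?V t)\<^sup>2 + 2 * m * integral {0..m} (\<lambda>t. (P t)\<^sup>2))"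
    by (rule integral_le) (use pt in \<open>auto intro!: integrable_continuous_real continuous_intros continuous_on_subset[OF Vc]\<close>)
  also have "\<dots> = integral {0..m} (\<lambda>t. 2 * (?V t)\<^sup>2) + integral {0..m} (\<lambda>t. 2 * m * integral {0..m} (\<lambda>t. (P t)\<^sup>2))"
    by (rule Henstock_Kurzweil_Integration.integral_add)
      (auto intro!: integrable_continuous_real continuous_intros continuous_on_subset[OF Vc])
  finally show ?thesis using pos by (simp add: power2_eq_square mult_ac)
qed

text \<open>A continuous approximation of the indicator of \<open>s < \<tau>\<close>. Without it the test function built from \<open>y\<close> would have
  a kink at \<open>s = \<tau>\<close>.\<close>

definition cutoff :: "nat \<Rightarrow> real \<Rightarrow> real" where
  "cutoff n s = max 0 (min 1 (real (Suc n) * (\<tau> - s)))"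

lemma cutoff_cont: "continuous_on S (cutoff n)" unfolding cutoff_def by (intro continuous_intros)
lemma cutoff_range: "0 \<le> cutoff n s" "cutoff n s \<le> 1" by (auto simp: cutoff_def)
lemma cutoff_zero: "\<tau> \<le> s \<Longrightarrow> cutoff n s = 0"
  using mult_nonneg_nonpos[of "real (Suc n)" "\<tau> - s"] by (simp add: cutoff_def)
lemma cutoff_tendsto: "s < \<tau> \<Longrightarrow> (\<lambda>n. cutoff n s) \<longlonglongrightarrow> 1"
proof -
  assume s: "s < \<tau>"
  obtain N where N: "1 / (\<tau> - s) < real N" using reals_Archimedean2 by blast
  have "cutoff n s = 1" if "N \<le> n" for n
  proof -
    have "1 / (\<tau> - s) \<le> real (Suc n)" using N that by simp
    then have "1 \<le> real (Suc n) * (\<tau> - s)" using s by (simp add: field_simps)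
    then show ?thesis by (simp add: cutoff_def)
  qed
  then have "\<forall>\<^sub>F n in sequentially. cutoff n s = 1" using eventually_sequentially by blast
  then show ?thesis by (rule tendsto_eventually)
qed

definition width :: "nat \<Rightarrow> real" where "width n = inverse (real (Suc n))"
definition truncated :: "nat \<Rightarrow> real \<times> real \<Rightarrow> real" where "truncated n p = cutoff n (fst p) * y p"

lemma width_pos: "0 < width n" by (simp add: width_def)
lemma width_0: "width \<longlonglongrightarrow> 0" unfolding width_def[abs_def] by (rule LIMSEQ_inverse_real_of_nat)

lemma truncated_cont: "continuous_on UNIV (truncated n)"
  unfolding truncated_def by (intro continuous_intros y_cont continuous_on_compose2[OF cutoff_cont[of UNIV]]) auto

text \<open>The hypothesis is the weak equation for test functions that are averages over vertical segments of
  length \<open>h\<close> of \<open>\<lambda>(x, t). integral {x..\<tau>} (\<lambda>s. g (s, t))\<close>. The choice \<open>g = y\<close> is the multiplier adapted to the equation: its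
  \<open>x\<close>-derivative is \<open>- y\<close>, so the principal part becomes the exact square of \<open>\<integral> D\<close> and no derivative of
  the coefficients appears. This \<open>g\<close> is reached by bounded convergence from the cut-off sources, with \<open>h\<close>
  tending to zero.\<close>

lemma energy_identity:
  fixes W :: "real \<times> real \<Rightarrow> real" and \<Gamma> :: "real \<Rightarrow> real"
  assumes W: "W \<in> borel_measurable borel" "\<And>p. \<bar>W p\<bar> \<le> C"
    and \<Gamma>: "continuous_on {0..\<tau>} \<Gamma>"
    and weak: "\<And>h g. 0 < h \<Longrightarrow> continuous_on UNIV g \<Longrightarrow> (\<And>s t. \<tau> \<le> s \<Longrightarrow> g (s, t) = 0) \<Longrightarrow>
      ((\<lambda>p. W p * - (integral {snd p..snd p + h} (\<lambda>t. g (fst p, t)) / h)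
          - D p * (integral {fst p..\<tau>} (\<lambda>s. g (s, snd p + h) - g (s, snd p)) / h))
        has_integral
        integral {0..\<tau>} (\<lambda>x. \<Gamma> x * (integral {m..m + h} (\<lambda>t. integral {x..\<tau>} (\<lambda>s. g (s, t))) / h))) R"
  shows "integral R (\<lambda>p. W p * y p) + integral {0..m} (\<lambda>t. (P t)\<^sup>2) / 2
    = - integral {0..\<tau>} (\<lambda>x. \<Gamma> x * integral {x..\<tau>} (\<lambda>s. y (s, m)))"
proof -
  define J where "J p = integral {0..\<tau>} (\<lambda>s. if fst p \<le> s then D (s, snd p) else 0)" for p :: "real \<times> real"
  have J: "J (x, t) = integral {x..\<tau>} (\<lambda>s. D (s, t))" if "0 \<le> x" for x t
  proof -
    have "J (x, t) = integral {0..\<tau>} (\<lambda>s. if s \<in> {x..\<tau>} then D (s, t) else 0)"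
      unfolding J_def by (rule Henstock_Kurzweil_Integration.integral_cong) auto
    also have "\<dots> = integral ({x..\<tau>} \<inter> {0..\<tau>}) (\<lambda>s. D (s, t))" by (rule integral_restrict_Int)
    also have "{x..\<tau>} \<inter> {0..\<tau>} = {x..\<tau>}" using that by auto
    finally show ?thesis .
  qed
  define E where "E n p = - (integral {snd p..snd p + width n} (\<lambda>t. truncated n (fst p, t)) / width n)" for n and p :: "real \<times> real"
  define F where "F n p = integral {fst p..\<tau>} (\<lambda>s. truncated n (s, snd p + width n) - truncated n (s, snd p)) / width n" for n and p :: "real \<times> real"
  define H where "H n x = integral {m..m + width n} (\<lambda>t. integral {x..\<tau>} (\<lambda>s. truncated n (s, t))) / width n" for n x
  have tc: "continuous_on S (\<lambda>t. truncated n (s, t))" "continuous_on S (\<lambda>s. truncated n (s, t))" for S n s t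
    by (rule continuous_on_compose2[OF truncated_cont]; auto intro!: continuous_intros)+
  have w: "((\<lambda>p. W p * E n p - D p * F n p) has_integral integral {0..\<tau>} (\<lambda>x. \<Gamma> x * H n x)) R" for n
    unfolding E_def F_def H_def
    by (rule weak[OF width_pos truncated_cont]) (simp add: truncated_def cutoff_zero)
  have truncated_b: "\<bar>truncated n p\<bar> \<le> C" for n p
    using cutoff_range[of n "fst p"] y_bound[of p] mult_mono[of "cutoff n (fst p)" 1 "\<bar>y p\<bar>" C]
    by (simp add: truncated_def abs_mult)
  have truncated_l: "\<bar>truncated n (s, t) - truncated n (s, t')\<bar> \<le> C * \<bar>t - t'\<bar>" if "s \<in> {0..\<tau>}" for n s t t'
  proof -
    have "truncated n (s, t) - truncated n (s, t') = cutoff n s * (y (s, t) - y (s, t'))" by (simp add: truncated_def algebra_simps)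
    then show ?thesis
      using cutoff_range[of n s] y_lip[OF that, of t t'] mult_mono[of "cutoff n s" 1 "\<bar>y (s, t) - y (s, t')\<bar>" "C * \<bar>t - t'\<bar>"]
      by (simp add: abs_mult)
  qed
  have Eb: "\<bar>E n p\<bar> \<le> C" for n p
  proof -
    have "\<bar>integral {snd p..snd p + width n} (\<lambda>t. truncated n (fst p, t))\<bar> \<le> C * (snd p + width n - snd p)"
      by (rule abs_integral_le) (use truncated_b width_pos[of n] tc in \<open>auto intro: integrable_continuous_real less_imp_le\<close>)
    then show ?thesis using width_pos[of n] by (simp add: E_def abs_divide field_simps)
  qed
  have Fb: "\<bar>F n p\<bar> \<le> C * \<tau>" if p: "p \<in> R" for n p
  proof -
    have "\<bar>integral {fst p..\<tau>} (\<lambda>s. truncated n (s, snd p + width n) - truncated n (s, snd p))\<bar> \<le> C * width n * (\<tau> - fst p)"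
    proof (rule abs_integral_le)
      fix s assume "s \<in> {fst p..\<tau>}"
      then show "\<bar>truncated n (s, snd p + width n) - truncated n (s, snd p)\<bar> \<le> C * width n"
        using truncated_l[of s n "snd p + width n" "snd p"] width_pos[of n] p by auto
    qed (use p in \<open>auto intro!: integrable_continuous_real continuous_intros tc\<close>)
    also have "\<dots> \<le> C * width n * \<tau>"
      using C_nonneg width_pos[of n] p by (intro mult_left_mono) auto
    finally show ?thesis using width_pos[of n] by (simp add: F_def abs_divide field_simps)
  qed
  have Elim: "(\<lambda>n. E n p) \<longlonglongrightarrow> - y p" if p: "p \<in> {0..<\<tau>} \<times> {0..m}" for p
  proof -
    obtain s t where st: "p = (s, t)" "s \<in> {0..<\<tau>}" using p by auto
    define av where "av n = integral {t..t + width n} (\<lambda>t. y (s, t)) / width n" for n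
    have avb: "\<bar>av n - y (s, t)\<bar> \<le> C * width n" for n
    proof -
      have yi: "(\<lambda>r. y (s, r)) integrable_on {t..t + width n}" by (intro integrable_continuous_real y_slice_cont)
      have "integral {t..t + width n} (\<lambda>r. y (s, r) - y (s, t)) = integral {t..t + width n} (\<lambda>r. y (s, r)) - y (s, t) * width n"
        using width_pos[of n] by (subst Henstock_Kurzweil_Integration.integral_diff[OF yi]) (auto simp: mult.commute)
      moreover have "\<bar>integral {t..t + width n} (\<lambda>r. y (s, r) - y (s, t))\<bar> \<le> C * width n * (t + width n - t)"
      proof (rule abs_integral_le)
        fix r assume r: "r \<in> {t..t + width n}"
        then have "C * \<bar>r - t\<bar> \<le> C * width n" using C_nonneg by (intro mult_left_mono) auto
        then show "\<bar>y (s, r) - y (s, t)\<bar> \<le> C * width n"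
          using y_lip[of s r t] st by simp
      qed (use width_pos[of n] in \<open>auto intro!: integrable_continuous_real continuous_intros y_slice_cont less_imp_le\<close>)
      ultimately have "\<bar>integral {t..t + width n} (\<lambda>t. y (s, t)) - y (s, t) * width n\<bar> \<le> C * width n * width n"
        by simp
      moreover have "av n - y (s, t) = (integral {t..t + width n} (\<lambda>t. y (s, t)) - y (s, t) * width n) / width n"
        using width_pos[of n] by (simp add: av_def diff_divide_distrib)
      ultimately show ?thesis using width_pos[of n] by (simp add: abs_divide pos_divide_le_eq)
    qed
    have "(\<lambda>n. C * width n) \<longlonglongrightarrow> 0" using tendsto_mult_left[OF width_0, of C] by simp
    then have "(\<lambda>n. av n - y (s, t)) \<longlonglongrightarrow> 0"
      by (rule Lim_null_comparison[rotated]) (use avb in auto)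
    then have "av \<longlonglongrightarrow> y (s, t)" by (simp add: LIM_zero_iff)
    from tendsto_mult[OF cutoff_tendsto[of s] this]
    have "(\<lambda>n. - (cutoff n s * av n)) \<longlonglongrightarrow> - y p" using st by (auto intro: tendsto_minus)
    moreover have "E n p = - (cutoff n s * av n)" for n
      by (simp add: E_def st truncated_def av_def)
    ultimately show ?thesis by simp
  qed
  have hat: "filterlim width (at 0) sequentially"
    unfolding filterlim_at using width_0 width_pos by (auto intro!: always_eventually less_imp_neq[symmetric])
  have "AE t in lborel. t \<noteq> 0" "AE t in lborel. t \<noteq> m" by (auto intro: AE_lborel_singleton)
  then have "AE t in lborel. t \<in> {0..m} \<longrightarrow> (\<forall>x\<in>{0..\<tau>}. (\<lambda>n. F n (x, t)) \<longlonglongrightarrow> J (x, t))"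
    using AE_slices(2)[OF D_deriv]
  proof eventually_elim
    case (elim t)
    show ?case
    proof (intro impI ballI)
      fix x assume t: "t \<in> {0..m}" and x: "x \<in> {0..\<tau>}"
      define f where "f n s = (truncated n (s, t + width n) - truncated n (s, t)) / width n" for n s
      have "(\<lambda>n. integral {x..\<tau>} (f n)) \<longlonglongrightarrow> integral {x..\<tau>} (\<lambda>s. D (s, t))"
      proof (rule bounded_convergence_AE(2))
        show "f n integrable_on {x..\<tau>}" for n
          unfolding f_def using width_pos[of n] by (intro integrable_continuous_real continuous_intros tc) auto
        show "\<bar>f n s\<bar> \<le> C" if "s \<in> {x..\<tau>}" for n s
          using truncated_l[of s n "t + width n" t] that x width_pos[of n] by (simp add: f_def abs_divide pos_divide_le_eq)
        have "AE s in lborel. s \<noteq> 0" "AE s in lborel. s \<noteq> \<tau>" by (auto intro: AE_lborel_singleton)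
        then show "AE s in lborel. s \<in> {x..\<tau>} \<longrightarrow> (\<lambda>n. f n s) \<longlonglongrightarrow> D (s, t)"
          using elim(3)
        proof eventually_elim
          case (elim s)
          show ?case
          proof
            assume "s \<in> {x..\<tau>}"
            with elim \<open>t \<noteq> 0\<close> \<open>t \<noteq> m\<close> x t have s: "s < \<tau>" and d: "((\<lambda>t. y (s, t)) has_real_derivative D (s, t)) (at t)" by auto
            from d have "((\<lambda>h. (y (s, t + h) - y (s, t)) / h) \<longlongrightarrow> D (s, t)) (at 0)" by (simp add: DERIV_def)
            from tendsto_mult[OF cutoff_tendsto[OF s] filterlim_compose[OF this hat]]
            have "(\<lambda>n. cutoff n s * ((y (s, t + width n) - y (s, t)) / width n)) \<longlonglongrightarrow> D (s, t)" by simp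
            moreover have "f n s = cutoff n s * ((y (s, t + width n) - y (s, t)) / width n)" for n
              by (simp add: f_def truncated_def right_diff_distrib)
            ultimately show "(\<lambda>n. f n s) \<longlonglongrightarrow> D (s, t)" by simp
          qed
        qed
      qed simp
      moreover have "integral {x..\<tau>} (f n) = F n (x, t)" for n by (simp add: f_def[abs_def] F_def)
      ultimately show "(\<lambda>n. F n (x, t)) \<longlonglongrightarrow> J (x, t)" using x by (simp add: J)
    qed
  qed
  from AE_snd[OF this] have Flim: "AE p in lborel. p \<in> R \<longrightarrow> (\<lambda>n. F n p) \<longlonglongrightarrow> J p"
    by eventually_elim auto
  have lim1: "(\<lambda>n. integral R (\<lambda>p. W p * E n p - D p * F n p)) \<longlonglongrightarrow> integral R (\<lambda>p. W p * - y p - D p * J p)"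
  proof (rule bounded_convergence_AE(2))
    show "(\<lambda>p. W p * E n p - D p * F n p) integrable_on R" for n using w by blast
    show "compact R" by (intro compact_Times) auto
    show "\<bar>W p * E n p - D p * F n p\<bar> \<le> C * C + C * (C * \<tau>)" if "p \<in> R" for n p
    proof -
      have "\<bar>W p * E n p\<bar> \<le> C * C" using W(2)[of p] Eb[of n p] C_nonneg by (simp add: abs_mult mult_mono)
      moreover have "\<bar>D p * F n p\<bar> \<le> C * (C * \<tau>)" using D_bound[of p] Fb[OF that, of n] C_nonneg
        unfolding abs_mult by (intro mult_mono) auto
      ultimately show ?thesis by linarith
    qed
    have "AE s in lborel. s \<noteq> \<tau>" by (rule AE_lborel_singleton)
    have neg: "negligible ({\<tau>} \<times> {0..m} :: (real \<times> real) set)"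
    proof -
      have "box (\<tau>, 0::real) (\<tau>, m) = {}" by (auto simp: box_def Basis_prod_def)
      then have "negligible (cbox (\<tau>, 0::real) (\<tau>, m))" using negligible_interval(1) by blast
      then show ?thesis by (simp add: cbox_Pair_eq)
    qed
    have "AE p in lborel. p \<notin> {\<tau>} \<times> {0..m}"
      using neg unfolding negligible_iff_null_sets by (subst AE_completion_iff[symmetric]) (rule AE_not_in)
    with Flim show "AE p in lborel. p \<in> R \<longrightarrow> (\<lambda>n. W p * E n p - D p * F n p) \<longlonglongrightarrow> W p * - y p - D p * J p"
    proof eventually_elim
      case (elim p)
      show ?case
      proof
        assume p: "p \<in> R"
        with elim(2) have p': "p \<in> {0..<\<tau>} \<times> {0..m}" by (cases p) auto
        show "(\<lambda>n. W p * E n p - D p * F n p) \<longlonglongrightarrow> W p * - y p - D p * J p"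
          by (intro tendsto_intros Elim[OF p']) (use elim(1) p in blast)
      qed
    qed
  qed
  have Heq: "H n x = integral {x..\<tau>} (\<lambda>s. cutoff n s * y (s, m))" for n x
  proof -
    have "integral {m..m + width n} (\<lambda>t. integral {x..\<tau>} (\<lambda>s. truncated n (s, t)))
        = integral {m..m + width n} (\<lambda>t. integral {x..\<tau>} (\<lambda>s. cutoff n s * y (s, m)))"
    proof (rule Henstock_Kurzweil_Integration.integral_cong)
      fix t assume "t \<in> {m..m + width n}"
      then have "y (s, t) = y (s, m)" for s using y_top[of t s] by simp
      then show "integral {x..\<tau>} (\<lambda>s. truncated n (s, t)) = integral {x..\<tau>} (\<lambda>s. cutoff n s * y (s, m))"
        by (simp add: truncated_def)
    qed
    then show ?thesis using width_pos[of n] by (simp add: H_def)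
  qed
  have cyi: "(\<lambda>s. cutoff n s * y (s, m)) integrable_on {x..\<tau>}" for n x
    by (intro integrable_continuous_real continuous_intros cutoff_cont y_slice_cont)
  have cyb: "\<bar>cutoff n s * y (s, m)\<bar> \<le> C" for n s
    using truncated_b[of n "(s, m)"] by (simp add: truncated_def)
  have Hb: "\<bar>H n x\<bar> \<le> C * \<tau>" if "x \<in> {0..\<tau>}" for n x
  proof -
    have "\<bar>H n x\<bar> \<le> C * (\<tau> - x)" unfolding Heq by (rule abs_integral_le) (use that cyb cyi in auto)
    also have "\<dots> \<le> C * \<tau>" using C_nonneg that by (intro mult_left_mono) auto
    finally show ?thesis .
  qed
  have Hlim: "(\<lambda>n. H n x) \<longlonglongrightarrow> integral {x..\<tau>} (\<lambda>s. y (s, m))" if "x \<in> {0..\<tau>}" for x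
    unfolding Heq
  proof (rule bounded_convergence_AE(2)[OF cyi _ cyb])
    have "AE s in lborel. s \<noteq> \<tau>" by (rule AE_lborel_singleton)
    then show "AE s in lborel. s \<in> {x..\<tau>} \<longrightarrow> (\<lambda>n. cutoff n s * y (s, m)) \<longlonglongrightarrow> y (s, m)"
    proof eventually_elim
      case (elim s)
      then show ?case using tendsto_mult_right[OF cutoff_tendsto[of s], of "y (s, m)"] by auto
    qed
  qed simp
  obtain G where G: "\<And>x. x \<in> {0..\<tau>} \<Longrightarrow> \<bar>\<Gamma> x\<bar> \<le> G"
    using compact_imp_bounded[OF compact_continuous_image[OF \<Gamma> compact_Icc]]
    unfolding bounded_iff by (metis imageI real_norm_def)
  have G0: "0 \<le> G" using G[of 0] pos by simp
  have lim2: "(\<lambda>n. integral {0..\<tau>} (\<lambda>x. \<Gamma> x * H n x)) \<longlonglongrightarrow> integral {0..\<tau>} (\<lambda>x. \<Gamma> x * integral {x..\<tau>} (\<lambda>s. y (s, m)))"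
  proof (rule bounded_convergence_AE(2))
    show "(\<lambda>x. \<Gamma> x * H n x) integrable_on {0..\<tau>}" for n
      unfolding Heq by (intro integrable_continuous_real continuous_intros \<Gamma> indefinite_integral_continuous_1' cyi)
    show "\<bar>\<Gamma> x * H n x\<bar> \<le> G * (C * \<tau>)" if "x \<in> {0..\<tau>}" for n x
      using G[OF that] Hb[OF that, of n] G0 unfolding abs_mult by (intro mult_mono) auto
    show "AE x in lborel. x \<in> {0..\<tau>} \<longrightarrow> (\<lambda>n. \<Gamma> x * H n x) \<longlonglongrightarrow> \<Gamma> x * integral {x..\<tau>} (\<lambda>s. y (s, m))"
      by (intro AE_I2 impI tendsto_intros Hlim)
  qed simp
  have Jborel: "J \<in> borel_measurable borel"
  proof -
    define f where "f = (\<lambda>q :: (real \<times> real) \<times> real. if fst (fst q) \<le> snd q then D (snd q, snd (fst q)) else 0)"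
    have "f \<in> borel_measurable borel"
    proof -
      have "(\<lambda>q :: (real \<times> real) \<times> real. D (snd q, snd (fst q))) \<in> borel_measurable borel"
        by (rule measurable_compose[OF _ D_borel]) (intro borel_measurable_continuous_onI continuous_intros)
      moreover have "{q :: (real \<times> real) \<times> real. fst (fst q) \<le> snd q} \<in> sets borel"
        by (intro borel_closed closed_Collect_le continuous_intros)
      ultimately show ?thesis unfolding f_def by (intro measurable_If) auto
    qed
    moreover have "\<bar>f q\<bar> \<le> C" for q using D_bound C_nonneg by (auto simp: f_def)
    moreover have fb: "\<bar>f q\<bar> \<le> C" for q using D_bound C_nonneg by (auto simp: f_def)
    ultimately have "(\<lambda>p. integral {0..\<tau>} (\<lambda>s. f (p, s))) \<in> borel_measurable borel"
      by (intro borel_measurable_parametric_integral) auto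
    moreover have "f (p, s) = (if fst p \<le> s then D (s, snd p) else 0)" for p s by (auto simp: f_def)
    ultimately show ?thesis by (simp add: J_def[abs_def])
  qed
  have Jb: "\<bar>J (s, t)\<bar> \<le> C * \<tau>" if "s \<in> {0..\<tau>}" for s t
  proof -
    have "\<bar>integral {s..\<tau>} (\<lambda>s. D (s, t))\<bar> \<le> C * (\<tau> - s)"
      by (rule abs_integral_le) (use that D_slice_integrable D_bound in auto)
    also have "\<dots> \<le> C * \<tau>" using C_nonneg that by (intro mult_left_mono) auto
    finally show ?thesis using that by (simp add: J)
  qed
  have DJ: "(\<lambda>p. D p * J p) \<in> borel_measurable borel" by (intro borel_measurable_times D_borel Jborel)
  have DJb: "\<bar>D p * J p\<bar> \<le> C * (C * \<tau>)" if "p \<in> R" for p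
    using that Jb[of "fst p" "snd p"] D_bound[of p] C_nonneg unfolding abs_mult by (intro mult_mono) auto
  note Fub = Fubini_rectangle[OF DJ, of 0 \<tau> 0 m, OF DJb]
  have Wy: "(\<lambda>p. W p * y p) integrable_on R"
  proof (rule bounded_borel_integrable_on)
    show "(\<lambda>p. W p * y p) \<in> borel_measurable borel" by (intro borel_measurable_times W(1) y_borel)
    show "compact R" by (intro compact_Times) auto
    show "\<bar>W p * y p\<bar> \<le> C * C" for p using W(2)[of p] y_bound[of p] C_nonneg by (simp add: abs_mult mult_mono)
  qed
  have "integral R (\<lambda>p. D p * J p) = integral {0..m} (\<lambda>t. integral {0..\<tau>} (\<lambda>s. D (s, t) * J (s, t)))"
    by (rule Fub(3))
  also have "\<dots> = integral {0..m} (\<lambda>t. integral {0..\<tau>} (\<lambda>s. D (s, t) * integral {s..\<tau>} (\<lambda>s. D (s, t))))"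
    by (intro Henstock_Kurzweil_Integration.integral_cong) (simp add: J)
  also have "\<dots> = integral {0..m} (\<lambda>t. (P t)\<^sup>2 / 2)"
    by (intro Henstock_Kurzweil_Integration.integral_cong integral_square_triangle[OF borel_slices(1)[OF D_borel] D_bound])
      (use pos in auto)
  finally have DJ_eq: "integral R (\<lambda>p. D p * J p) = integral {0..m} (\<lambda>t. (P t)\<^sup>2) / 2" by simp
  have "integral R (\<lambda>p. W p * - y p - D p * J p) = integral R (\<lambda>p. - (W p * y p)) - integral R (\<lambda>p. D p * J p)"
    using Henstock_Kurzweil_Integration.integral_diff[OF integrable_neg[OF Wy] Fub(1)] by simp
  moreover have "integral R (\<lambda>p. W p * - y p - D p * J p) = integral {0..\<tau>} (\<lambda>x. \<Gamma> x * integral {x..\<tau>} (\<lambda>s. y (s, m)))"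
    using LIMSEQ_unique[OF lim1] lim2 unfolding integral_unique[OF w] by blast
  ultimately show ?thesis by (simp add: DJ_eq)
qed

end

text \<open>The Lipschitz constants may blow up at the origin, since the coefficient \<open>b\<close> is singular there;
  continuity carries the estimate to the end point.\<close>

lemma integral_lower_bound_from_AE_deriv:
  fixes p u :: "real \<Rightarrow> real"
  assumes \<tau>: "0 < \<tau>" and p: "continuous_on {0..\<tau>} p" "p 0 = 0"
    and L: "\<And>\<delta>. 0 < \<delta> \<Longrightarrow> \<delta> < \<tau> \<Longrightarrow> \<exists>L. L-lipschitz_on {\<delta>..\<tau>} p"
    and d: "AE x in lborel. x \<in> {0<..<\<tau>} \<longrightarrow> (p has_real_derivative d x) (at x) \<and> d x \<le> u x"
    and u: "u \<in> borel_measurable borel" "\<And>x. \<bar>u x\<bar> \<le> C"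
  shows "p \<tau> \<le> integral {0..\<tau>} u"
proof -
  have ui: "u integrable_on {a..c}" for a c by (rule bounded_borel_integrable_on[OF u(1) _ u(2)]) simp
  have step: "p \<tau> - p \<delta> \<le> integral {0..\<tau>} u + C * \<delta>" if \<delta>: "0 < \<delta>" "\<delta> < \<tau>" for \<delta>
  proof -
    obtain L where L: "L-lipschitz_on {\<delta>..\<tau>} p" using L \<delta> by blast
    have "AE x in lborel. x \<in> {\<delta><..<\<tau>} \<longrightarrow> (p has_real_derivative d x) (at x)"
      using d by eventually_elim (use \<delta> in auto)
    from Lipschitz_FTC[OF _ L this] \<delta> have I: "(d has_integral p \<tau> - p \<delta>) {\<delta>..\<tau>}" by simp
    have "AE x in lborel. x \<noteq> \<delta>" "AE x in lborel. x \<noteq> \<tau>" by (auto intro: AE_lborel_singleton)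
    then have "AE x in lborel. x \<in> {\<delta>..\<tau>} \<longrightarrow> d x = min (d x) (u x)"
      using d by eventually_elim (use \<delta> in auto)
    then obtain N where N: "negligible N" "\<And>x. x \<notin> N \<Longrightarrow> x \<in> {\<delta>..\<tau>} \<longrightarrow> d x = min (d x) (u x)"
      using AE_lborel_negligible by blast
    have "((\<lambda>x. min (d x) (u x)) has_integral p \<tau> - p \<delta>) {\<delta>..\<tau>}"
      by (rule has_integral_spike[OF N(1) _ I]) (use N(2) in force)
    then have "p \<tau> - p \<delta> \<le> integral {\<delta>..\<tau>} u"
      by (rule has_integral_le[OF _ integrable_integral[OF ui]]) simp
    moreover have "integral {0..\<delta>} u + integral {\<delta>..\<tau>} u = integral {0..\<tau>} u"
      using \<delta> by (intro Henstock_Kurzweil_Integration.integral_combine ui) auto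
    moreover have "\<bar>integral {0..\<delta>} u\<bar> \<le> C * (\<delta> - 0)"
      by (rule abs_integral_le) (use \<delta> ui u(2) in auto)
    ultimately show ?thesis by simp
  qed
  have "((\<lambda>\<delta>. p \<tau> - p \<delta>) \<longlongrightarrow> p \<tau> - p 0) (at_right 0)"
  proof -
    have "(p \<longlongrightarrow> p 0) (at 0 within {0..\<tau>})" using p(1) \<tau> by (auto simp: continuous_on_def)
    then have "(p \<longlongrightarrow> p 0) (at_right 0)" using \<tau> by (simp add: at_within_Icc_at_right)
    then show ?thesis by (intro tendsto_intros)
  qed
  moreover have "((\<lambda>\<delta>. integral {0..\<tau>} u + C * \<delta>) \<longlongrightarrow> integral {0..\<tau>} u + C * 0) (at_right 0)"
    by (intro tendsto_intros)
  moreover have "eventually (\<lambda>\<delta>. p \<tau> - p \<delta> \<le> integral {0..\<tau>} u + C * \<delta>) (at_right 0)"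
    using eventually_at_right_less[of 0] eventually_at_right_field
    unfolding eventually_at_right_field by (intro exI[of _ \<tau>]) (use \<tau> step in auto)
  ultimately have "p \<tau> - p 0 \<le> integral {0..\<tau>} u + C * 0"
    by (intro tendsto_le[of "at_right (0::real)"]) auto
  then show ?thesis using p(2) by simp
qed

section \<open>Partial derivatives and test functions\<close>

text \<open>The limit of difference quotients is Borel measurable wherever it is taken, unlike the derivative of a
  merely Lipschitz function chosen by a description operator; truncation keeps it bounded on the null set
  where the limit fails to exist.\<close>

lemma borel_partial_derivative:
  fixes u :: "real \<times> real \<Rightarrow> real"
  assumes u: "continuous_on UNIV u" and C: "0 \<le> C"
  obtains D where "D \<in> borel_measurable borel" "\<forall>p. \<bar>D p\<bar> \<le> C"
    "\<forall>x t d. ((\<lambda>t. u (x, t)) has_real_derivative d) (at t) \<longrightarrow> \<bar>d\<bar> \<le> C \<longrightarrow> D (x, t) = d"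
proof -
  define h where "h n = inverse (real (Suc n))" for n
  have hat: "filterlim h (at 0) sequentially"
    unfolding filterlim_at using LIMSEQ_inverse_real_of_nat
    by (auto simp: h_def[abs_def] intro!: always_eventually)
  define q where "q n p = (u (fst p, snd p + h n) - u p) / h n" for n p
  define D where "D p = max (- C) (min C (lim (\<lambda>n. q n p)))" for p
  have "q n \<in> borel_measurable borel" for n
  proof (rule borel_measurable_continuous_onI)
    show "continuous_on UNIV (q n)" unfolding q_def
      by (intro continuous_intros continuous_on_compose2[OF u]) (auto simp: h_def)
  qed
  then have "(\<lambda>p. lim (\<lambda>n. q n p)) \<in> borel_measurable borel" by (rule borel_measurable_lim_metric)
  then have "D \<in> borel_measurable borel" unfolding D_def by (intro borel_measurable_max borel_measurable_min) auto
  moreover have "\<bar>D p\<bar> \<le> C" for p using C by (auto simp: D_def)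
  moreover have "D (x, t) = d" if d: "((\<lambda>t. u (x, t)) has_real_derivative d) (at t)" "\<bar>d\<bar> \<le> C" for x t d
  proof -
    have "((\<lambda>h. (u (x, t + h) - u (x, t)) / h) \<longlongrightarrow> d) (at 0)" using d(1) by (simp add: DERIV_def)
    from filterlim_compose[OF this hat] have "(\<lambda>n. q n (x, t)) \<longlonglongrightarrow> d" by (simp add: q_def)
    then have "lim (\<lambda>n. q n (x, t)) = d" by (rule limI)
    then show ?thesis using d(2) by (simp add: D_def abs_le_iff)
  qed
  ultimately show thesis using that by simp
qed

lemma borel_partial_derivative_fst:
  fixes u :: "real \<times> real \<Rightarrow> real"
  assumes u: "continuous_on UNIV u" and C: "0 \<le> C"
  obtains D where "D \<in> borel_measurable borel" "\<forall>p. \<bar>D p\<bar> \<le> C"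
    "\<forall>x t d. ((\<lambda>x. u (x, t)) has_real_derivative d) (at x) \<longrightarrow> \<bar>d\<bar> \<le> C \<longrightarrow> D (x, t) = d"
proof -
  have "continuous_on UNIV (\<lambda>p. u (snd p, fst p))"
    by (rule continuous_on_compose2[OF u]) (auto intro!: continuous_intros)
  then obtain D where D: "D \<in> borel_measurable borel" "\<forall>p. \<bar>D p\<bar> \<le> C"
    "\<forall>x t d. ((\<lambda>t. u (snd (x, t), fst (x, t))) has_real_derivative d) (at t) \<longrightarrow> \<bar>d\<bar> \<le> C \<longrightarrow> D (x, t) = d"
    by (rule borel_partial_derivative[OF _ C])
  have "(\<lambda>p::real \<times> real. D (snd p, fst p)) \<in> borel_measurable borel"
    by (rule measurable_compose[OF _ D(1)]) (intro borel_measurable_continuous_onI continuous_intros)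
  then show thesis by (rule that[of "\<lambda>p. D (snd p, fst p)"]) (use D in simp_all)
qed

text \<open>The average of \<open>integral {x..\<tau>} (\<lambda>s. g (s, t))\<close> over the vertical segment of length \<open>h\<close> above a point, see
  \<open>smeared_eq\<close>. Written as a second difference of the primitive of \<open>g\<close> on rectangles it is visibly
  continuously differentiable for continuous \<open>g\<close>.\<close>

definition smeared :: "real \<Rightarrow> real \<Rightarrow> (real \<times> real \<Rightarrow> real) \<Rightarrow> real \<times> real \<Rightarrow> real" where
  "smeared \<tau> h g p = (let \<Psi> = (\<lambda>x t. integral {0..x} (\<lambda>s. integral {0..t} (\<lambda>r. g (s, r))))
     in (\<Psi> \<tau> (snd p + h) - \<Psi> \<tau> (snd p) - \<Psi> (fst p) (snd p + h) + \<Psi> (fst p) (snd p)) / h)"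

definition smeared_fst :: "real \<Rightarrow> (real \<times> real \<Rightarrow> real) \<Rightarrow> real \<times> real \<Rightarrow> real" where
  "smeared_fst h g p = - (integral {0..snd p + h} (\<lambda>r. g (fst p, r)) - integral {0..snd p} (\<lambda>r. g (fst p, r))) / h"

definition smeared_snd :: "real \<Rightarrow> real \<Rightarrow> (real \<times> real \<Rightarrow> real) \<Rightarrow> real \<times> real \<Rightarrow> real" where
  "smeared_snd \<tau> h g p = (integral {0..\<tau>} (\<lambda>s. g (s, snd p + h)) - integral {0..\<tau>} (\<lambda>s. g (s, snd p))
     - integral {0..fst p} (\<lambda>s. g (s, snd p + h)) + integral {0..fst p} (\<lambda>s. g (s, snd p))) / h"

context
  fixes \<tau> h :: real and g :: "real \<times> real \<Rightarrow> real"
  assumes \<tau>: "0 < \<tau>" and h: "0 < h" and g: "continuous_on UNIV g"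
    and g0: "\<And>s t. \<tau> \<le> s \<Longrightarrow> g (s, t) = 0"
begin

lemma g_slices: "continuous_on S (\<lambda>s. g (s, t))" "continuous_on S (\<lambda>t. g (s, t))"
  by (rule continuous_on_compose2[OF g]; auto intro!: continuous_intros)+

lemma g_slices_integrable: "(\<lambda>s. g (s, t)) integrable_on {u..v}" "(\<lambda>t. g (s, t)) integrable_on {u..v}"
  by (intro integrable_continuous_real g_slices)+

lemma smeared_has_derivative:
  assumes xt: "0 \<le> x" "0 \<le> t"
  shows "(smeared \<tau> h g has_derivative (\<lambda>k. smeared_fst h g (x, t) * fst k + smeared_snd \<tau> h g (x, t) * snd k))
    (at (x, t) within {0..} \<times> {0..})"
proof -
  define \<Psi> where "\<Psi> x y = integral {0..x} (\<lambda>s. integral {0..y} (\<lambda>r. g (s, r)))" for x y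
  define Gx where "Gx x y = integral {0..y} (\<lambda>t. g (x, t))" for x y
  define Gy where "Gy x y = integral {0..x} (\<lambda>s. g (s, y))" for x y
  let ?W = "at (x, t) within {0..} \<times> {0..}"
  have d: "((\<lambda>p. \<Psi> (fst p) (snd p)) has_derivative (\<lambda>k. Gx x y * fst k + Gy x y * snd k)) (at (x, y) within {0..} \<times> {0..})"
    if "0 \<le> x" "0 \<le> y" for x y
    unfolding \<Psi>_def Gx_def Gy_def by (rule rectangle_primitive_has_derivative[OF g that])
  have c: "((\<lambda>p. \<Psi> (\<alpha> p) (\<beta> p)) has_derivative (\<lambda>k. Gx (\<alpha> (x, t)) (\<beta> (x, t)) * \<alpha>' k + Gy (\<alpha> (x, t)) (\<beta> (x, t)) * \<beta>' k)) ?W"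
    if "(\<alpha> has_derivative \<alpha>') ?W" "(\<beta> has_derivative \<beta>') ?W" "\<And>p. 0 \<le> fst p \<Longrightarrow> 0 \<le> snd p \<Longrightarrow> 0 \<le> \<alpha> p \<and> 0 \<le> \<beta> p"
    for \<alpha> \<beta> \<alpha>' \<beta>' :: "real \<times> real \<Rightarrow> real"
  proof -
    have sub: "(\<lambda>p. (\<alpha> p, \<beta> p)) ` ({0..} \<times> {0..}) \<subseteq> {0..} \<times> {0..}" using that(3) by auto
    have "0 \<le> \<alpha> (x, t)" "0 \<le> \<beta> (x, t)" using that(3) xt by auto
    from has_derivative_in_compose[OF has_derivative_Pair[OF that(1,2)] has_derivative_subset[OF d[OF this] sub]]
    show ?thesis by simp
  qed
  have ds: "(snd has_derivative snd) ?W" "(fst has_derivative fst) ?W" "((\<lambda>p. snd p + h) has_derivative snd) ?W"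
    "((\<lambda>p. \<tau>) has_derivative (\<lambda>k. 0)) ?W"
    by (auto intro!: derivative_eq_intros)
  have 1: "((\<lambda>p. \<Psi> \<tau> (snd p + h)) has_derivative (\<lambda>k. Gy \<tau> (t + h) * snd k)) ?W"
    using c[OF ds(4,3)] \<tau> h by simp
  have 2: "((\<lambda>p. \<Psi> \<tau> (snd p)) has_derivative (\<lambda>k. Gy \<tau> t * snd k)) ?W"
    using c[OF ds(4,1)] \<tau> h by simp
  have 3: "((\<lambda>p. \<Psi> (fst p) (snd p + h)) has_derivative (\<lambda>k. Gx x (t + h) * fst k + Gy x (t + h) * snd k)) ?W"
    using c[OF ds(2,3)] \<tau> h by simp
  have 4: "((\<lambda>p. \<Psi> (fst p) (snd p)) has_derivative (\<lambda>k. Gx x t * fst k + Gy x t * snd k)) ?W"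
    using c[OF ds(2,1)] \<tau> h by simp
  have "((\<lambda>p. (\<Psi> \<tau> (snd p + h) - \<Psi> \<tau> (snd p) - \<Psi> (fst p) (snd p + h) + \<Psi> (fst p) (snd p)) / h) has_derivative
     (\<lambda>k. (Gy \<tau> (t + h) * snd k - Gy \<tau> t * snd k - (Gx x (t + h) * fst k + Gy x (t + h) * snd k) + (Gx x t * fst k + Gy x t * snd k)) / h)) ?W"
    by (intro bounded_linear.has_derivative[OF bounded_linear_divide] has_derivative_add has_derivative_diff 1 2 3 4)
  moreover have "(\<lambda>p. (\<Psi> \<tau> (snd p + h) - \<Psi> \<tau> (snd p) - \<Psi> (fst p) (snd p + h) + \<Psi> (fst p) (snd p)) / h) = smeared \<tau> h g"
    by (simp add: smeared_def Let_def fun_eq_iff \<Psi>_def)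
  moreover have "(\<lambda>k. (Gy \<tau> (t + h) * snd k - Gy \<tau> t * snd k - (Gx x (t + h) * fst k + Gy x (t + h) * snd k) + (Gx x t * fst k + Gy x t * snd k)) / h)
      = (\<lambda>k. smeared_fst h g (x, t) * fst k + smeared_snd \<tau> h g (x, t) * snd k)"
    using h by (simp add: fun_eq_iff smeared_fst_def smeared_snd_def Gx_def Gy_def field_simps)
  ultimately show ?thesis by simp
qed

lemma smeared_C1: "C1_closed ({0..z} \<times> {0..m}) (smeared \<tau> h g)"
proof -
  have gs: "continuous_on UNIV (\<lambda>p. g (snd p, fst p))"
    by (rule continuous_on_compose2[OF g]) (auto intro!: continuous_intros)
  have I1: "continuous_on ({0..z} \<times> {0..m}) (\<lambda>p. integral {0..X p} (\<lambda>s. g (s, Y p)))"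
    if "continuous_on ({0..z} \<times> {0..m}) X" "continuous_on ({0..z} \<times> {0..m}) Y" "\<And>p. p \<in> {0..z} \<times> {0..m} \<Longrightarrow> 0 \<le> X p" for X Y
    using continuous_on_compose2[OF continuous_on_integral_upper[OF g], of "{0..z} \<times> {0..m}" "\<lambda>p. (X p, Y p)"] that
    by (auto intro!: continuous_intros)
  have I2: "continuous_on ({0..z} \<times> {0..m}) (\<lambda>p. integral {0..Y p} (\<lambda>r. g (X p, r)))"
    if "continuous_on ({0..z} \<times> {0..m}) X" "continuous_on ({0..z} \<times> {0..m}) Y" "\<And>p. p \<in> {0..z} \<times> {0..m} \<Longrightarrow> 0 \<le> Y p" for X Y
    using continuous_on_compose2[OF continuous_on_integral_upper[OF gs], of "{0..z} \<times> {0..m}" "\<lambda>p. (Y p, X p)"] that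
    by (auto intro!: continuous_intros)
  let ?G = "\<lambda>p. (smeared_fst h g p, smeared_snd \<tau> h g p)"
  have "continuous_on ({0..z} \<times> {0..m}) ?G"
    unfolding smeared_fst_def smeared_snd_def
    by (intro continuous_intros I1 I2) (use h \<tau> in auto)
  moreover have "(smeared \<tau> h g has_derivative (\<lambda>k. ?G p \<bullet> k)) (at p within {0..z} \<times> {0..m})"
    if "p \<in> {0..z} \<times> {0..m}" for p
  proof -
    have "(smeared \<tau> h g has_derivative (\<lambda>k. ?G p \<bullet> k)) (at p within {0..} \<times> {0..})"
      using smeared_has_derivative[of "fst p" "snd p"] that by (auto simp: inner_prod_def)
    then show ?thesis by (rule has_derivative_subset) auto
  qed
  ultimately show ?thesis unfolding C1_closed_def by blast
qed

lemma smeared_partials: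
  assumes "0 < x" "0 < t"
  shows "D_phi (smeared \<tau> h g) x t = smeared_fst h g (x, t)" "D_psi (smeared \<tau> h g) x t = smeared_snd \<tau> h g (x, t)"
proof -
  have "(x, t) \<in> interior ({0..} \<times> {0..})" using assms by (simp add: interior_Times)
  then have w: "at (x, t) within {0..} \<times> {0..} = at (x, t)" by (rule at_within_interior)
  have d: "(smeared \<tau> h g has_derivative (\<lambda>k. smeared_fst h g (x, t) * fst k + smeared_snd \<tau> h g (x, t) * snd k)) (at (x, t))"
    using smeared_has_derivative[of x t] assms unfolding w by simp
  have "((\<lambda>s. (s, t)) has_derivative (\<lambda>k. (k, 0))) (at x)" by (auto intro!: derivative_eq_intros)
  from has_derivative_compose[OF this d]
  have "((\<lambda>s. smeared \<tau> h g (s, t)) has_real_derivative smeared_fst h g (x, t)) (at x)"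
    by (simp add: has_field_derivative_def)
  then show "D_phi (smeared \<tau> h g) x t = smeared_fst h g (x, t)" unfolding D_phi_def by (rule DERIV_imp_deriv)
  have "((\<lambda>s. (x, s)) has_derivative (\<lambda>k. (0, k))) (at t)" by (auto intro!: derivative_eq_intros)
  from has_derivative_compose[OF this d]
  have "((\<lambda>s. smeared \<tau> h g (x, s)) has_real_derivative smeared_snd \<tau> h g (x, t)) (at t)"
    by (simp add: has_field_derivative_def)
  then show "D_psi (smeared \<tau> h g) x t = smeared_snd \<tau> h g (x, t)" unfolding D_psi_def by (rule DERIV_imp_deriv)
qed

lemma smeared_fst_eq:
  assumes "0 \<le> t"
  shows "smeared_fst h g (x, t) = - (integral {t..t + h} (\<lambda>r. g (x, r)) / h)"
proof -
  have "integral {0..t + h} (\<lambda>r. g (x, r)) - integral {0..t} (\<lambda>r. g (x, r)) = integral {t..t + h} (\<lambda>r. g (x, r))"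
    using Henstock_Kurzweil_Integration.integral_combine[of 0 t "t + h" "\<lambda>r. g (x, r)"] assms h g_slices_integrable
    by simp
  then show ?thesis by (simp only: smeared_fst_def fst_conv snd_conv minus_divide_left)
qed

lemma integral_g_tail:
  assumes "\<tau> \<le> x" shows "integral {0..x} (\<lambda>s. g (s, t)) = integral {0..\<tau>} (\<lambda>s. g (s, t))"
proof -
  have "integral {\<tau>..x} (\<lambda>s. g (s, t)) = integral {\<tau>..x} (\<lambda>s. 0)"
    by (rule Henstock_Kurzweil_Integration.integral_cong) (use g0 in auto)
  then show ?thesis
    using Henstock_Kurzweil_Integration.integral_combine[of 0 \<tau> x "\<lambda>s. g (s, t)"] assms \<tau> g_slices_integrable by simp
qed

lemma smeared_snd_eq:
  assumes "0 \<le> x"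
  shows "smeared_snd \<tau> h g (x, t) = integral {x..\<tau>} (\<lambda>s. g (s, t + h) - g (s, t)) / h"
proof (cases "x \<le> \<tau>")
  case True
  have "integral {0..x} (\<lambda>s. g (s, t)) + integral {x..\<tau>} (\<lambda>s. g (s, t)) = integral {0..\<tau>} (\<lambda>s. g (s, t))" for t
    by (intro Henstock_Kurzweil_Integration.integral_combine g_slices_integrable assms True)
  from this[of "t + h"] this[of t] show ?thesis
    by (simp add: smeared_snd_def Henstock_Kurzweil_Integration.integral_diff g_slices_integrable)
next
  case False
  then show ?thesis using integral_g_tail[of x t] integral_g_tail[of x "t + h"] by (simp add: smeared_snd_def)
qed

lemma smeared_eq:
  assumes "0 \<le> x" "0 \<le> t"
  shows "smeared \<tau> h g (x, t) = integral {t..t + h} (\<lambda>r. integral {x..\<tau>} (\<lambda>s. g (s, r))) / h"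
proof -
  have swap: "integral {0..x} (\<lambda>s. integral {0..t} (\<lambda>r. g (s, r))) = integral {0..t} (\<lambda>r. integral {0..x} (\<lambda>s. g (s, r)))" for x t
    using integral_swap_continuous[of 0 0 x t "\<lambda>s t. g (s, t)"] continuous_on_subset[OF g] by simp
  have c2: "continuous_on UNIV (\<lambda>t. integral {0..x} (\<lambda>s. g (s, t)))" for x
  proof -
    have "continuous_on UNIV (\<lambda>t. integral (cbox 0 x) (\<lambda>s. g (s, t)))"
      by (intro integral_continuous_on_param) (auto intro!: continuous_on_compose2[OF g] continuous_intros simp: case_prod_beta')
    then show ?thesis by simp
  qed
  have ii: "(\<lambda>t. integral {0..x} (\<lambda>s. g (s, t))) integrable_on {u..v}" for x u v
    by (intro integrable_continuous_real continuous_on_subset[OF c2]) auto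
  have comb: "integral {0..t + h} (\<lambda>r. integral {0..x} (\<lambda>s. g (s, r))) - integral {0..t} (\<lambda>r. integral {0..x} (\<lambda>s. g (s, r)))
      = integral {t..t + h} (\<lambda>r. integral {0..x} (\<lambda>s. g (s, r)))" for x
    using Henstock_Kurzweil_Integration.integral_combine[OF assms(2) _ ii, of "t + h" x] h by simp
  have "smeared \<tau> h g (x, t) = (integral {t..t + h} (\<lambda>r. integral {0..\<tau>} (\<lambda>s. g (s, r)))
      - integral {t..t + h} (\<lambda>r. integral {0..x} (\<lambda>s. g (s, r)))) / h"
    unfolding comb[symmetric] by (simp add: smeared_def swap)
  also have "\<dots> = integral {t..t + h} (\<lambda>r. integral {0..\<tau>} (\<lambda>s. g (s, r)) - integral {0..x} (\<lambda>s. g (s, r))) / h"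
    by (simp add: Henstock_Kurzweil_Integration.integral_diff ii)
  also have "(\<lambda>r. integral {0..\<tau>} (\<lambda>s. g (s, r)) - integral {0..x} (\<lambda>s. g (s, r))) = (\<lambda>r. integral {x..\<tau>} (\<lambda>s. g (s, r)))"
  proof
    fix r
    show "integral {0..\<tau>} (\<lambda>s. g (s, r)) - integral {0..x} (\<lambda>s. g (s, r)) = integral {x..\<tau>} (\<lambda>s. g (s, r))"
      using Henstock_Kurzweil_Integration.integral_combine[of 0 x \<tau> "\<lambda>s. g (s, r)"] assms(1) g_slices_integrable
        integral_g_tail[of x r]
      by (cases "x \<le> \<tau>") simp_all
  qed
  finally show ?thesis .
qed

lemma smeared_beyond:
  assumes "\<tau> \<le> x" "0 \<le> t"
  shows "smeared \<tau> h g (x, t) = 0" "smeared_fst h g (x, t) = 0" "smeared_snd \<tau> h g (x, t) = 0"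
proof -
  have z: "integral {x..\<tau>} f = 0" for f :: "real \<Rightarrow> real" using assms(1) by (cases "x = \<tau>") auto
  show "smeared \<tau> h g (x, t) = 0" using assms \<tau> by (simp add: smeared_eq z)
  show "smeared_snd \<tau> h g (x, t) = 0" using assms \<tau> by (simp add: smeared_snd_eq z)
  show "smeared_fst h g (x, t) = 0" using assms g0 by (simp add: smeared_fst_eq)
qed

end

section \<open>The geometry of the wall\<close>

locale nozzle = gas_law +
  fixes lam \<delta>2 \<delta>3 l C1 C2 :: real and f :: "real \<Rightarrow> real"
  assumes lam: "lam > 2" and l: "0 < l" "l \<le> 1" and f0: "f 0 > 0" and smooth: "C_Icc 4 l f"
    and f2_bound: "\<And>x. x \<in> {0..l} \<Longrightarrow> 0 \<le> deriv_Icc l 2 f x \<and> deriv_Icc l 2 f x \<le> \<delta>2 * x powr lam"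
    and f3_bound: "\<And>x. x \<in> {0..l} \<Longrightarrow> \<bar>deriv_Icc l 3 f x\<bar> \<le> \<delta>3 * x powr (lam - 1)"
    and C12: "0 < C1" "0 < C2"
begin

abbreviation "m \<equiv> flux \<gamma> f"
definition "f1 = deriv_Icc l 1 f"
abbreviation "f2 \<equiv> deriv_Icc l 2 f"
abbreviation "f3 \<equiv> deriv_Icc l 3 f"

lemma m_pos: "0 < m" using f0 c_pos by (simp add: flux_def)

lemma deriv_Icc_Suc: "deriv_Icc l (Suc k) f x = vector_derivative (deriv_Icc l k f) (at x within {0..l})"
  by (simp add: deriv_Icc_def)

lemma deriv_Icc_has_derivative:
  assumes "k < 4" "x \<in> {0..l}"
  shows "(deriv_Icc l k f has_real_derivative deriv_Icc l (Suc k) f x) (at x within {0..l})"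
proof -
  have "deriv_Icc l k f differentiable (at x within {0..l})"
    using smooth assms unfolding C_Icc_def differentiable_on_def by blast
  then show ?thesis unfolding deriv_Icc_Suc has_real_derivative_iff_has_vector_derivative
    by (simp add: vector_derivative_works)
qed

lemma f1_deriv: "x \<in> {0..l} \<Longrightarrow> (f1 has_real_derivative f2 x) (at x within {0..l})"
  using deriv_Icc_has_derivative[of 1 x] by (simp add: f1_def numeral_2_eq_2)
lemma f2_deriv: "x \<in> {0..l} \<Longrightarrow> (f2 has_real_derivative f3 x) (at x within {0..l})"
  using deriv_Icc_has_derivative[of 2 x] by (simp add: numeral_3_eq_3 numeral_2_eq_2)

text \<open>With \<open>cosT\<close> the cosine of the wall angle, \<open>curv\<close> is the derivative of the angle along the wall, i.e. the
  curvature of the wall.\<close>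

definition cosT :: "real \<Rightarrow> real" where "cosT x = cos (\<Theta> l f x)"
definition curv :: "real \<Rightarrow> real" where "curv x = deriv_Icc l 1 (\<Theta> l f) x * cosT x"

lemma cosT_pos: "0 < cosT x" and cosT_le_1: "cosT x \<le> 1"
  using arctan_lbound[of "f1 x"] arctan_ubound[of "f1 x"]
  by (auto simp: cosT_def \<Theta>_def f1_def intro!: cos_gt_zero_pi)

lemma Theta_deriv: "x \<in> {0..l} \<Longrightarrow> (\<Theta> l f has_real_derivative f2 x / (1 + (f1 x)\<^sup>2)) (at x within {0..l})"
  unfolding \<Theta>_def[abs_def] f1_def[symmetric] by (auto intro!: derivative_eq_intros f1_deriv simp: divide_inverse mult.commute)

lemma Theta_deriv_Icc: "x \<in> {0..l} \<Longrightarrow> deriv_Icc l 1 (\<Theta> l f) x = f2 x / (1 + (f1 x)\<^sup>2)"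
  using Theta_deriv[of x] vector_derivative_within_cbox[of 0 l x "\<Theta> l f"] l
  by (simp add: deriv_Icc_def has_real_derivative_iff_has_vector_derivative)

lemma curv_eq: "x \<in> {0..l} \<Longrightarrow> curv x = f2 x / (1 + (f1 x)\<^sup>2) * cosT x"
  unfolding curv_def by (simp only: Theta_deriv_Icc)

lemma curv_nonneg: "x \<in> {0..l} \<Longrightarrow> 0 \<le> curv x"
  using f2_bound[of x] cosT_pos[of x] by (simp add: curv_eq)

lemma cosT_deriv: "x \<in> {0..l} \<Longrightarrow>
    (cosT has_real_derivative - sin (\<Theta> l f x) * (f2 x / (1 + (f1 x)\<^sup>2))) (at x within {0..l})"
  unfolding cosT_def[abs_def] by (rule DERIV_chain2[OF DERIV_cos Theta_deriv])

definition dcurv :: "real \<Rightarrow> real" where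
  "dcurv x = (f3 x * (1 + (f1 x)\<^sup>2) - f2 x * (2 * f1 x * f2 x)) / (1 + (f1 x)\<^sup>2)\<^sup>2 * cosT x
     + f2 x / (1 + (f1 x)\<^sup>2) * (- sin (\<Theta> l f x) * (f2 x / (1 + (f1 x)\<^sup>2)))"

lemma curv_deriv: assumes x: "x \<in> {0..l}" shows "(curv has_real_derivative dcurv x) (at x within {0..l})"
proof -
  have nz: "1 + (f1 x)\<^sup>2 \<noteq> 0" by (smt (verit) zero_le_power2)
  have "((\<lambda>x. 1 + (f1 x)\<^sup>2) has_real_derivative 2 * f1 x * f2 x) (at x within {0..l})"
    by (auto intro!: derivative_eq_intros f1_deriv[OF x])
  from DERIV_divide[OF f2_deriv[OF x] this nz]
  have "((\<lambda>x. f2 x / (1 + (f1 x)\<^sup>2)) has_real_derivative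
      (f3 x * (1 + (f1 x)\<^sup>2) - f2 x * (2 * f1 x * f2 x)) / (1 + (f1 x)\<^sup>2)\<^sup>2) (at x within {0..l})"
    by (simp add: power2_eq_square)
  from DERIV_mult'[OF this cosT_deriv[OF x]]
  have "((\<lambda>x. f2 x / (1 + (f1 x)\<^sup>2) * cosT x) has_real_derivative dcurv x) (at x within {0..l})"
    unfolding dcurv_def by (rule DERIV_cong) simp
  then show ?thesis
    by (rule has_field_derivative_transform_within[OF _ zero_less_one x]) (simp add: curv_eq)
qed

text \<open>The growth conditions on the wall make the derivative of the curvature at most \<open>Hc * x powr (lam - 1)\<close>; this
  vanishing rate at the throat compensates the singularity of \<open>b\<close>.\<close>

definition "Hc = \<delta>3 + 2 * \<delta>2\<^sup>2"

lemma Hc_nonneg: "0 \<le> Hc"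
proof -
  have "0 \<le> \<delta>3 * l powr (lam - 1)" using f3_bound[of l] l by force
  then have "0 \<le> \<delta>3" using l by (simp add: zero_le_mult_iff)
  then show ?thesis by (simp add: Hc_def)
qed

lemma dcurv_bound: assumes x: "x \<in> {0..l}" shows "\<bar>dcurv x\<bar> \<le> Hc * x powr (lam - 1)"
proof -
  define D where "D = 1 + (f1 x)\<^sup>2"
  have D: "1 \<le> D" by (simp add: D_def)
  have a1: "2 * \<bar>f1 x\<bar> \<le> D" using zero_le_power2[of "\<bar>f1 x\<bar> - 1"] by (simp add: D_def power2_eq_square algebra_simps)
  have D2: "1 \<le> D\<^sup>2" using D by (simp add: one_le_power)
  have f3D: "\<bar>f3 x * D / D\<^sup>2 * cosT x\<bar> \<le> \<bar>f3 x\<bar>"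
  proof -
    have "\<bar>f3 x * D / D\<^sup>2 * cosT x\<bar> = \<bar>f3 x\<bar> * (cosT x / D)"
      using D cosT_pos[of x] by (simp add: abs_mult power2_eq_square)
    also have "\<dots> \<le> \<bar>f3 x\<bar> * 1" using D cosT_pos[of x] cosT_le_1[of x] by (intro mult_left_mono) auto
    finally show ?thesis by simp
  qed
  have t2: "\<bar>f2 x * (2 * f1 x * f2 x) / D\<^sup>2 * cosT x\<bar> \<le> (f2 x)\<^sup>2"
  proof -
    have "\<bar>f2 x * (2 * f1 x * f2 x) / D\<^sup>2 * cosT x\<bar> = (f2 x)\<^sup>2 * ((2 * \<bar>f1 x\<bar> / D) * (cosT x / D))"
      using D cosT_pos[of x] by (simp add: abs_mult power2_eq_square)
    also have "\<dots> \<le> (f2 x)\<^sup>2 * (1 * 1)"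
      using D cosT_pos[of x] cosT_le_1[of x] a1 by (intro mult_left_mono mult_mono) auto
    finally show ?thesis by simp
  qed
  have t3: "\<bar>f2 x / D * (- sin (\<Theta> l f x) * (f2 x / D))\<bar> \<le> (f2 x)\<^sup>2"
  proof -
    have "\<bar>f2 x / D * (- sin (\<Theta> l f x) * (f2 x / D))\<bar> = (f2 x)\<^sup>2 * (\<bar>sin (\<Theta> l f x)\<bar> / D\<^sup>2)"
      using D by (simp add: abs_mult power2_eq_square)
    also have "\<dots> \<le> (f2 x)\<^sup>2 * 1"
      using D order_trans[OF abs_sin_le_one[of "\<Theta> l f x"] D2] by (intro mult_left_mono) (auto simp: divide_le_eq_1)
    finally show ?thesis by simp
  qed
  have "\<bar>dcurv x\<bar> \<le> \<bar>f3 x * D / D\<^sup>2 * cosT x\<bar> + \<bar>f2 x * (2 * f1 x * f2 x) / D\<^sup>2 * cosT x\<bar>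
      + \<bar>f2 x / D * (- sin (\<Theta> l f x) * (f2 x / D))\<bar>"
  proof -
    have "dcurv x = f3 x * D / D\<^sup>2 * cosT x - f2 x * (2 * f1 x * f2 x) / D\<^sup>2 * cosT x
        + f2 x / D * (- sin (\<Theta> l f x) * (f2 x / D))"
      unfolding dcurv_def D_def[symmetric] by (simp add: diff_divide_distrib left_diff_distrib)
    moreover have "\<bar>u - v + r\<bar> \<le> \<bar>u\<bar> + \<bar>v\<bar> + \<bar>r\<bar>" for u v r :: real by linarith
    ultimately show ?thesis by (simp only:)
  qed
  also have "\<dots> \<le> \<bar>f3 x\<bar> + 2 * (f2 x)\<^sup>2" using f3D t2 t3 by linarith
  also have "\<dots> \<le> \<delta>3 * x powr (lam - 1) + 2 * (\<delta>2\<^sup>2 * x powr (lam - 1))"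
  proof -
    have "(f2 x)\<^sup>2 \<le> (\<delta>2 * x powr lam)\<^sup>2" using f2_bound[OF x] by (intro power_mono) auto
    also have "\<dots> = \<delta>2\<^sup>2 * (x powr lam * x powr lam)" by (simp add: power2_eq_square)
    also have "\<dots> \<le> \<delta>2\<^sup>2 * (x powr (lam - 1) * 1)"
    proof -
      have "x powr lam \<le> x powr (lam - 1)" using x l lam by (intro powr_mono') auto
      moreover have "x powr lam \<le> 1" using x l lam by (intro powr_le1) auto
      ultimately show ?thesis by (intro mult_left_mono mult_mono) auto
    qed
    finally show ?thesis using f3_bound[OF x] by simp
  qed
  finally show ?thesis by (simp add: Hc_def algebra_simps)
qed

lemma curv_diff:
  assumes "x \<in> {0..l}" "x' \<in> {0..l}" "x \<le> r" "x' \<le> r"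
  shows "\<bar>curv x - curv x'\<bar> \<le> Hc * r powr (lam - 1) * \<bar>x - x'\<bar>"
proof -
  let ?S = "{min x x'..max x x'}"
  have "norm (curv x - curv x') \<le> Hc * r powr (lam - 1) * norm (x - x')"
  proof (rule field_differentiable_bound[of ?S curv dcurv])
    fix y assume y: "y \<in> ?S"
    then have yl: "y \<in> {0..l}" using assms by auto
    show "(curv has_field_derivative dcurv y) (at y within ?S)"
      by (rule has_field_derivative_subset[OF curv_deriv[OF yl]]) (use assms in auto)
    have "y powr (lam - 1) \<le> r powr (lam - 1)" using y assms lam by (intro powr_mono2) auto
    then have "Hc * y powr (lam - 1) \<le> Hc * r powr (lam - 1)" using Hc_nonneg by (rule mult_left_mono)
    then show "norm (dcurv y) \<le> Hc * r powr (lam - 1)" using dcurv_bound[OF yl] by simp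
  qed auto
  then show ?thesis by simp
qed

definition arc :: "real \<Rightarrow> real" where "arc x = integral {0..x} (\<lambda>s. 1 / cosT s)"

lemma cosT_cont: "continuous_on {0..l} cosT"
  by (rule DERIV_continuous_on[OF cosT_deriv])

lemma arc_deriv: "x \<in> {0..l} \<Longrightarrow> (arc has_real_derivative 1 / cosT x) (at x within {0..l})"
  unfolding arc_def[abs_def] using cosT_pos
  by (intro integral_has_real_derivative continuous_intros cosT_cont) (auto simp: less_imp_neq[symmetric])

text \<open>The arc length has derivative \<open>1 / cosT\<close>, at least one.\<close>

lemma arc_expands:
  assumes "x \<in> {0..l}" "x' \<in> {0..l}"
  shows "\<bar>x - x'\<bar> \<le> \<bar>arc x - arc x'\<bar>"
proof -
  have *: "y - x \<le> arc y - arc x" if "x \<in> {0..l}" "y \<in> {0..l}" "x \<le> y" for x y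
  proof -
    have "(\<lambda>x. arc x - x) x \<le> (\<lambda>x. arc x - x) y"
    proof (rule DERIV_nonneg_imp_increasing_open[OF that(3)])
      fix t assume t: "x < t" "t < y"
      then have "(arc has_real_derivative 1 / cosT t) (at t)"
        using arc_deriv[of t] that at_within_Icc_at[of 0 t l] by simp
      then have "((\<lambda>x. arc x - x) has_real_derivative 1 / cosT t - 1) (at t)" by (intro DERIV_diff DERIV_ident)
      moreover have "0 \<le> 1 / cosT t - 1" using cosT_pos[of t] cosT_le_1[of t] by simp
      ultimately show "\<exists>d. ((\<lambda>x. arc x - x) has_real_derivative d) (at t) \<and> 0 \<le> d" by blast
    next
      have "continuous_on {0..l} arc" by (rule DERIV_continuous_on[OF arc_deriv])
      then have "continuous_on {x..y} arc" by (rule continuous_on_subset) (use that in auto)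
      then show "continuous_on {x..y} (\<lambda>x. arc x - x)" by (intro continuous_intros)
    qed
    then show ?thesis by simp
  qed
  show ?thesis
  proof (cases "x \<le> x'")
    case True
    with *[OF assms] show ?thesis by linarith
  next
    case False
    with *[OF assms(2,1)] show ?thesis by linarith
  qed
qed

end

section \<open>A single flow\<close>

lemma continuous_on_UNIV_clamp:
  fixes Q :: "real \<times> real \<Rightarrow> real"
  assumes "continuous_on ({0..z} \<times> {0..m}) Q" "0 \<le> z" "0 \<le> m"
  shows "continuous_on UNIV (\<lambda>p. Q (max 0 (min z (fst p)), max 0 (min m (snd p))))"
  by (rule continuous_on_compose2[OF assms(1)]) (use assms(2,3) in \<open>auto intro!: continuous_intros\<close>)

text \<open>A set of full measure is dense; this turns almost everywhere estimates into estimates everywhere, in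
  particular on the boundary.\<close>

lemma closed_contains_Icc:
  fixes z :: real
  assumes "closed S" "0 < z" "AE x in lborel. x \<in> {0<..<z} \<longrightarrow> x \<in> S" "x \<in> {0..z}"
  shows "x \<in> S"
proof -
  have "AE x in lebesgue. x \<in> {0<..<z} \<longrightarrow> x \<in> S" using assms(3) by (rule AE_completion)
  then have "{0<..<z} \<subseteq> S" using mem_closed_if_AE_lebesgue_open[OF open_greaterThanLessThan assms(1)] by blast
  then have "closure {0<..<z} \<subseteq> S" using assms(1) by (rule closure_minimal)
  then show ?thesis using assms(2,4) by auto
qed

context gas_law
begin

text \<open>Convexity of \<open>- K\<close>: its graph lies above the tangents.\<close>

lemma K_tangent:
  assumes s: "s < 0" and t: "t < 0"
  shows "K \<gamma> t - K \<gamma> s \<le> b \<gamma> s * (s - t)" "b \<gamma> t * (s - t) \<le> K \<gamma> t - K \<gamma> s"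
proof -
  have "K \<gamma> t - K \<gamma> s \<le> b \<gamma> s * (s - t) \<and> b \<gamma> t * (s - t) \<le> K \<gamma> t - K \<gamma> s"
  proof (cases s t rule: linorder_cases)
    case less
    obtain x where x: "s < x" "x < t" "K \<gamma> s - K \<gamma> t = b \<gamma> x * (t - s)" using K_mono_diff[OF less t] by blast
    have "b \<gamma> s \<le> b \<gamma> x" "b \<gamma> x \<le> b \<gamma> t" using b_mono[of s x] b_mono[of x t] x t by simp_all
    then have "b \<gamma> s * (t - s) \<le> b \<gamma> x * (t - s)" "b \<gamma> x * (t - s) \<le> b \<gamma> t * (t - s)"
      using less by (simp_all add: mult_right_mono)
    then show ?thesis using x(3) by (simp add: algebra_simps)
  next
    case equal
    then show ?thesis by simp
  next
    case greater
    obtain x where x: "t < x" "x < s" "K \<gamma> t - K \<gamma> s = b \<gamma> x * (s - t)" using K_mono_diff[OF greater s] by blast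
    have "b \<gamma> t \<le> b \<gamma> x" "b \<gamma> x \<le> b \<gamma> s" using b_mono[of t x] b_mono[of x s] x s by simp_all
    then show ?thesis unfolding x(3) using greater by (simp add: mult_right_mono)
  qed
  then show "K \<gamma> t - K \<gamma> s \<le> b \<gamma> s * (s - t)" "b \<gamma> t * (s - t) \<le> K \<gamma> t - K \<gamma> s" by auto
qed

lemma K_secant:
  assumes "s < 0" "t < 0" "b \<gamma> s \<le> M" "b \<gamma> t \<le> M"
  obtains x where "0 < x" "x \<le> M" "K \<gamma> t - K \<gamma> s = x * (s - t)"
proof (cases s t rule: linorder_cases)
  case less
  obtain x where x: "s < x" "x < t" "K \<gamma> s - K \<gamma> t = b \<gamma> x * (t - s)" using K_mono_diff[OF less assms(2)] by blast
  show thesis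
  proof (rule that[of "b \<gamma> x"])
    show "0 < b \<gamma> x" using b_pos x assms by simp
    show "b \<gamma> x \<le> M" using b_mono[of x t] x assms by simp
    show "K \<gamma> t - K \<gamma> s = b \<gamma> x * (s - t)" using x(3) by (simp add: algebra_simps)
  qed
next
  case equal
  show thesis by (rule that[of "b \<gamma> s"]) (use equal b_pos[OF assms(1)] assms(3) in simp_all)
next
  case greater
  obtain x where x: "t < x" "x < s" "K \<gamma> t - K \<gamma> s = b \<gamma> x * (s - t)" using K_mono_diff[OF greater assms(1)] by blast
  show thesis
  proof (rule that[of "b \<gamma> x"])
    show "0 < b \<gamma> x" using b_pos x assms by simp
    show "b \<gamma> x \<le> M" using b_mono[of x s] x assms by simp
  qed (rule x(3))
qed

end

text \<open>In a weak solution \<open>pot\<close> is the potential along the wall and \<open>pos\<close> its inverse, the position on the wall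
  as a function of the potential.\<close>

locale flow = nozzle +
  fixes w :: "real \<Rightarrow> real" and Q :: "real \<times> real \<Rightarrow> real"
  assumes sol: "weak_solution \<gamma> l f w Q"
    and growth: "growth_bounds lam C1 C2 (\<zeta> l f w) (flux \<gamma> f) Q"
begin

abbreviation "z \<equiv> \<zeta> l f w"
abbreviation "pot \<equiv> \<Phi> l f w"
abbreviation "pos \<equiv> X l f w"

lemma w_pos: "x \<in> {0..l} \<Longrightarrow> 0 < w x"
  and w_int: "(\<lambda>s. w s / cosT s) integrable_on {0..l}"
  and Q_lip: "\<exists>L. L-lipschitz_on ({0..z} \<times> {0..m}) Q"
  and w_eq: "x \<in> {0..l} \<Longrightarrow> w x = q_of (Q (pot x, m))"
  and Q_initial: "\<psi> \<in> {0<..<m} \<Longrightarrow> Q (0, \<psi>) = 0"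
  and Q_weak: "C1_closed ({0..z} \<times> {0..m}) \<xi> \<Longrightarrow> (\<And>\<psi>. \<psi> \<in> {0<..<m} \<Longrightarrow> \<xi> (z, \<psi>) = 0) \<Longrightarrow>
     interior_integrand \<gamma> Q \<xi> absolutely_integrable_on ({0<..<z} \<times> {0<..<m}) \<and>
     wall_integrand \<gamma> l f w Q \<xi> integrable_on {0..z} \<and>
     integral ({0<..<z} \<times> {0<..<m}) (interior_integrand \<gamma> Q \<xi>)
            - integral {0..z} (wall_integrand \<gamma> l f w Q \<xi>) = 0"
  using sol unfolding weak_solution_def Let_def cosT_def by blast+

lemma pot_eq: "pot x = integral {0..x} (\<lambda>s. w s / cosT s)"
  by (simp add: \<Phi>_def cosT_def)

lemma pot_0: "pot 0 = 0" by (simp add: pot_eq)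
lemma z_eq: "z = pot l" by (simp add: \<zeta>_def)

lemma pot_range: assumes "x \<in> {0..l}" shows "pot x \<in> {0..z}"
proof -
  have nn: "0 \<le> w s / cosT s" if "s \<in> {0..l}" for s using w_pos[OF that] cosT_pos[of s] by simp
  have i: "(\<lambda>s. w s / cosT s) integrable_on {0..x}"
    by (rule integrable_on_subinterval[OF w_int]) (use assms in auto)
  have "0 \<le> pot x" unfolding pot_eq
    by (rule Henstock_Kurzweil_Integration.integral_nonneg[OF i]) (use nn assms in auto)
  moreover have "pot x \<le> z" unfolding z_eq pot_eq
    by (rule integral_subset_le[OF _ i w_int]) (use nn assms in auto)
  ultimately show ?thesis by simp
qed

lemma z_nonneg: "0 \<le> z" using pot_range[of 0] l by auto

lemma Q_cont: "continuous_on ({0..z} \<times> {0..m}) Q"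
  using Q_lip lipschitz_on_continuous_on by blast

lemma Q_slice_cont: "t \<in> {0..m} \<Longrightarrow> continuous_on {0..z} (\<lambda>s. Q (s, t))"
  "s \<in> {0..z} \<Longrightarrow> continuous_on {0..m} (\<lambda>t. Q (s, t))"
  by (rule continuous_on_compose2[OF Q_cont]; auto intro!: continuous_intros)+

lemma Q_zero: assumes "t \<in> {0..m}" shows "Q (0, t) = 0"
proof -
  have "continuous_on (closure {0<..<m}) (\<lambda>t. Q (0, t))"
    using Q_slice_cont(2)[of 0] z_nonneg m_pos by simp
  from continuous_constant_on_closure[OF this, of 0] show ?thesis
    using assms m_pos Q_initial by auto
qed

text \<open>Both sides are continuous, and the open rectangle is dense in the closed one.\<close>

lemma Q_bounds:
  assumes "s \<in> {0..z}" "t \<in> {0..m}"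
  shows "- C2 * s powr (lam + 2) \<le> Q (s, t)" "Q (s, t) \<le> - C1 * s powr (lam + 2)"
proof -
  have "- C2 * s powr (lam + 2) \<le> Q (s, t) \<and> Q (s, t) \<le> - C1 * s powr (lam + 2)"
  proof (cases "z = 0")
    case True
    then show ?thesis using assms Q_zero[OF assms(2)] by simp
  next
    case False
    then have z: "0 < z" using z_nonneg by simp
    let ?O = "{0<..<z} \<times> {0<..<m}"
    have cl: "closure ?O = {0..z} \<times> {0..m}" using z m_pos by (simp add: closure_Times)
    have pc: "continuous_on ({0..z} \<times> {0..m}) (\<lambda>p::real\<times>real. fst p powr (lam + 2))"
      using lam by (intro continuous_on_powr' continuous_intros) auto
    have in_O: "- C2 * fst p powr (lam + 2) \<le> Q p" "Q p \<le> - C1 * fst p powr (lam + 2)" if "p \<in> ?O" for p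
      using growth that unfolding growth_bounds_def by auto
    have "continuous_on (closure ?O) (\<lambda>p. Q p + C1 * fst p powr (lam + 2))"
      unfolding cl by (intro continuous_intros Q_cont pc)
    from continuous_le_on_closure[OF this, of "(s, t)" 0]
    have 1: "Q (s, t) + C1 * s powr (lam + 2) \<le> 0" using assms in_O(2) unfolding cl by fastforce
    have "continuous_on (closure ?O) (\<lambda>p. - C2 * fst p powr (lam + 2) - Q p)"
      unfolding cl by (intro continuous_intros Q_cont pc)
    from continuous_le_on_closure[OF this, of "(s, t)" 0]
    have 2: "- C2 * s powr (lam + 2) - Q (s, t) \<le> 0" using assms in_O(1) unfolding cl by fastforce
    show ?thesis using 1 2 by simp
  qed
  then show "- C2 * s powr (lam + 2) \<le> Q (s, t)" "Q (s, t) \<le> - C1 * s powr (lam + 2)" by auto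
qed

lemma Q_nonpos: "s \<in> {0..z} \<Longrightarrow> t \<in> {0..m} \<Longrightarrow> Q (s, t) \<le> 0"
  using Q_bounds(2)[of s t] C12 by (smt (verit) mult_nonneg_nonneg powr_ge_zero mult_minus_left)

lemma Q_neg: "s \<in> {0<..z} \<Longrightarrow> t \<in> {0..m} \<Longrightarrow> Q (s, t) < 0"
  using Q_bounds(2)[of s t] C12 by (smt (verit) mult_pos_pos powr_gt_zero mult_minus_left greaterThanAtMost_iff atLeastAtMost_iff)

definition "S = C2 * z powr (lam + 2)"

lemma Q_range: assumes "s \<in> {0..z}" "t \<in> {0..m}" shows "Q (s, t) \<in> {- S..0}"
proof -
  have "s powr (lam + 2) \<le> z powr (lam + 2)" using assms lam by (intro powr_mono2) auto
  then have "C2 * s powr (lam + 2) \<le> S" unfolding S_def using C12 by (intro mult_left_mono) auto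
  then show ?thesis using Q_bounds(1)[OF assms] Q_nonpos[OF assms] by simp
qed

definition "speed s = q_of (Q (s, m))"

lemma speed_ge: "s \<in> {0..z} \<Longrightarrow> c \<le> speed s"
  unfolding speed_def using q_of_range(1) Q_nonpos m_pos by simp

lemma speed_cont: "continuous_on {0..z} speed"
  unfolding speed_def[abs_def]
  by (rule continuous_on_compose2[OF q_of_continuous[of "- S"] Q_slice_cont(1)])
    (use Q_range m_pos in auto)

lemma w_speed: "x \<in> {0..l} \<Longrightarrow> w x = speed (pot x)" by (simp add: w_eq speed_def)

lemma pot_cont: "continuous_on {0..l} pot"
  unfolding pot_eq[abs_def] by (rule indefinite_integral_continuous_1[OF w_int])

lemma w_cont: "continuous_on {0..l} w"
proof -
  have "continuous_on {0..l} (\<lambda>x. speed (pot x))"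
    by (rule continuous_on_compose2[OF speed_cont pot_cont]) (use pot_range in auto)
  then show ?thesis by (rule continuous_on_eq) (simp add: w_speed)
qed

lemma pot_deriv: "x \<in> {0..l} \<Longrightarrow> (pot has_real_derivative w x / cosT x) (at x within {0..l})"
  unfolding pot_eq[abs_def] using cosT_pos
  by (intro integral_has_real_derivative continuous_intros cosT_cont w_cont) (auto simp: less_imp_neq[symmetric])

lemma pot_strict_mono: assumes "x \<in> {0..l}" "y \<in> {0..l}" "x < y" shows "pot x < pot y"
proof (rule DERIV_pos_imp_increasing_open[OF assms(3)])
  fix t assume t: "x < t" "t < y"
  then have "(pot has_real_derivative w t / cosT t) (at t)"
    using pot_deriv[of t] assms at_within_Icc_at[of 0 t l] by simp
  moreover have "0 < w t / cosT t" using w_pos[of t] cosT_pos[of t] assms t by simp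
  ultimately show "\<exists>d. (pot has_real_derivative d) (at t) \<and> 0 < d" by blast
qed (rule continuous_on_subset[OF pot_cont], use assms in auto)

lemma z_pos: "0 < z" using pot_strict_mono[of 0 l] l by (simp add: z_eq pot_0)

lemma pot_inj: "inj_on pot {0..l}"
proof (rule linorder_inj_onI)
  fix x y assume "x < y" "x \<in> {0..l}" "y \<in> {0..l}"
  then show "pot x \<noteq> pot y" using pot_strict_mono[of x y] by simp
qed auto

lemma pot_image: "pot ` {0..l} = {0..z}"
proof (intro equalityI subsetI)
  fix s assume "s \<in> {0..z}"
  then have "\<exists>x\<ge>0. x \<le> l \<and> pot x = s"
    by (intro IVT') (use l pot_cont in \<open>auto simp: pot_0 z_eq\<close>)
  then show "s \<in> pot ` {0..l}" by auto
qed (use pot_range in auto)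

lemma pos_range: "s \<in> {0..z} \<Longrightarrow> pos s \<in> {0..l}"
  unfolding X_def by (rule the_inv_into_into[OF pot_inj]) (auto simp: pot_image)

lemma pot_pos: "s \<in> {0..z} \<Longrightarrow> pot (pos s) = s"
  unfolding X_def by (rule f_the_inv_into_f[OF pot_inj]) (simp add: pot_image)

lemma pos_pot: "x \<in> {0..l} \<Longrightarrow> pos (pot x) = x"
  unfolding X_def by (rule the_inv_into_f_f[OF pot_inj])

lemma pos_cont: "continuous_on {0..z} pos"
  using continuous_on_inv_into[OF pot_cont compact_Icc pot_inj] unfolding X_def pot_image .

lemma inv_speed_cont: "continuous_on {0..z} (\<lambda>s. 1 / speed s)"
proof (intro continuous_intros speed_cont ballI)
  fix s assume "s \<in> {0..z}"
  from speed_ge[OF this] show "speed s \<noteq> 0" using c_pos by simp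
qed

text \<open>Both sides vanish at the throat and have the same derivative, because the speed on the wall is prescribed
  by the flow. The position of a point on the wall is thus determined by the slowness \<open>1 / speed\<close> alone.\<close>

lemma arc_pot: assumes "x \<in> {0..l}" shows "arc x = integral {0..pot x} (\<lambda>s. 1 / speed s)"
proof -
  let ?I = "\<lambda>s. integral {0..s} (\<lambda>s. 1 / speed s)"
  have "((\<lambda>x. arc x - ?I (pot x)) has_real_derivative 0) (at x within {0..l})" if x: "x \<in> {0..l}" for x
  proof -
    have "(?I has_real_derivative 1 / speed (pot x)) (at (pot x) within {0..z})"
      by (rule integral_has_real_derivative[OF inv_speed_cont pot_range[OF x]])
    then have "(?I has_real_derivative 1 / speed (pot x)) (at (pot x) within pot ` {0..l})"
      by (simp add: pot_image)
    from DERIV_image_chain[OF this pot_deriv[OF x]]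
    have "((\<lambda>x. ?I (pot x)) has_real_derivative 1 / speed (pot x) * (w x / cosT x)) (at x within {0..l})"
      by (simp add: o_def)
    moreover have "1 / speed (pot x) * (w x / cosT x) = 1 / cosT x"
      using w_speed[OF x] w_pos[OF x] by simp
    ultimately show ?thesis using DERIV_diff[OF arc_deriv[OF x]] by fastforce
  qed
  then have "\<exists>k. \<forall>x\<in>{0..l}. arc x - ?I (pot x) = k"
    by (intro has_field_derivative_zero_constant) auto
  then obtain k where k: "\<forall>x\<in>{0..l}. arc x - ?I (pot x) = k" by blast
  have "k = 0" using k[rule_format, of 0] l by (simp add: arc_def pot_0)
  then show ?thesis using k assms by simp
qed

lemma arc_pos: "s \<in> {0..z} \<Longrightarrow> arc (pos s) = integral {0..s} (\<lambda>s. 1 / speed s)"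
  using arc_pot[OF pos_range, of s] by (simp add: pot_pos)

lemma pos_le: assumes s: "s \<in> {0..z}" shows "pos s \<le> s / c"
proof -
  have "\<bar>pos s - 0\<bar> \<le> \<bar>arc (pos s) - arc 0\<bar>" by (rule arc_expands) (use pos_range[OF s] l in auto)
  then have "pos s \<le> \<bar>integral {0..s} (\<lambda>s. 1 / speed s)\<bar>" using arc_pos[OF s] by (simp add: arc_def)
  also have "\<dots> \<le> 1 / c * (s - 0)"
  proof (rule abs_integral_le)
    show "\<bar>1 / speed t\<bar> \<le> 1 / c" if "t \<in> {0..s}" for t
      using speed_ge[of t] that s c_pos by (simp add: frac_le)
    show "(\<lambda>s. 1 / speed s) integrable_on {0..s}"
      by (rule integrable_continuous_real, rule continuous_on_subset[OF inv_speed_cont]) (use s in auto)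
  qed (use s in auto)
  finally show ?thesis by simp
qed

lemma growth_AE: "AE p in lborel. p \<in> {0<..<z} \<times> {0<..<m} \<longrightarrow>
    (\<lambda>s. Q (s, snd p)) differentiable at (fst p) \<and> (\<lambda>t. Q (fst p, t)) differentiable at (snd p) \<and>
    \<bar>D_phi Q (fst p) (snd p)\<bar> \<le> C2 * fst p powr (lam + 1) \<and> D_phi Q (fst p) (snd p) \<le> 0 \<and>
    \<bar>D_psi Q (fst p) (snd p)\<bar> \<le> C2 * fst p powr (3 * lam / 2 + 1)"
proof -
  have "AE p in lebesgue. case p of (\<phi>, \<psi>) \<Rightarrow> (\<phi>, \<psi>) \<in> {0<..<z} \<times> {0<..<m} \<longrightarrow>
        (\<lambda>t. Q (t, \<psi>)) differentiable at \<phi> \<and> (\<lambda>t. Q (\<phi>, t)) differentiable at \<psi> \<and>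
        - C2 * \<phi> powr (lam + 1) \<le> D_phi Q \<phi> \<psi> \<and> D_phi Q \<phi> \<psi> \<le> - C1 * \<phi> powr (lam + 1) \<and>
        \<bar>D_psi Q \<phi> \<psi>\<bar> \<le> C2 * \<phi> powr (3 * lam / 2 + 1)"
    using growth unfolding growth_bounds_def by blast
  then show ?thesis unfolding AE_completion_iff
  proof eventually_elim
    case (elim p)
    obtain \<phi> \<psi> where p: "p = (\<phi>, \<psi>)" by (cases p)
    have "0 \<le> C1 * \<phi> powr (lam + 1)" "0 \<le> C2 * \<phi> powr (lam + 1)" using C12 by auto
    then show ?case using elim unfolding p prod.case fst_conv snd_conv mult_minus_left by linarith
  qed
qed

lemma D_derivs:
  "(\<lambda>s. Q (s, t)) differentiable at s \<Longrightarrow> ((\<lambda>s. Q (s, t)) has_real_derivative D_phi Q s t) (at s)"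
  "(\<lambda>t. Q (s, t)) differentiable at t \<Longrightarrow> ((\<lambda>t. Q (s, t)) has_real_derivative D_psi Q s t) (at t)"
  unfolding D_phi_def D_psi_def
  by (simp_all add: DERIV_deriv_iff_real_differentiable)

lemma Q_slice_lip: obtains L where
  "\<forall>t\<in>{0..m}. L-lipschitz_on {0..z} (\<lambda>s. Q (s, t))"
  "\<forall>s\<in>{0..z}. L-lipschitz_on {0..m} (\<lambda>t. Q (s, t))"
proof -
  obtain L where L: "L-lipschitz_on ({0..z} \<times> {0..m}) Q" using Q_lip by blast
  show thesis
  proof (rule that[of L]; intro ballI)
    fix t assume t: "t \<in> {0..m}"
    show "L-lipschitz_on {0..z} (\<lambda>s. Q (s, t))"
    proof (rule lipschitz_onI)
      fix x y assume "x \<in> {0..z}" "y \<in> {0..z}"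
      then show "dist (Q (x, t)) (Q (y, t)) \<le> L * dist x y"
        using lipschitz_onD[OF L, of "(x, t)" "(y, t)"] t by (simp add: dist_Pair_Pair)
    qed (rule lipschitz_on_nonneg[OF L])
  next
    fix s assume s: "s \<in> {0..z}"
    show "L-lipschitz_on {0..m} (\<lambda>t. Q (s, t))"
    proof (rule lipschitz_onI)
      fix x y assume "x \<in> {0..m}" "y \<in> {0..m}"
      then show "dist (Q (s, x)) (Q (s, y)) \<le> L * dist x y"
        using lipschitz_onD[OF L, of "(s, x)" "(s, y)"] s by (simp add: dist_Pair_Pair)
    qed (rule lipschitz_on_nonneg[OF L])
  qed
qed

text \<open>The extension of \<open>Q\<close> to the plane that is obtained by clamping both coordinates to the rectangle.\<close>

definition Qe :: "real \<times> real \<Rightarrow> real" where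
  "Qe p = Q (max 0 (min z (fst p)), max 0 (min m (snd p)))"

lemma Qe_eq: "s \<in> {0..z} \<Longrightarrow> t \<in> {0..m} \<Longrightarrow> Qe (s, t) = Q (s, t)"
  by (simp add: Qe_def)

lemma Qe_cont: "continuous_on UNIV Qe"
  unfolding Qe_def[abs_def] by (rule continuous_on_UNIV_clamp[OF Q_cont]) (use z_pos m_pos in auto)

lemma Qe_slice_cont: "continuous_on UNIV (\<lambda>s. Qe (s, t))" "continuous_on UNIV (\<lambda>t. Qe (s, t))"
  by (rule continuous_on_compose2[OF Qe_cont]; auto intro!: continuous_intros)+

text \<open>On almost every vertical segment the bound on the derivative integrates; both sides are continuous in \<open>s\<close>.\<close>

lemma Q_psi_lip:
  assumes s: "s \<in> {0..z}" and t: "t \<in> {0..m}" "t' \<in> {0..m}" "t \<le> t'"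
  shows "\<bar>Q (s, t') - Q (s, t)\<bar> \<le> C2 * s powr (3 * lam / 2 + 1) * (t' - t)"
proof -
  let ?M = "{s. \<bar>Qe (s, t') - Qe (s, t)\<bar> \<le> C2 * (max 0 s) powr (3 * lam / 2 + 1) * (t' - t)}"
  obtain L where "\<forall>t\<in>{0..m}. L-lipschitz_on {0..z} (\<lambda>s. Q (s, t))"
    and L: "\<forall>s\<in>{0..z}. L-lipschitz_on {0..m} (\<lambda>t. Q (s, t))" by (rule Q_slice_lip)
  have "s \<in> ?M"
  proof (rule closed_contains_Icc[OF _ z_pos _ s])
    have "continuous_on UNIV (\<lambda>s::real. max 0 s powr (3 * lam / 2 + 1))"
      by (rule continuous_on_powr') (use lam in \<open>auto intro!: continuous_on_max continuous_on_id continuous_on_const\<close>)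
    then have c1: "continuous_on UNIV (\<lambda>s::real. C2 * max 0 s powr (3 * lam / 2 + 1) * (t' - t))"
      by (intro continuous_on_mult continuous_on_const)
    have c2: "continuous_on UNIV (\<lambda>s. \<bar>Qe (s, t') - Qe (s, t)\<bar>)"
      by (intro continuous_on_rabs continuous_on_diff Qe_slice_cont)
    show "closed ?M" by (rule closed_Collect_le[OF c2 c1])
    show "AE s in lborel. s \<in> {0<..<z} \<longrightarrow> s \<in> ?M"
      using AE_slices(1)[OF growth_AE]
    proof eventually_elim
      case (elim s)
      show ?case
      proof
        assume s: "s \<in> {0<..<z}"
        let ?B = "C2 * s powr (3 * lam / 2 + 1)"
        have Ls: "L-lipschitz_on {t..t'} (\<lambda>t. Q (s, t))"
          by (rule lipschitz_on_subset[OF L[rule_format]]) (use s t in auto)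
        have Ls': "L-lipschitz_on {t..t'} (\<lambda>t. - Q (s, t))"
          using Ls unfolding lipschitz_on_def dist_minus .
        have "Q (s, t') - Q (s, t) \<le> ?B * (t' - t)"
        proof (rule Lipschitz_bound_from_AE_deriv[OF t(3) Ls, where f' = "D_psi Q s"])
          show "AE x in lborel. x \<in> {t<..<t'} \<longrightarrow> ((\<lambda>t. Q (s, t)) has_real_derivative D_psi Q s x) (at x) \<and> D_psi Q s x \<le> ?B"
            using elim
          proof eventually_elim
            case (elim x)
            show ?case
            proof
              assume "x \<in> {t<..<t'}"
              then have d: "(\<lambda>t. Q (s, t)) differentiable at x \<and> \<bar>D_psi Q s x\<bar> \<le> ?B" using elim s t by simp
              show "((\<lambda>t. Q (s, t)) has_real_derivative D_psi Q s x) (at x) \<and> D_psi Q s x \<le> ?B"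
                by (rule conjI[OF D_derivs(2)[OF conjunct1[OF d]] abs_le_D1[OF conjunct2[OF d]]])
            qed
          qed
        qed
        moreover have "- Q (s, t') - - Q (s, t) \<le> ?B * (t' - t)"
        proof (rule Lipschitz_bound_from_AE_deriv[OF t(3) Ls', where f' = "\<lambda>x. - D_psi Q s x"])
          show "AE x in lborel. x \<in> {t<..<t'} \<longrightarrow> ((\<lambda>t. - Q (s, t)) has_real_derivative - D_psi Q s x) (at x) \<and> - D_psi Q s x \<le> ?B"
            using elim
          proof eventually_elim
            case (elim x)
            show ?case
            proof
              assume "x \<in> {t<..<t'}"
              then have d: "(\<lambda>t. Q (s, t)) differentiable at x \<and> \<bar>D_psi Q s x\<bar> \<le> ?B" using elim s t by simp
              then have "((\<lambda>t. - Q (s, t)) has_real_derivative - D_psi Q s x) (at x)"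
                using DERIV_minus[OF D_derivs(2)[of s x]] by simp
              moreover have "- D_psi Q s x \<le> ?B" using d by linarith
              ultimately show "((\<lambda>t. - Q (s, t)) has_real_derivative - D_psi Q s x) (at x) \<and> - D_psi Q s x \<le> ?B" ..
            qed
          qed
        qed
        ultimately have "\<bar>Q (s, t') - Q (s, t)\<bar> \<le> ?B * (t' - t)" by linarith
        then show "s \<in> ?M" using s t by (simp add: Qe_eq)
      qed
    qed
  qed
  then show ?thesis using s t by (simp add: Qe_eq)
qed

lemma Q_wall_antimono:
  assumes s: "s \<in> {0..z}" "s' \<in> {0..z}" "s \<le> s'"
  shows "Q (s', m) \<le> Q (s, m)"
proof -
  let ?M = "{t. Qe (s', t) - Qe (s, t) \<le> 0}"
  obtain L where L: "\<forall>t\<in>{0..m}. L-lipschitz_on {0..z} (\<lambda>s. Q (s, t))"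
    and "\<forall>s\<in>{0..z}. L-lipschitz_on {0..m} (\<lambda>t. Q (s, t))" by (rule Q_slice_lip)
  have "m \<in> ?M"
  proof (rule closed_contains_Icc[OF _ m_pos])
    show "closed ?M"
      by (rule closed_Collect_le[OF continuous_on_diff[OF Qe_slice_cont(2) Qe_slice_cont(2)] continuous_on_const])
    show "AE t in lborel. t \<in> {0<..<m} \<longrightarrow> t \<in> ?M"
      using AE_slices(2)[OF growth_AE]
    proof eventually_elim
      case (elim t)
      show ?case
      proof
        assume t: "t \<in> {0<..<m}"
        have Ls: "L-lipschitz_on {s..s'} (\<lambda>s. Q (s, t))"
          by (rule lipschitz_on_subset[OF L[rule_format]]) (use s t in auto)
        have "Q (s', t) - Q (s, t) \<le> 0 * (s' - s)"
        proof (rule Lipschitz_bound_from_AE_deriv[OF s(3) Ls, where f' = "\<lambda>s. D_phi Q s t"])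
          show "AE x in lborel. x \<in> {s<..<s'} \<longrightarrow> ((\<lambda>s. Q (s, t)) has_real_derivative D_phi Q x t) (at x) \<and> D_phi Q x t \<le> 0"
            using elim
          proof eventually_elim
            case (elim x)
            show ?case
            proof
              assume "x \<in> {s<..<s'}"
              then have "(\<lambda>s. Q (s, t)) differentiable at x \<and> D_phi Q x t \<le> 0" using elim s t by simp
              then show "((\<lambda>s. Q (s, t)) has_real_derivative D_phi Q x t) (at x) \<and> D_phi Q x t \<le> 0"
                using D_derivs(1)[of t x] by blast
            qed
          qed
        qed
        then show "t \<in> ?M" using s t by (simp add: Qe_eq)
      qed
    qed
  qed (use m_pos in auto)
  then show ?thesis using s m_pos by (simp add: Qe_eq)
qed

lemma Qe_range: "Qe p \<in> {- S..0}"
  unfolding Qe_def by (rule Q_range) (use z_pos m_pos in auto)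

text \<open>The upper bound on \<open>Q\<close> keeps the flow away from the sonic state at a controlled rate.\<close>

lemma b_Q_bound:
  obtains k where "0 \<le> k" "\<forall>s\<in>{0<..z}. \<forall>t\<in>{0..m}. b \<gamma> (Q (s, t)) \<le> k * s powr (- (lam / 2 + 1))"
proof (rule b_bound[of "- S"])
  fix Cb assume Cb: "0 < Cb" "\<And>s. - S \<le> s \<Longrightarrow> s < 0 \<Longrightarrow> b \<gamma> s \<le> Cb / sqrt (- s)"
  show thesis
  proof (rule that[of "Cb / sqrt C1"]; (intro ballI)?)
    show "0 \<le> Cb / sqrt C1" using Cb C12 by simp
    fix s t assume s: "s \<in> {0<..z}" and t: "t \<in> {0..m}"
    define r where "r = C1 * s powr (lam + 2)"
    have r: "0 < r" using s C12 by (simp add: r_def)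
    have s': "s \<in> {0..z}" using s by simp
    have Qr: "Q (s, t) \<le> - r" "- S \<le> Q (s, t)"
      using Q_bounds(2)[OF s' t] Q_range[OF s' t] by (simp_all add: r_def)
    have "b \<gamma> (Q (s, t)) \<le> b \<gamma> (- r)" by (rule b_mono[OF Qr(1)]) (use r in linarith)
    also have "\<dots> \<le> Cb / sqrt (- (- r))" by (rule Cb(2)) (use Qr r in linarith)+
    also have "sqrt (- (- r)) = sqrt C1 * s powr (lam / 2 + 1)"
    proof -
      have "sqrt (s powr (lam + 2)) = (s powr (lam + 2)) powr (1 / 2)" by (rule powr_half_sqrt[symmetric]) simp
      also have "\<dots> = s powr ((lam + 2) * (1 / 2))" by (rule powr_powr)
      also have "(lam + 2) * (1 / 2) = lam / 2 + 1" by simp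
      finally show ?thesis by (simp only: r_def minus_minus real_sqrt_mult)
    qed
    also have "Cb / (sqrt C1 * s powr (lam / 2 + 1)) = Cb / sqrt C1 * s powr (- (lam / 2 + 1))"
    proof -
      have pm: "s powr (- (lam / 2 + 1)) = inverse (s powr (lam / 2 + 1))" by (rule powr_minus)
      show ?thesis unfolding pm by (simp only: divide_inverse inverse_mult_distrib mult.assoc)
    qed
    finally show "b \<gamma> (Q (s, t)) \<le> Cb / sqrt C1 * s powr (- (lam / 2 + 1))" .
  qed
qed

text \<open>The vertical flux \<open>b(Q) Q\<^sub>\<psi>\<close> is the \<open>\<psi>\<close>-derivative of \<open>\<Lambda>\<close>.\<close>

definition \<Lambda> :: "real \<times> real \<Rightarrow> real" where "\<Lambda> p = - K \<gamma> (Qe p)"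

lemma \<Lambda>_cont: "continuous_on UNIV \<Lambda>"
  unfolding \<Lambda>_def
  by (intro continuous_intros continuous_on_compose2[OF K_continuous[of "- S"] Qe_cont]) (use Qe_range in blast)

lemma \<Lambda>_bounded: obtains M where "\<forall>p. \<bar>\<Lambda> p\<bar> \<le> M"
proof -
  obtain M where M: "\<forall>x\<in>K \<gamma> ` {- S..0}. norm x \<le> M"
    using compact_imp_bounded[OF compact_continuous_image[OF K_continuous compact_Icc]] unfolding bounded_iff by metis
  have "\<bar>\<Lambda> p\<bar> \<le> M" for p
    using M[rule_format, OF imageI[OF Qe_range[of p]]] by (simp add: \<Lambda>_def)
  then show thesis by (intro that) blast
qed

text \<open>The growth of the bound on \<open>Q\<^sub>\<psi>\<close>, of order \<open>3 * lam / 2 + 1\<close>, exceeds the blow-up of \<open>b\<close>, of order \<open>lam / 2 + 1\<close>.\<close>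

lemma \<Lambda>_lip:
  assumes k: "0 \<le> k" "\<And>s t. s \<in> {0<..z} \<Longrightarrow> t \<in> {0..m} \<Longrightarrow> b \<gamma> (Q (s, t)) \<le> k * s powr (- (lam / 2 + 1))"
    and s: "s \<in> {0..z}"
  shows "\<bar>\<Lambda> (s, t) - \<Lambda> (s, t')\<bar> \<le> k * C2 * z powr lam * \<bar>t - t'\<bar>"
proof -
  define a a' where "a = max 0 (min m t)" and "a' = max 0 (min m t')"
  have a: "a \<in> {0..m}" "a' \<in> {0..m}" "\<bar>a - a'\<bar> \<le> \<bar>t - t'\<bar>" using m_pos by (auto simp: a_def a'_def)
  have e: "Qe (s, t) = Q (s, a)" "Qe (s, t') = Q (s, a')" using s by (auto simp: Qe_def a_def a'_def)
  show ?thesis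
  proof (cases "s = 0")
    case True
    have "0 \<le> k * C2 * z powr lam * \<bar>t - t'\<bar>" using k(1) C12 by simp
    then show ?thesis unfolding \<Lambda>_def e unfolding True Q_zero[OF a(1)] Q_zero[OF a(2)] by simp
  next
    case False
    then have s': "s \<in> {0<..z}" using s by auto
    obtain x where x: "0 < x" "x \<le> k * s powr (- (lam / 2 + 1))" "K \<gamma> (Q (s, a')) - K \<gamma> (Q (s, a)) = x * (Q (s, a) - Q (s, a'))"
      by (rule K_secant[OF Q_neg[OF s' a(1)] Q_neg[OF s' a(2)] k(2)[OF s' a(1)] k(2)[OF s' a(2)]])
    have ql: "\<bar>Q (s, a) - Q (s, a')\<bar> \<le> C2 * s powr (3 * lam / 2 + 1) * \<bar>a - a'\<bar>"
      using Q_psi_lip[OF s a(1,2)] Q_psi_lip[OF s a(2,1)] by (cases "a \<le> a'") (auto simp: abs_minus_commute)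
    have "\<bar>\<Lambda> (s, t) - \<Lambda> (s, t')\<bar> = x * \<bar>Q (s, a) - Q (s, a')\<bar>"
      using x(1,3) by (simp add: \<Lambda>_def e abs_mult)
    also have "\<dots> \<le> (k * s powr (- (lam / 2 + 1))) * (C2 * s powr (3 * lam / 2 + 1) * \<bar>a - a'\<bar>)"
      using x ql k(1) by (intro mult_mono) auto
    also have "\<dots> = k * C2 * (s powr (- (lam / 2 + 1)) * s powr (3 * lam / 2 + 1)) * \<bar>a - a'\<bar>" by simp
    also have "s powr (- (lam / 2 + 1)) * s powr (3 * lam / 2 + 1) = s powr lam"
      by (simp add: powr_add[symmetric])
    also have "k * C2 * s powr lam * \<bar>a - a'\<bar> \<le> k * C2 * z powr lam * \<bar>t - t'\<bar>"
      using k(1) C12 s lam a by (intro mult_mono powr_mono2) auto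
    finally show ?thesis .
  qed
qed

definition wall_source :: "real \<Rightarrow> real" where "wall_source s = curv (pos s) / speed s"

lemma curv_cont: "continuous_on {0..l} curv" by (rule DERIV_continuous_on[OF curv_deriv])

lemma wall_source_cont: "continuous_on {0..z} wall_source"
proof -
  have "continuous_on {0..z} (\<lambda>s. curv (pos s) * (1 / speed s))"
    by (intro continuous_on_mult inv_speed_cont continuous_on_compose2[OF curv_cont pos_cont]) (use pos_range in blast)
  then show ?thesis by (simp add: wall_source_def[abs_def])
qed

lemma pos_deriv:
  assumes s: "0 < s" "s < z"
  shows "(pos has_real_derivative cosT (pos s) / speed s) (at s)"
proof -
  have r: "pos s \<in> {0..l}" using pos_range[of s] s by simp
  have p: "pot (pos s) = s" using pot_pos[of s] s by simp
  have "pos s \<noteq> 0" using p pot_0 s by auto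
  moreover have "pos s \<noteq> l" using p z_eq s by auto
  ultimately have i: "0 < pos s" "pos s < l" using r by auto
  have w: "w (pos s) = speed s" using w_speed[OF r] p by simp
  have d: "(pot has_real_derivative w (pos s) / cosT (pos s)) (at (pos s))"
    using pot_deriv[OF r] at_within_Icc_at[of 0 "pos s" l] i by simp
  have "continuous_on {0<..<z} pos" by (rule continuous_on_subset[OF pos_cont]) auto
  then have cont: "isCont pos s" using s by (simp add: continuous_on_eq_continuous_at)
  have nz: "w (pos s) / cosT (pos s) \<noteq> 0" using w_pos[OF r] cosT_pos[of "pos s"] by simp
  have inv: "pot (pos y) = y" if "0 < y" "y < z" for y using pot_pos[of y] that by simp
  have "(pos has_real_derivative inverse (w (pos s) / cosT (pos s))) (at s)"
    by (rule DERIV_inverse_function[OF d nz s inv cont])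
  then show ?thesis by (simp add: w)
qed

text \<open>By \<open>pos_le\<close> the position is at most \<open>s / c\<close>, so the rate for the curvature carries over from the position to
  the potential.\<close>

lemma wall_curv_deriv:
  assumes s: "0 < s" "s < z"
  shows "((\<lambda>s. curv (pos s)) has_real_derivative dcurv (pos s) * (cosT (pos s) / speed s)) (at s)"
    and "\<bar>dcurv (pos s) * (cosT (pos s) / speed s)\<bar> \<le> Hc * (s / c) powr (lam - 1) / c"
proof -
  have r: "pos s \<in> {0..l}" using pos_range[of s] s by simp
  have p: "pot (pos s) = s" using pot_pos[of s] s by simp
  have "pos s \<noteq> 0" using p pot_0 s by auto
  moreover have "pos s \<noteq> l" using p z_eq s by auto
  ultimately have i: "0 < pos s" "pos s < l" using r by auto
  have d: "(curv has_real_derivative dcurv (pos s)) (at (pos s))"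
    using curv_deriv[OF r] at_within_Icc_at[of 0 "pos s" l] i by simp
  show "((\<lambda>s. curv (pos s)) has_real_derivative dcurv (pos s) * (cosT (pos s) / speed s)) (at s)"
    by (rule DERIV_chain2[OF d pos_deriv[OF s]])
  have sp: "c \<le> speed s" using speed_ge[of s] s by simp
  have "\<bar>dcurv (pos s)\<bar> \<le> Hc * pos s powr (lam - 1)" by (rule dcurv_bound[OF r])
  also have "\<dots> \<le> Hc * (s / c) powr (lam - 1)"
    using Hc_nonneg i pos_le[of s] s lam by (intro mult_left_mono powr_mono2) auto
  finally have "\<bar>dcurv (pos s)\<bar> * \<bar>cosT (pos s) / speed s\<bar> \<le> (Hc * (s / c) powr (lam - 1)) * (1 / c)"
  proof (rule mult_mono)
    show "\<bar>cosT (pos s) / speed s\<bar> \<le> 1 / c"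
      using cosT_pos[of "pos s"] cosT_le_1[of "pos s"] sp c_pos by (simp add: frac_le)
  qed (use Hc_nonneg in simp_all)
  then show "\<bar>dcurv (pos s) * (cosT (pos s) / speed s)\<bar> \<le> Hc * (s / c) powr (lam - 1) / c"
    by (simp add: abs_mult)
qed

text \<open>The test function vanishes beyond \<open>\<tau>\<close>, so all integrals in the weak equation reduce to \<open>[0, \<tau>]\<close>. This makes
  the equations of two flows comparable although their domains have different lengths.\<close>

lemma weak_smeared:
  fixes W D :: "real \<times> real \<Rightarrow> real"
  assumes WD: "AE p in lborel. p \<in> {0<..<z} \<times> {0<..<m} \<longrightarrow>
      W p = D_phi Q (fst p) (snd p) \<and> D p = b \<gamma> (Q p) * D_psi Q (fst p) (snd p)"
    and \<tau>: "0 < \<tau>" "\<tau> \<le> z" and h: "0 < h" and g: "continuous_on UNIV g" "\<And>s t. \<tau> \<le> s \<Longrightarrow> g (s, t) = 0"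
  shows "((\<lambda>p. W p * - (integral {snd p..snd p + h} (\<lambda>t. g (fst p, t)) / h)
          - D p * (integral {fst p..\<tau>} (\<lambda>s. g (s, snd p + h) - g (s, snd p)) / h))
        has_integral
        integral {0..\<tau>} (\<lambda>x. wall_source x * (integral {m..m + h} (\<lambda>t. integral {x..\<tau>} (\<lambda>s. g (s, t))) / h)))
      ({0..\<tau>} \<times> {0..m})"
proof -
  let ?\<xi> = "smeared \<tau> h g" and ?O = "{0<..<z} \<times> {0<..<m}"
  let ?J = "\<lambda>p. W p * - (integral {snd p..snd p + h} (\<lambda>t. g (fst p, t)) / h)
          - D p * (integral {fst p..\<tau>} (\<lambda>s. g (s, snd p + h) - g (s, snd p)) / h)"
  note ctx = \<tau>(1) h g
  have J: "?J p = W p * smeared_fst h g p - D p * smeared_snd \<tau> h g p" if "0 \<le> fst p" "0 \<le> snd p" for p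
    using smeared_fst_eq[OF ctx that(2), of "fst p"] smeared_snd_eq[OF ctx that(1), of "snd p"] by simp
  have weak: "interior_integrand \<gamma> Q ?\<xi> absolutely_integrable_on ?O"
    "wall_integrand \<gamma> l f w Q ?\<xi> integrable_on {0..z}"
    "integral ?O (interior_integrand \<gamma> Q ?\<xi>) = integral {0..z} (wall_integrand \<gamma> l f w Q ?\<xi>)"
  proof -
    have "?\<xi> (z, \<psi>) = 0" if "\<psi> \<in> {0<..<m}" for \<psi> using smeared_beyond(1)[OF ctx \<tau>(2), of \<psi>] that by simp
    from Q_weak[OF smeared_C1[OF ctx] this]
    have all: "interior_integrand \<gamma> Q ?\<xi> absolutely_integrable_on ?O \<and>
     wall_integrand \<gamma> l f w Q ?\<xi> integrable_on {0..z} \<and>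
     integral ?O (interior_integrand \<gamma> Q ?\<xi>) - integral {0..z} (wall_integrand \<gamma> l f w Q ?\<xi>) = 0" .
    show "interior_integrand \<gamma> Q ?\<xi> absolutely_integrable_on ?O" by (rule all[THEN conjunct1])
    show "wall_integrand \<gamma> l f w Q ?\<xi> integrable_on {0..z}" by (rule all[THEN conjunct2, THEN conjunct1])
    show "integral ?O (interior_integrand \<gamma> Q ?\<xi>) = integral {0..z} (wall_integrand \<gamma> l f w Q ?\<xi>)"
      using all[THEN conjunct2, THEN conjunct2] by (simp only: right_minus_eq)
  qed
  have ae: "AE p in lborel. p \<in> ?O \<longrightarrow> interior_integrand \<gamma> Q ?\<xi> p = ?J p"
    using WD
  proof eventually_elim
    case (elim p)
    show ?case
    proof
      assume p: "p \<in> ?O"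
      obtain x t where xt: "p = (x, t)" "0 < x" "0 < t" using p by auto
      show "interior_integrand \<gamma> Q ?\<xi> p = ?J p"
        using J[of p] elim p smeared_partials[OF ctx xt(2,3)] xt by (simp add: interior_integrand_def)
    qed
  qed
  have "?J integrable_on ?O"
    by (rule integrable_cong_AE_lborel[OF ae set_lebesgue_integral_eq_integral(1)[OF weak(1)]])
  then have "(?J has_integral integral {0..z} (wall_integrand \<gamma> l f w Q ?\<xi>)) ?O"
    using integral_cong_AE_lborel[OF ae] weak(3) by (simp add: has_integral_iff)
  moreover
  have bx: "?O = box (0, 0) (z, m)" "{0..z} \<times> {0..m} = cbox (0, 0) (z, m)"
    by (auto simp: box_def Basis_prod_def cbox_Pair_eq)
  ultimately have 1: "(?J has_integral integral {0..z} (wall_integrand \<gamma> l f w Q ?\<xi>)) ({0..z} \<times> {0..m})"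
    using has_integral_open_interval[of ?J] by simp
  have "((\<lambda>p. if p \<in> {0..\<tau>} \<times> {0..m} then ?J p else 0) has_integral integral {0..z} (wall_integrand \<gamma> l f w Q ?\<xi>)) ({0..z} \<times> {0..m})"
  proof (rule has_integral_eq[OF _ 1])
    fix p assume p: "p \<in> {0..z} \<times> {0..m}"
    show "?J p = (if p \<in> {0..\<tau>} \<times> {0..m} then ?J p else 0)"
    proof (cases "p \<in> {0..\<tau>} \<times> {0..m}")
      case False
      obtain x t where xt: "p = (x, t)" by (cases p)
      have "\<tau> \<le> x" "0 \<le> t" using False p xt by auto
      then have "?J p = 0" using J[of p] smeared_beyond(2,3)[OF ctx, of x t] p xt by auto
      then show ?thesis using False by simp
    qed simp
  qed
  then have 2: "(?J has_integral integral {0..z} (wall_integrand \<gamma> l f w Q ?\<xi>)) ({0..\<tau>} \<times> {0..m})"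
  proof -
    have "{0..\<tau>} \<times> {0..m} \<subseteq> {0..z} \<times> {0..m}" using \<tau> by auto
    then show ?thesis by (rule has_integral_restrict[THEN iffD1]) fact
  qed
  have wi: "wall_integrand \<gamma> l f w Q ?\<xi> s = wall_source s * ?\<xi> (s, m)" for s
    by (simp add: wall_integrand_def wall_source_def curv_def cosT_def speed_def)
  have "integral {\<tau>..z} (wall_integrand \<gamma> l f w Q ?\<xi>) = integral {\<tau>..z} (\<lambda>s. 0)"
    by (rule Henstock_Kurzweil_Integration.integral_cong) (use smeared_beyond(1)[OF ctx] m_pos in \<open>simp add: wi\<close>)
  then have "integral {0..z} (wall_integrand \<gamma> l f w Q ?\<xi>) = integral {0..\<tau>} (wall_integrand \<gamma> l f w Q ?\<xi>)"
    using Henstock_Kurzweil_Integration.integral_combine[of 0 \<tau> z, OF _ _ weak(2)] \<tau> by simp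
  also have "\<dots> = integral {0..\<tau>} (\<lambda>x. wall_source x * (integral {m..m + h} (\<lambda>t. integral {x..\<tau>} (\<lambda>s. g (s, t))) / h))"
    by (rule Henstock_Kurzweil_Integration.integral_cong) (use smeared_eq[OF ctx] m_pos in \<open>simp add: wi\<close>)
  finally show ?thesis using 2 by (simp only:)
qed

text \<open>Bounded Borel representatives \<open>W\<close> of \<open>Q\<^sub>\<phi>\<close> and \<open>D\<close> of \<open>b(Q) Q\<^sub>\<psi>\<close>.\<close>

lemma flow_data:
  obtains W D :: "real \<times> real \<Rightarrow> real" and M :: real where
    "W \<in> borel_measurable borel" "D \<in> borel_measurable borel" "\<forall>p. \<bar>W p\<bar> \<le> M" "\<forall>p. \<bar>D p\<bar> \<le> M"
    "\<forall>p. \<bar>\<Lambda> p\<bar> \<le> M" "\<forall>s\<in>{0..z}. \<forall>t t'. \<bar>\<Lambda> (s, t) - \<Lambda> (s, t')\<bar> \<le> M * \<bar>t - t'\<bar>"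
    "AE p in lborel. p \<in> {0<..<z} \<times> {0<..<m} \<longrightarrow>
      ((\<lambda>s. Qe (s, snd p)) has_real_derivative W p) (at (fst p)) \<and> W p \<le> 0 \<and>
      ((\<lambda>t. \<Lambda> (fst p, t)) has_real_derivative D p) (at (snd p))"
    "AE p in lborel. p \<in> {0<..<z} \<times> {0<..<m} \<longrightarrow>
      W p = D_phi Q (fst p) (snd p) \<and> D p = b \<gamma> (Q p) * D_psi Q (fst p) (snd p)"
proof -
  obtain k where k: "0 \<le> k" "\<forall>s\<in>{0<..z}. \<forall>t\<in>{0..m}. b \<gamma> (Q (s, t)) \<le> k * s powr (- (lam / 2 + 1))"
    by (rule b_Q_bound)
  obtain Ml where Ml: "\<forall>p. \<bar>\<Lambda> p\<bar> \<le> Ml" by (rule \<Lambda>_bounded)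
  have Ml0: "0 \<le> Ml" using Ml[rule_format, of "(0,0)"] by linarith
  define Mk where "Mk = k * C2 * z powr lam"
  define Mw where "Mw = C2 * z powr (lam + 1)"
  have M0: "0 \<le> Mk" "0 \<le> Mw" using k C12 by (auto simp: Mk_def Mw_def)
  define M where "M = Ml + Mk + Mw"
  have M: "0 \<le> M" "Ml \<le> M" "Mk \<le> M" "Mw \<le> M" using Ml0 M0 by (auto simp: M_def)
  obtain W where W: "W \<in> borel_measurable borel" "\<forall>p. \<bar>W p\<bar> \<le> M"
    "\<forall>x t d. ((\<lambda>x. Qe (x, t)) has_real_derivative d) (at x) \<longrightarrow> \<bar>d\<bar> \<le> M \<longrightarrow> W (x, t) = d"
    by (rule borel_partial_derivative_fst[OF Qe_cont M(1)])
  obtain D where D: "D \<in> borel_measurable borel" "\<forall>p. \<bar>D p\<bar> \<le> M"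
    "\<forall>x t d. ((\<lambda>t. \<Lambda> (x, t)) has_real_derivative d) (at t) \<longrightarrow> \<bar>d\<bar> \<le> M \<longrightarrow> D (x, t) = d"
    by (rule borel_partial_derivative[OF \<Lambda>_cont M(1)])
  have ae: "AE p in lborel. p \<in> {0<..<z} \<times> {0<..<m} \<longrightarrow>
      (((\<lambda>s. Qe (s, snd p)) has_real_derivative W p) (at (fst p)) \<and> W p \<le> 0 \<and>
      ((\<lambda>t. \<Lambda> (fst p, t)) has_real_derivative D p) (at (snd p))) \<and>
      (W p = D_phi Q (fst p) (snd p) \<and> D p = b \<gamma> (Q p) * D_psi Q (fst p) (snd p))"
    using growth_AE
  proof eventually_elim
    case (elim p)
    show ?case
    proof
      assume p: "p \<in> {0<..<z} \<times> {0<..<m}"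
      obtain s t where st: "p = (s, t)" by (cases p)
      have s: "s \<in> {0<..<z}" and t: "t \<in> {0<..<m}" using p st by auto
      have df: "(\<lambda>s. Q (s, t)) differentiable at s" "(\<lambda>t. Q (s, t)) differentiable at t"
        and bd: "\<bar>D_phi Q s t\<bar> \<le> C2 * s powr (lam + 1)" "D_phi Q s t \<le> 0" "\<bar>D_psi Q s t\<bar> \<le> C2 * s powr (3 * lam / 2 + 1)"
        using elim[THEN mp, OF p] unfolding st fst_conv snd_conv by iprover+
      note d1 = D_derivs(1)[OF df(1)] and d2 = D_derivs(2)[OF df(2)]
      have e1: "((\<lambda>s. Qe (s, t)) has_real_derivative D_phi Q s t) (at s)"
        by (rule has_field_derivative_transform_within_open[OF d1 open_greaterThanLessThan s]) (use t Qe_eq in auto)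
      have e2: "((\<lambda>t. Qe (s, t)) has_real_derivative D_psi Q s t) (at t)"
        by (rule has_field_derivative_transform_within_open[OF d2 open_greaterThanLessThan t]) (use s Qe_eq in auto)
      have neg: "Qe (s, t) < 0" using Q_neg[of s t] Qe_eq[of s t] s t by simp
      have "((\<lambda>t. - K \<gamma> (Qe (s, t))) has_real_derivative - (- b \<gamma> (Qe (s, t)) * D_psi Q s t)) (at t)"
        by (rule DERIV_minus[OF DERIV_chain2[OF K_has_deriv_b[OF neg] e2]])
      then have e3: "((\<lambda>t. \<Lambda> (s, t)) has_real_derivative b \<gamma> (Q (s, t)) * D_psi Q s t) (at t)"
        using s t by (simp add: \<Lambda>_def[abs_def] Qe_eq)
      have "C2 * s powr (lam + 1) \<le> Mw" unfolding Mw_def using C12 s lam by (intro mult_left_mono powr_mono2) auto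
      then have b1: "\<bar>D_phi Q s t\<bar> \<le> M" using bd(1) M by linarith
      have "\<bar>b \<gamma> (Q (s, t)) * D_psi Q s t\<bar> \<le> (k * s powr (- (lam / 2 + 1))) * (C2 * s powr (3 * lam / 2 + 1))"
        unfolding abs_mult using k(2)[rule_format, of s t] b_pos[of "Q (s, t)"] Q_neg[of s t] s t bd(3) k(1)
        by (intro mult_mono) auto
      also have "\<dots> = k * C2 * (s powr (- (lam / 2 + 1)) * s powr (3 * lam / 2 + 1))" by simp
      also have "s powr (- (lam / 2 + 1)) * s powr (3 * lam / 2 + 1) = s powr lam"
        by (simp add: powr_add[symmetric])
      also have "k * C2 * s powr lam \<le> Mk" unfolding Mk_def using k(1) C12 s lam by (intro mult_left_mono powr_mono2) auto
      finally have b2: "\<bar>b \<gamma> (Q (s, t)) * D_psi Q s t\<bar> \<le> M" using M by linarith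
      show "(((\<lambda>s. Qe (s, snd p)) has_real_derivative W p) (at (fst p)) \<and> W p \<le> 0 \<and>
        ((\<lambda>t. \<Lambda> (fst p, t)) has_real_derivative D p) (at (snd p))) \<and>
        (W p = D_phi Q (fst p) (snd p) \<and> D p = b \<gamma> (Q p) * D_psi Q (fst p) (snd p))"
        using W(3)[rule_format, OF e1 b1] D(3)[rule_format, OF e3 b2] e1 e3 bd(2) by (simp add: st)
    qed
  qed
  have lip: "\<bar>\<Lambda> (s, t) - \<Lambda> (s, t')\<bar> \<le> M * \<bar>t - t'\<bar>" if "s \<in> {0..z}" for s t t'
  proof -
    have "\<bar>\<Lambda> (s, t) - \<Lambda> (s, t')\<bar> \<le> Mk * \<bar>t - t'\<bar>" unfolding Mk_def by (rule \<Lambda>_lip[OF k(1) k(2)[rule_format] that])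
    also have "\<dots> \<le> M * \<bar>t - t'\<bar>" using M by (intro mult_right_mono) auto
    finally show ?thesis .
  qed
  show thesis
  proof (rule that[OF W(1) D(1) W(2) D(2)])
    show "\<forall>p. \<bar>\<Lambda> p\<bar> \<le> M" using Ml M(2) order_trans by blast
    show "\<forall>s\<in>{0..z}. \<forall>t t'. \<bar>\<Lambda> (s, t) - \<Lambda> (s, t')\<bar> \<le> M * \<bar>t - t'\<bar>" using lip by blast
    show "AE p in lborel. p \<in> {0<..<z} \<times> {0<..<m} \<longrightarrow>
      ((\<lambda>s. Qe (s, snd p)) has_real_derivative W p) (at (fst p)) \<and> W p \<le> 0 \<and>
      ((\<lambda>t. \<Lambda> (fst p, t)) has_real_derivative D p) (at (snd p))"
      using ae by eventually_elim iprover
    show "AE p in lborel. p \<in> {0<..<z} \<times> {0<..<m} \<longrightarrow>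
      W p = D_phi Q (fst p) (snd p) \<and> D p = b \<gamma> (Q p) * D_psi Q (fst p) (snd p)"
      using ae by eventually_elim iprover
  qed
qed

end

section \<open>The energy inequality for two flows\<close>

lemma mult_lipschitz_on_real:
  fixes f g :: "real \<Rightarrow> real"
  assumes f: "L-lipschitz_on S f" and g: "M-lipschitz_on S g"
    and bf: "\<And>x. x \<in> S \<Longrightarrow> \<bar>f x\<bar> \<le> A'" and bg: "\<And>x. x \<in> S \<Longrightarrow> \<bar>g x\<bar> \<le> B'" and nn: "0 \<le> A'" "0 \<le> B'"
  shows "(A' * M + L * B')-lipschitz_on S (\<lambda>x. f x * g x)"
proof (rule lipschitz_onI)
  have L: "0 \<le> L" "0 \<le> M" using lipschitz_on_nonneg[OF f] lipschitz_on_nonneg[OF g] by auto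
  fix x y assume xy: "x \<in> S" "y \<in> S"
  have "f x * g x - f y * g y = f x * (g x - g y) + (f x - f y) * g y" by (simp add: algebra_simps)
  then have "\<bar>f x * g x - f y * g y\<bar> \<le> \<bar>f x\<bar> * \<bar>g x - g y\<bar> + \<bar>f x - f y\<bar> * \<bar>g y\<bar>"
    by (simp add: abs_mult[symmetric])
  also have "\<dots> \<le> A' * (M * \<bar>x - y\<bar>) + (L * \<bar>x - y\<bar>) * B'"
    using lipschitz_onD[OF f xy] lipschitz_onD[OF g xy] bf[OF xy(1)] bg[OF xy(2)] nn L
    by (intro add_mono mult_mono) (auto simp: dist_real_def)
  finally show "dist (f x * g x) (f y * g y) \<le> (A' * M + L * B') * dist x y"
    by (simp add: dist_real_def algebra_simps)
next
  show "0 \<le> A' * M + L * B'" using nn lipschitz_on_nonneg[OF f] lipschitz_on_nonneg[OF g] by simp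
qed

context flow
begin

text \<open>Away from \<open>s = 0\<close> the coefficient \<open>b(Q)\<close> is bounded.\<close>

lemma \<Lambda>_slice_lip:
  assumes \<delta>: "0 < \<delta>" "\<delta> \<le> z"
  obtains L where "\<forall>t\<in>{0..m}. L-lipschitz_on {\<delta>..z} (\<lambda>s. Qe (s, t)) \<and> L-lipschitz_on {\<delta>..z} (\<lambda>s. \<Lambda> (s, t))"
proof -
  obtain k where k: "0 \<le> k" "\<forall>s\<in>{0<..z}. \<forall>t\<in>{0..m}. b \<gamma> (Q (s, t)) \<le> k * s powr (- (lam / 2 + 1))"
    by (rule b_Q_bound)
  obtain L where L: "\<forall>t\<in>{0..m}. L-lipschitz_on {0..z} (\<lambda>s. Q (s, t))"
    and "\<forall>s\<in>{0..z}. L-lipschitz_on {0..m} (\<lambda>t. Q (s, t))" by (rule Q_slice_lip)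
  define N where "N = k * \<delta> powr (- (lam / 2 + 1))"
  have N: "0 \<le> N" using k by (simp add: N_def)
  have L0: "0 \<le> L" using L m_pos lipschitz_on_nonneg by (meson atLeastAtMost_iff less_imp_le order_refl)
  have bN: "b \<gamma> (Q (s, t)) \<le> N" if "s \<in> {\<delta>..z}" "t \<in> {0..m}" for s t
  proof -
    have "s powr (- (lam / 2 + 1)) \<le> \<delta> powr (- (lam / 2 + 1))" using that \<delta> lam by (intro powr_mono2') auto
    then have "k * s powr (- (lam / 2 + 1)) \<le> N" unfolding N_def using k(1) by (rule mult_left_mono)
    then show ?thesis using k(2)[rule_format, of s t] that \<delta> by simp
  qed
  have Ql: "\<bar>Q (x, t) - Q (y, t)\<bar> \<le> L * \<bar>x - y\<bar>" if "x \<in> {\<delta>..z}" "y \<in> {\<delta>..z}" "t \<in> {0..m}" for x y t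
    using lipschitz_onD[OF L[rule_format, OF that(3)], of x y] that \<delta> by (simp add: dist_real_def)
  have "L-lipschitz_on {\<delta>..z} (\<lambda>s. Qe (s, t)) \<and> (N * L)-lipschitz_on {\<delta>..z} (\<lambda>s. \<Lambda> (s, t))" if t: "t \<in> {0..m}" for t
  proof (intro conjI lipschitz_onI)
    fix x y assume xy: "x \<in> {\<delta>..z}" "y \<in> {\<delta>..z}"
    have e: "Qe (x, t) = Q (x, t)" "Qe (y, t) = Q (y, t)" using xy t \<delta> by (auto intro!: Qe_eq)
    show "dist (Qe (x, t)) (Qe (y, t)) \<le> L * dist x y" using Ql[OF xy t] by (simp add: e dist_real_def)
    have ng: "Q (x, t) < 0" "Q (y, t) < 0" using Q_neg[of x t] Q_neg[of y t] xy t \<delta> by auto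
    obtain r where r: "0 < r" "r \<le> N" "K \<gamma> (Q (y, t)) - K \<gamma> (Q (x, t)) = r * (Q (x, t) - Q (y, t))"
      by (rule K_secant[OF ng bN[OF xy(1) t] bN[OF xy(2) t]])
    have "\<bar>\<Lambda> (x, t) - \<Lambda> (y, t)\<bar> = r * \<bar>Q (x, t) - Q (y, t)\<bar>"
      using r(1,3) by (simp add: \<Lambda>_def e abs_mult)
    also have "\<dots> \<le> N * (L * \<bar>x - y\<bar>)" using r Ql[OF xy t] by (intro mult_mono) auto
    finally show "dist (\<Lambda> (x, t)) (\<Lambda> (y, t)) \<le> N * L * dist x y" by (simp add: dist_real_def mult.assoc)
  qed (use N L0 in auto)
  then have "\<forall>t\<in>{0..m}. (max L (N * L))-lipschitz_on {\<delta>..z} (\<lambda>s. Qe (s, t)) \<and> (max L (N * L))-lipschitz_on {\<delta>..z} (\<lambda>s. \<Lambda> (s, t))"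
    by (intro ballI conjI lipschitz_on_le[of _ _ _ "max L (N * L)"]) auto
  then show thesis by (rule that)
qed

end

text \<open>Two flows in the same nozzle, the first with the shorter range of the potential. Here \<open>u\<close> is the
  difference of the unknowns, \<open>y\<close> the difference of the \<open>\<Lambda>\<close>, and \<open>V\<close> the integral of \<open>y\<close> along the wall.\<close>

locale flow_pair =
  F1: flow \<gamma> lam \<delta>2 \<delta>3 l C1 C2 f w1 Q1 + F2: flow \<gamma> lam \<delta>2 \<delta>3 l C1 C2 f w2 Q2
  for \<gamma> lam \<delta>2 \<delta>3 l C1 C2 :: real and f w1 w2 :: "real \<Rightarrow> real" and Q1 Q2 :: "real \<times> real \<Rightarrow> real" +
  assumes shorter: "\<zeta> l f w1 \<le> \<zeta> l f w2"
begin

abbreviation "z \<equiv> \<zeta> l f w1"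
abbreviation "m \<equiv> flux \<gamma> f"

definition "u p = F1.Qe p - F2.Qe p"
definition "y p = F1.\<Lambda> p - F2.\<Lambda> p"
definition "V x = integral {0..x} (\<lambda>s. y (s, m))"
definition "\<Gamma> s = F1.wall_source s - F2.wall_source s"

lemma in_z2: "s \<in> {0..z} \<Longrightarrow> s \<in> {0..\<zeta> l f w2}" using shorter by simp

lemma u_cont: "continuous_on UNIV u" and y_cont: "continuous_on UNIV y"
  unfolding u_def[abs_def] y_def[abs_def]
  by (intro continuous_on_diff F1.Qe_cont F2.Qe_cont F1.\<Lambda>_cont F2.\<Lambda>_cont)+

lemma slice_cont: "continuous_on S (\<lambda>s. u (s, t))" "continuous_on S (\<lambda>t. u (s, t))"
  "continuous_on S (\<lambda>s. y (s, t))" "continuous_on S (\<lambda>t. y (s, t))"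
  by (rule continuous_on_compose2[OF u_cont] continuous_on_compose2[OF y_cont]; auto intro!: continuous_intros)+

lemma \<Gamma>_cont: "continuous_on {0..z} \<Gamma>"
  unfolding \<Gamma>_def[abs_def]
  by (intro continuous_on_diff F1.wall_source_cont continuous_on_subset[OF F2.wall_source_cont]) (use shorter in auto)

lemma neg: assumes "s \<in> {0<..z}" "t \<in> {0..m}"
  shows "F1.Qe (s, t) = Q1 (s, t)" "F2.Qe (s, t) = Q2 (s, t)" "Q1 (s, t) < 0" "Q2 (s, t) < 0"
  using F1.Qe_eq[of s t] F2.Qe_eq[of s t] F1.Q_neg[of s t] F2.Q_neg[of s t] assms shorter by auto

lemma y_K: assumes "s \<in> {0<..z}" "t \<in> {0..m}"
  shows "y (s, t) = K \<gamma> (Q2 (s, t)) - K \<gamma> (Q1 (s, t))" "u (s, t) = Q1 (s, t) - Q2 (s, t)"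
  using neg[OF assms] by (simp_all add: y_def u_def F1.\<Lambda>_def F2.\<Lambda>_def)

lemma u_zero: "t \<in> {0..m} \<Longrightarrow> u (0, t) = 0"
  using F1.Qe_eq[of 0 t] F2.Qe_eq[of 0 t] F1.Q_zero[of t] F2.Q_zero[of t] F1.z_pos F2.z_pos by (simp add: u_def)

text \<open>By the mean value theorem \<open>y\<close> is a positive multiple of \<open>u\<close>, the factor being a value of \<open>b\<close>.\<close>

lemma secant_bound:
  obtains k where "0 \<le> k"
    "\<forall>s\<in>{0<..z}. \<forall>t\<in>{0..m}. (y (s, t))\<^sup>2 \<le> k * s powr (- (lam / 2 + 1)) * (u (s, t) * y (s, t)) \<and>
      0 \<le> u (s, t) * y (s, t) \<and> (u (s, t) * y (s, t) = 0 \<longrightarrow> u (s, t) = 0)"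
proof -
  obtain k1 where k1: "0 \<le> k1" "\<forall>s\<in>{0<..z}. \<forall>t\<in>{0..m}. b \<gamma> (Q1 (s, t)) \<le> k1 * s powr (- (lam / 2 + 1))"
    by (rule F1.b_Q_bound)
  obtain k2 where k2: "0 \<le> k2" "\<forall>s\<in>{0<..\<zeta> l f w2}. \<forall>t\<in>{0..m}. b \<gamma> (Q2 (s, t)) \<le> k2 * s powr (- (lam / 2 + 1))"
    by (rule F2.b_Q_bound)
  show thesis
  proof (rule that[of "k1 + k2"]; (intro ballI)?)
    show "0 \<le> k1 + k2" using k1 k2 by simp
    fix s t assume st: "s \<in> {0<..z}" "t \<in> {0..m}"
    let ?p = "s powr (- (lam / 2 + 1))"
    have b1: "b \<gamma> (Q1 (s, t)) \<le> k1 * ?p" using k1(2) st by blast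
    have b2: "b \<gamma> (Q2 (s, t)) \<le> k2 * ?p" using k2(2) st shorter by simp
    have "0 \<le> k1 * ?p" "0 \<le> k2 * ?p" using k1(1) k2(1) by simp_all
    then have "b \<gamma> (Q1 (s, t)) \<le> (k1 + k2) * ?p" "b \<gamma> (Q2 (s, t)) \<le> (k1 + k2) * ?p"
      using b1 b2 unfolding distrib_right by linarith+
    from F1.K_secant[OF neg(3,4)[OF st] this] obtain r where
      r: "0 < r" "r \<le> (k1 + k2) * ?p" "K \<gamma> (Q2 (s, t)) - K \<gamma> (Q1 (s, t)) = r * (Q1 (s, t) - Q2 (s, t))" .
    have yr: "y (s, t) = r * u (s, t)" using r(3) y_K[OF st] by simp
    have uy: "u (s, t) * y (s, t) = r * (u (s, t))\<^sup>2" by (simp add: yr power2_eq_square)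
    have nn: "0 \<le> u (s, t) * y (s, t)" unfolding uy using r(1) by simp
    have "(y (s, t))\<^sup>2 = r * (u (s, t) * y (s, t))" by (simp add: yr power2_eq_square)
    also have "\<dots> \<le> (k1 + k2) * ?p * (u (s, t) * y (s, t))" by (rule mult_right_mono[OF r(2) nn])
    finally show "(y (s, t))\<^sup>2 \<le> (k1 + k2) * ?p * (u (s, t) * y (s, t)) \<and>
      0 \<le> u (s, t) * y (s, t) \<and> (u (s, t) * y (s, t) = 0 \<longrightarrow> u (s, t) = 0)"
      using nn uy r(1) by simp
  qed
qed

text \<open>In the energy identity the term with \<open>u\<^sub>\<phi> y\<close> is bounded below by half of the boundary term \<open>u y\<close> at \<open>\<tau>\<close>:
  the defect \<open>u\<^sub>\<phi> y - u y\<^sub>\<phi>\<close> is a sum of products of \<open>Q\<^sub>\<phi> \<le> 0\<close> with differences between the graph of \<open>- K\<close>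
  and its tangents, and convexity gives the right sign. The square of the vertical derivative is then
  exchanged for the value at the wall by the trace estimate.\<close>

lemma energy_inequality:
  assumes \<tau>: "0 < \<tau>" "\<tau> \<le> z"
  defines "rhs \<equiv> - integral {0..\<tau>} (\<lambda>x. \<Gamma> x * integral {x..\<tau>} (\<lambda>s. y (s, m)))"
  shows "integral {0..m} (\<lambda>t. u (\<tau>, t) * y (\<tau>, t)) / 2 \<le> rhs"
    and "m * (V \<tau>)\<^sup>2 \<le> 2 * integral {0..m} (\<lambda>t. (integral {0..\<tau>} (\<lambda>s. y (s, t)))\<^sup>2)
      + 4 * m\<^sup>2 * (rhs - integral {0..m} (\<lambda>t. u (\<tau>, t) * y (\<tau>, t)) / 2)"
proof -
  have m: "0 < m" by (rule F1.m_pos)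
  obtain W1 D1 M1 where d1: "W1 \<in> borel_measurable borel" "D1 \<in> borel_measurable borel" "\<forall>p. \<bar>W1 p\<bar> \<le> M1" "\<forall>p. \<bar>D1 p\<bar> \<le> M1"
    "\<forall>p. \<bar>F1.\<Lambda> p\<bar> \<le> M1" "\<forall>s\<in>{0..z}. \<forall>t t'. \<bar>F1.\<Lambda> (s, t) - F1.\<Lambda> (s, t')\<bar> \<le> M1 * \<bar>t - t'\<bar>"
    and a1: "AE p in lborel. p \<in> {0<..<z} \<times> {0<..<m} \<longrightarrow>
      ((\<lambda>s. F1.Qe (s, snd p)) has_real_derivative W1 p) (at (fst p)) \<and> W1 p \<le> 0 \<and>
      ((\<lambda>t. F1.\<Lambda> (fst p, t)) has_real_derivative D1 p) (at (snd p))"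
    and e1: "AE p in lborel. p \<in> {0<..<z} \<times> {0<..<m} \<longrightarrow>
      W1 p = D_phi Q1 (fst p) (snd p) \<and> D1 p = b \<gamma> (Q1 p) * D_psi Q1 (fst p) (snd p)"
    by (rule F1.flow_data)
  obtain W2 D2 M2 where d2: "W2 \<in> borel_measurable borel" "D2 \<in> borel_measurable borel" "\<forall>p. \<bar>W2 p\<bar> \<le> M2" "\<forall>p. \<bar>D2 p\<bar> \<le> M2"
    "\<forall>p. \<bar>F2.\<Lambda> p\<bar> \<le> M2" "\<forall>s\<in>{0..\<zeta> l f w2}. \<forall>t t'. \<bar>F2.\<Lambda> (s, t) - F2.\<Lambda> (s, t')\<bar> \<le> M2 * \<bar>t - t'\<bar>"
    and a2: "AE p in lborel. p \<in> {0<..<\<zeta> l f w2} \<times> {0<..<m} \<longrightarrow>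
      ((\<lambda>s. F2.Qe (s, snd p)) has_real_derivative W2 p) (at (fst p)) \<and> W2 p \<le> 0 \<and>
      ((\<lambda>t. F2.\<Lambda> (fst p, t)) has_real_derivative D2 p) (at (snd p))"
    and e2: "AE p in lborel. p \<in> {0<..<\<zeta> l f w2} \<times> {0<..<m} \<longrightarrow>
      W2 p = D_phi Q2 (fst p) (snd p) \<and> D2 p = b \<gamma> (Q2 p) * D_psi Q2 (fst p) (snd p)"
    by (rule F2.flow_data)
  define W where "W p = W1 p - W2 p" for p
  define D where "D p = D1 p - D2 p" for p
  define C where "C = M1 + M2"
  have ad: "\<bar>v - v'\<bar> \<le> C" if "\<bar>v\<bar> \<le> M1" "\<bar>v'\<bar> \<le> M2" for v v' :: real using that by (simp add: C_def)
  have Wb: "W \<in> borel_measurable borel" "\<bar>W p\<bar> \<le> C" for p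
  proof -
    show "W \<in> borel_measurable borel" unfolding W_def[abs_def] by (rule borel_measurable_diff[OF d1(1) d2(1)])
    show "\<bar>W p\<bar> \<le> C" unfolding W_def by (rule ad[OF d1(3)[rule_format] d2(3)[rule_format]])
  qed
  have Db: "D \<in> borel_measurable borel" "\<bar>D p\<bar> \<le> C" for p
  proof -
    show "D \<in> borel_measurable borel" unfolding D_def[abs_def] by (rule borel_measurable_diff[OF d1(2) d2(2)])
    show "\<bar>D p\<bar> \<le> C" unfolding D_def by (rule ad[OF d1(4)[rule_format] d2(4)[rule_format]])
  qed
  have yb: "\<bar>y p\<bar> \<le> C" for p unfolding y_def by (rule ad[OF d1(5)[rule_format] d2(5)[rule_format]])
  have C0: "0 \<le> C" using yb[of "(0,0)"] by linarith
  have both: "AE p in lborel. p \<in> {0<..<\<tau>} \<times> {0<..<m} \<longrightarrow>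
      (((\<lambda>s. F1.Qe (s, snd p)) has_real_derivative W1 p) (at (fst p)) \<and> W1 p \<le> 0 \<and>
      ((\<lambda>t. F1.\<Lambda> (fst p, t)) has_real_derivative D1 p) (at (snd p))) \<and>
      (((\<lambda>s. F2.Qe (s, snd p)) has_real_derivative W2 p) (at (fst p)) \<and> W2 p \<le> 0 \<and>
      ((\<lambda>t. F2.\<Lambda> (fst p, t)) has_real_derivative D2 p) (at (snd p)))"
    using a1 a2
  proof eventually_elim
    case (elim p)
    show ?case
    proof
      assume p: "p \<in> {0<..<\<tau>} \<times> {0<..<m}"
      have p1: "p \<in> {0<..<z} \<times> {0<..<m}" "p \<in> {0<..<\<zeta> l f w2} \<times> {0<..<m}" using p \<tau> shorter by auto
      show "(((\<lambda>s. F1.Qe (s, snd p)) has_real_derivative W1 p) (at (fst p)) \<and> W1 p \<le> 0 \<and>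
      ((\<lambda>t. F1.\<Lambda> (fst p, t)) has_real_derivative D1 p) (at (snd p))) \<and>
      (((\<lambda>s. F2.Qe (s, snd p)) has_real_derivative W2 p) (at (fst p)) \<and> W2 p \<le> 0 \<and>
      ((\<lambda>t. F2.\<Lambda> (fst p, t)) has_real_derivative D2 p) (at (snd p)))"
        by (rule conjI[OF elim(1)[THEN mp, OF p1(1)] elim(2)[THEN mp, OF p1(2)]])
    qed
  qed
  interpret vertical_primitive y D \<tau> m C
  proof
    fix s t t' assume s: "s \<in> {0..\<tau>}"
    have "\<bar>F1.\<Lambda> (s, t) - F1.\<Lambda> (s, t')\<bar> \<le> M1 * \<bar>t - t'\<bar>" "\<bar>F2.\<Lambda> (s, t) - F2.\<Lambda> (s, t')\<bar> \<le> M2 * \<bar>t - t'\<bar>"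
      using d1(6) d2(6) s \<tau> shorter by simp_all
    then show "\<bar>y (s, t) - y (s, t')\<bar> \<le> C * \<bar>t - t'\<bar>" unfolding y_def C_def distrib_right by linarith
  next
    fix s t assume t: "m \<le> t"
    have "max 0 (min m t) = m" "max 0 (min m m) = m" using t m by auto
    then show "y (s, t) = y (s, m)" by (simp add: y_def F1.\<Lambda>_def F2.\<Lambda>_def F1.Qe_def F2.Qe_def)
  next
    show "AE p in lborel. p \<in> {0<..<\<tau>} \<times> {0<..<m} \<longrightarrow> ((\<lambda>t. y (fst p, t)) has_real_derivative D p) (at (snd p))"
      using both
    proof eventually_elim
      case (elim p)
      show ?case
      proof
        assume "p \<in> {0<..<\<tau>} \<times> {0<..<m}"
        note e = elim[THEN mp, OF this]
        show "((\<lambda>t. y (fst p, t)) has_real_derivative D p) (at (snd p))"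
          unfolding y_def D_def
          by (rule DERIV_diff[OF e[THEN conjunct1, THEN conjunct2, THEN conjunct2] e[THEN conjunct2, THEN conjunct2, THEN conjunct2]])
      qed
    qed
  qed (use \<tau> m y_cont yb Db in auto)
  have id: "integral R (\<lambda>p. W p * y p) + integral {0..m} (\<lambda>t. (P t)\<^sup>2) / 2
    = - integral {0..\<tau>} (\<lambda>x. \<Gamma> x * integral {x..\<tau>} (\<lambda>s. y (s, m)))"
  proof (rule energy_identity[OF Wb])
    show "continuous_on {0..\<tau>} \<Gamma>" by (rule continuous_on_subset[OF \<Gamma>_cont]) (use \<tau> in auto)
    fix h :: real and g :: "real \<times> real \<Rightarrow> real"
    assume h: "0 < h" and g: "continuous_on UNIV g" "\<And>s t. \<tau> \<le> s \<Longrightarrow> g (s, t) = 0"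
    define H where "H x = integral {m..m + h} (\<lambda>t. integral {x..\<tau>} (\<lambda>s. g (s, t))) / h" for x
    let ?a = "\<lambda>p. - (integral {snd p..snd p + h} (\<lambda>t. g (fst p, t)) / h)"
    let ?b = "\<lambda>p. integral {fst p..\<tau>} (\<lambda>s. g (s, snd p + h) - g (s, snd p)) / h"
    have Hc: "continuous_on {0..\<tau>} H"
    proof -
      have "continuous_on ({0..} \<times> {0..}) (smeared \<tau> h g)"
      proof (rule has_derivative_continuous_on)
        fix p :: "real \<times> real" assume "p \<in> {0..} \<times> {0..}"
        then show "(smeared \<tau> h g has_derivative (\<lambda>k. smeared_fst h g p * fst k + smeared_snd \<tau> h g p * snd k)) (at p within {0..} \<times> {0..})"
          using smeared_has_derivative[OF \<tau>(1) h g, of "fst p" "snd p"] by auto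
      qed
      then have "continuous_on {0..\<tau>} (\<lambda>x. smeared \<tau> h g (x, m))"
        by (rule continuous_on_compose2) (use m in \<open>auto intro!: continuous_intros\<close>)
      then show ?thesis
        by (rule continuous_on_eq) (use smeared_eq[OF \<tau>(1) h g, of _ m] m in \<open>simp add: H_def\<close>)
    qed
    have w1: "((\<lambda>p. W1 p * ?a p - D1 p * ?b p) has_integral integral {0..\<tau>} (\<lambda>x. F1.wall_source x * H x)) R"
      unfolding H_def by (rule F1.weak_smeared[OF e1 \<tau> h g])
    have w2: "((\<lambda>p. W2 p * ?a p - D2 p * ?b p) has_integral integral {0..\<tau>} (\<lambda>x. F2.wall_source x * H x)) R"
      unfolding H_def by (rule F2.weak_smeared[OF e2 \<tau>(1) order_trans[OF \<tau>(2) shorter] h g])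
    have i1: "(\<lambda>x. F1.wall_source x * H x) integrable_on {0..\<tau>}" and i2: "(\<lambda>x. F2.wall_source x * H x) integrable_on {0..\<tau>}"
      by (intro integrable_continuous_real continuous_on_mult Hc continuous_on_subset[OF F1.wall_source_cont]
          continuous_on_subset[OF F2.wall_source_cont]; use \<tau> shorter in auto)+
    have "integral {0..\<tau>} (\<lambda>x. F1.wall_source x * H x) - integral {0..\<tau>} (\<lambda>x. F2.wall_source x * H x)
        = integral {0..\<tau>} (\<lambda>x. \<Gamma> x * H x)"
      unfolding Henstock_Kurzweil_Integration.integral_diff[OF i1 i2, symmetric]
      by (simp add: \<Gamma>_def left_diff_distrib)
    moreover have "(\<lambda>p. (W1 p * ?a p - D1 p * ?b p) - (W2 p * ?a p - D2 p * ?b p)) = (\<lambda>p. W p * ?a p - D p * ?b p)"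
    proof -
      have "(v1 * a - d1 * a') - (v2 * a - d2 * a') = (v1 - v2) * a - (d1 - d2) * a'" for v1 v2 d1 d2 a a' :: real
        by (simp add: algebra_simps)
      then show ?thesis unfolding W_def D_def by (intro ext) (simp only:)
    qed
    ultimately show "((\<lambda>p. W p * ?a p - D p * ?b p) has_integral
        integral {0..\<tau>} (\<lambda>x. \<Gamma> x * (integral {m..m + h} (\<lambda>t. integral {x..\<tau>} (\<lambda>s. g (s, t))) / h))) R"
      using has_integral_diff[OF w1 w2] unfolding H_def by (simp only:)
  qed
  have Wy: "(\<lambda>p. W p * y p) \<in> borel_measurable borel" by (intro borel_measurable_times Wb(1) y_borel)
  have Wyb: "\<bar>W p * y p\<bar> \<le> C * C" for p using Wb(2)[of p] yb[of p] C0 by (simp add: abs_mult mult_mono)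
  note Fub = Fubini_rectangle[OF Wy, of 0 \<tau> 0 m, OF Wyb]
  have low: "integral {0..m} (\<lambda>t. u (\<tau>, t) * y (\<tau>, t) / 2) \<le> integral R (\<lambda>p. W p * y p)"
  proof -
    have "AE t in lborel. t \<noteq> 0" "AE t in lborel. t \<noteq> m" by (auto intro: AE_lborel_singleton)
    then have "AE t in lborel. t \<in> {0..m} \<longrightarrow> u (\<tau>, t) * y (\<tau>, t) / 2 \<le> integral {0..\<tau>} (\<lambda>s. W (s, t) * y (s, t))"
      using AE_slices(2)[OF both]
    proof eventually_elim
      case (elim t)
      show ?case
      proof
        assume t0: "t \<in> {0..m}"
        then have t: "t \<in> {0<..<m}" using elim(1,2) by auto
        define d where "d s = (W (s, t) * y (s, t) + (b \<gamma> (Q1 (s, t)) * W1 (s, t) - b \<gamma> (Q2 (s, t)) * W2 (s, t)) * u (s, t)) / 2" for s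
        show "u (\<tau>, t) * y (\<tau>, t) / 2 \<le> integral {0..\<tau>} (\<lambda>s. W (s, t) * y (s, t))"
        proof (rule integral_lower_bound_from_AE_deriv[where p = "\<lambda>s. u (s, t) * y (s, t) / 2" and d = d and C = "C * C"])
          show "continuous_on {0..\<tau>} (\<lambda>s. u (s, t) * y (s, t) / 2)"
            by (intro continuous_intros slice_cont) simp
          show "u (0, t) * y (0, t) / 2 = 0" using u_zero[OF t0] by simp
          show "(\<lambda>s. W (s, t) * y (s, t)) \<in> borel_measurable borel" by (rule borel_slices(1)[OF Wy])
          show "\<bar>W (s, t) * y (s, t)\<bar> \<le> C * C" for s by (rule Wyb)
          show "\<exists>L. L-lipschitz_on {\<delta>..\<tau>} (\<lambda>s. u (s, t) * y (s, t) / 2)" if \<delta>: "0 < \<delta>" "\<delta> < \<tau>" for \<delta>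
          proof -
            have dz: "\<delta> \<le> z" "\<delta> \<le> \<zeta> l f w2" using \<delta> \<tau> shorter by auto
            obtain L1 where L1: "\<forall>t\<in>{0..m}. L1-lipschitz_on {\<delta>..z} (\<lambda>s. F1.Qe (s, t)) \<and> L1-lipschitz_on {\<delta>..z} (\<lambda>s. F1.\<Lambda> (s, t))"
              by (rule F1.\<Lambda>_slice_lip[OF \<delta>(1) dz(1)])
            obtain L2 where L2: "\<forall>t\<in>{0..m}. L2-lipschitz_on {\<delta>..\<zeta> l f w2} (\<lambda>s. F2.Qe (s, t)) \<and> L2-lipschitz_on {\<delta>..\<zeta> l f w2} (\<lambda>s. F2.\<Lambda> (s, t))"
              by (rule F2.\<Lambda>_slice_lip[OF \<delta>(1) dz(2)])
            have s1: "{\<delta>..\<tau>} \<subseteq> {\<delta>..z}" "{\<delta>..\<tau>} \<subseteq> {\<delta>..\<zeta> l f w2}" using \<tau> shorter by auto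
            have ul: "(L1 + L2)-lipschitz_on {\<delta>..\<tau>} (\<lambda>s. u (s, t))"
              unfolding u_def using L1[rule_format, OF t0] L2[rule_format, OF t0]
              by (intro lipschitz_on_diff lipschitz_on_subset[OF _ s1(1)] lipschitz_on_subset[OF _ s1(2)]) simp_all
            have yl: "(L1 + L2)-lipschitz_on {\<delta>..\<tau>} (\<lambda>s. y (s, t))"
              unfolding y_def using L1[rule_format, OF t0] L2[rule_format, OF t0]
              by (intro lipschitz_on_diff lipschitz_on_subset[OF _ s1(1)] lipschitz_on_subset[OF _ s1(2)]) simp_all
            have ub: "\<bar>u p\<bar> \<le> F1.S + F2.S" for p
              using F1.Qe_range[of p] F2.Qe_range[of p] unfolding u_def atLeastAtMost_iff by linarith
            have SS: "0 \<le> F1.S + F2.S" using ub[of "(0,0)"] by linarith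
            have pl: "((F1.S + F2.S) * (L1 + L2) + (L1 + L2) * C)-lipschitz_on {\<delta>..\<tau>} (\<lambda>s. u (s, t) * y (s, t))"
              by (rule mult_lipschitz_on_real[OF ul yl ub yb SS C0])
            have "((F1.S + F2.S) * (L1 + L2) + (L1 + L2) * C)-lipschitz_on {\<delta>..\<tau>} (\<lambda>s. u (s, t) * y (s, t) / 2)"
            proof (rule lipschitz_onI[OF _ lipschitz_on_nonneg[OF pl]])
              fix a b' assume ab: "a \<in> {\<delta>..\<tau>}" "b' \<in> {\<delta>..\<tau>}"
              have "\<bar>v / 2 - v' / 2\<bar> \<le> \<bar>v - v'\<bar>" for v v' :: real by linarith
              then show "dist (u (a, t) * y (a, t) / 2) (u (b', t) * y (b', t) / 2)
                  \<le> ((F1.S + F2.S) * (L1 + L2) + (L1 + L2) * C) * dist a b'"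
                using lipschitz_onD[OF pl ab] unfolding dist_real_def by (rule order_trans)
            qed
            then show ?thesis by blast
          qed
          show "AE s in lborel. s \<in> {0<..<\<tau>} \<longrightarrow>
              ((\<lambda>s. u (s, t) * y (s, t) / 2) has_real_derivative d s) (at s) \<and> d s \<le> W (s, t) * y (s, t)"
            using elim(3)
          proof eventually_elim
            case (elim s)
            show ?case
            proof
              assume s: "s \<in> {0<..<\<tau>}"
              have st: "s \<in> {0<..z}" "t \<in> {0..m}" using s t0 \<tau> by auto
              have "(s, t) \<in> {0<..<\<tau>} \<times> {0<..<m}" using s t by simp
              note e = elim[THEN mp, OF this, unfolded fst_conv snd_conv]
              have q1: "((\<lambda>s. F1.Qe (s, t)) has_real_derivative W1 (s, t)) (at s)" "W1 (s, t) \<le> 0"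
                and q2: "((\<lambda>s. F2.Qe (s, t)) has_real_derivative W2 (s, t)) (at s)" "W2 (s, t) \<le> 0"
                using e by iprover+
              note n = neg[OF st]
              have k1: "((\<lambda>s. K \<gamma> (F1.Qe (s, t))) has_real_derivative - b \<gamma> (Q1 (s, t)) * W1 (s, t)) (at s)"
                using DERIV_chain2[OF F1.K_has_deriv_b q1(1)] n by simp
              have k2: "((\<lambda>s. K \<gamma> (F2.Qe (s, t))) has_real_derivative - b \<gamma> (Q2 (s, t)) * W2 (s, t)) (at s)"
                using DERIV_chain2[OF F1.K_has_deriv_b q2(1)] n by simp
              have du: "((\<lambda>s. u (s, t)) has_real_derivative W (s, t)) (at s)"
                unfolding u_def W_def by (rule DERIV_diff[OF q1(1) q2(1)])
              have "((\<lambda>s. - K \<gamma> (F1.Qe (s, t)) - - K \<gamma> (F2.Qe (s, t))) has_real_derivative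
                  - (- b \<gamma> (Q1 (s, t)) * W1 (s, t)) - - (- b \<gamma> (Q2 (s, t)) * W2 (s, t))) (at s)"
                by (rule DERIV_diff[OF DERIV_minus[OF k1] DERIV_minus[OF k2]])
              then have dy: "((\<lambda>s. y (s, t)) has_real_derivative (b \<gamma> (Q1 (s, t)) * W1 (s, t) - b \<gamma> (Q2 (s, t)) * W2 (s, t))) (at s)"
                by (simp add: y_def[abs_def] F1.\<Lambda>_def F2.\<Lambda>_def)
              have "((\<lambda>s. u (s, t) * y (s, t) / 2) has_real_derivative d s) (at s)"
                unfolding d_def by (rule DERIV_cdivide[OF DERIV_mult[OF du dy]])
              moreover have "d s \<le> W (s, t) * y (s, t)"
              proof -
                have t1: "y (s, t) \<le> b \<gamma> (Q1 (s, t)) * u (s, t)" and t2: "b \<gamma> (Q2 (s, t)) * u (s, t) \<le> y (s, t)"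
                  using F1.K_tangent[OF n(3,4)] y_K[OF st] by simp_all
                have h: "0 \<le> W1 (s, t) * (y (s, t) - b \<gamma> (Q1 (s, t)) * u (s, t))"
                  "0 \<le> - W2 (s, t) * (y (s, t) - b \<gamma> (Q2 (s, t)) * u (s, t))"
                  using q1(2) q2(2) t1 t2
                  by - (rule mult_nonpos_nonpos mult_nonneg_nonneg; simp)+
                have "((v1 - v2) * yy + (c1 * v1 - c2 * v2) * uu) / 2 \<le> (v1 - v2) * yy"
                  if "0 \<le> v1 * (yy - c1 * uu)" "0 \<le> - v2 * (yy - c2 * uu)" for v1 v2 yy c1 c2 uu :: real
                proof -
                  have "(c1 * v1 - c2 * v2) * uu \<le> (v1 - v2) * yy" using that by (simp add: algebra_simps)
                  then show ?thesis by (simp add: mult.commute)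
                qed
                from this[OF h] show ?thesis unfolding d_def W_def .
              qed
              ultimately show "((\<lambda>s. u (s, t) * y (s, t) / 2) has_real_derivative d s) (at s) \<and> d s \<le> W (s, t) * y (s, t)" ..
            qed
          qed
        qed (rule \<tau>(1))
      qed
    qed
    then obtain N where N: "negligible N"
      "\<And>t. t \<notin> N \<Longrightarrow> t \<in> {0..m} \<longrightarrow> u (\<tau>, t) * y (\<tau>, t) / 2 \<le> integral {0..\<tau>} (\<lambda>s. W (s, t) * y (s, t))"
      by (rule AE_lborel_negligible) (rule that)
    have i: "((\<lambda>t. u (\<tau>, t) * y (\<tau>, t) / 2) has_integral integral {0..m} (\<lambda>t. u (\<tau>, t) * y (\<tau>, t) / 2)) {0..m}"
      by (intro integrable_integral integrable_continuous_real continuous_intros slice_cont) simp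
    have "((\<lambda>t. if t \<in> N then integral {0..\<tau>} (\<lambda>s. W (s, t) * y (s, t)) else u (\<tau>, t) * y (\<tau>, t) / 2)
        has_integral integral {0..m} (\<lambda>t. u (\<tau>, t) * y (\<tau>, t) / 2)) {0..m}"
      by (rule has_integral_spike[OF N(1) _ i]) simp
    then have "integral {0..m} (\<lambda>t. u (\<tau>, t) * y (\<tau>, t) / 2) \<le> integral {0..m} (\<lambda>t. integral {0..\<tau>} (\<lambda>s. W (s, t) * y (s, t)))"
      by (rule has_integral_le[OF _ integrable_integral[OF Fub(5)]]) (use N(2) in auto)
    then show ?thesis unfolding Fub(3) .
  qed
  have tr: "m * (V \<tau>)\<^sup>2 \<le> 2 * integral {0..m} (\<lambda>t. (integral {0..\<tau>} (\<lambda>s. y (s, t)))\<^sup>2) + 2 * m\<^sup>2 * integral {0..m} (\<lambda>t. (P t)\<^sup>2)"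
    using trace_estimate by (simp add: V_def)
  have idr: "integral R (\<lambda>p. W p * y p) + integral {0..m} (\<lambda>t. (P t)\<^sup>2) / 2 = rhs" using id unfolding rhs_def .
  have low': "integral {0..m} (\<lambda>t. u (\<tau>, t) * y (\<tau>, t)) / 2 \<le> integral R (\<lambda>p. W p * y p)" using low by simp
  have P0: "0 \<le> integral {0..m} (\<lambda>t. (P t)\<^sup>2)"
    by (cases "(\<lambda>t. (P t)\<^sup>2) integrable_on {0..m}")
      (simp_all add: Henstock_Kurzweil_Integration.integral_nonneg not_integrable_integral)
  show "integral {0..m} (\<lambda>t. u (\<tau>, t) * y (\<tau>, t)) / 2 \<le> rhs" using idr low' P0 by linarith
  have "v \<le> 2 * (r - r')" if "i + v / 2 = r" "r' \<le> i" for i v r r' :: real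
    using that by (auto simp: field_simps)
  from this[OF idr low'] have "integral {0..m} (\<lambda>t. (P t)\<^sup>2)
      \<le> 2 * (rhs - integral {0..m} (\<lambda>t. u (\<tau>, t) * y (\<tau>, t)) / 2)" .
  then have tr': "2 * m\<^sup>2 * integral {0..m} (\<lambda>t. (P t)\<^sup>2)
      \<le> 2 * m\<^sup>2 * (2 * (rhs - integral {0..m} (\<lambda>t. u (\<tau>, t) * y (\<tau>, t)) / 2))" by (rule mult_left_mono) simp
  have four: "2 * c * (2 * r) = 4 * c * r" for c r :: real by simp
  show "m * (V \<tau>)\<^sup>2 \<le> 2 * integral {0..m} (\<lambda>t. (integral {0..\<tau>} (\<lambda>s. y (s, t)))\<^sup>2)
      + 4 * m\<^sup>2 * (rhs - integral {0..m} (\<lambda>t. u (\<tau>, t) * y (\<tau>, t)) / 2)"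
    by (rule order_trans[OF tr add_left_mono[OF tr'[unfolded four]]])
qed

section \<open>The contribution of the wall\<close>

text \<open>The mean slope between the two wall states. It increases along the wall because both flows accelerate.\<close>

definition slope :: "real \<Rightarrow> real" where
  "slope s = F1.wall_slope (Q1 (s, m)) (Q2 (s, m))"

abbreviation "pos1 \<equiv> X l f w1"
abbreviation "pos2 \<equiv> X l f w2"

lemma Q_wall_nonpos: "s \<in> {0..z} \<Longrightarrow> Q1 (s, m) \<le> 0" "s \<in> {0..z} \<Longrightarrow> Q2 (s, m) \<le> 0"
  using F1.Q_nonpos[of s m] F2.Q_nonpos[of s m] shorter F1.m_pos by auto

lemma slope_mono: assumes "s \<in> {0..z}" "s' \<in> {0..z}" "s \<le> s'" shows "slope s \<le> slope s'"
  unfolding slope_def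
  using F1.wall_slope_antimono[OF F1.Q_wall_antimono[OF assms] Q_wall_nonpos(1)[OF assms(1)]
      F2.Q_wall_antimono[OF in_z2[OF assms(1)] in_z2[OF assms(2)] assms(3)] Q_wall_nonpos(2)[OF assms(1)]] .

lemma slope_nonneg: "s \<in> {0..z} \<Longrightarrow> 0 \<le> slope s"
  unfolding slope_def by (rule F1.wall_slope_nonneg[OF Q_wall_nonpos])

lemma speed_diff: assumes "s \<in> {0..z}" shows "1 / F1.speed s - 1 / F2.speed s = slope s * y (s, m)"
proof -
  have "F1.Qe (s, m) = Q1 (s, m)" "F2.Qe (s, m) = Q2 (s, m)"
    using F1.Qe_eq[of s m] F2.Qe_eq[of s m] assms shorter F1.m_pos by auto
  then show ?thesis
    using F1.inverse_speed_diff[OF Q_wall_nonpos[OF assms]]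
    by (simp add: F1.speed_def F2.speed_def slope_def y_def F1.\<Lambda>_def F2.\<Lambda>_def)
qed

lemma y_wall_integrable: "(\<lambda>s. y (s, m)) integrable_on {a..a'}"
  by (intro integrable_continuous_real slice_cont)

lemma V_diff: "0 \<le> x \<Longrightarrow> x \<le> x' \<Longrightarrow> integral {x..x'} (\<lambda>s. y (s, m)) = V x' - V x"
  unfolding V_def using Henstock_Kurzweil_Integration.integral_combine[of 0 x x' "\<lambda>s. y (s, m)"] y_wall_integrable
  by simp

lemma V_0: "V 0 = 0" by (simp add: V_def)

lemma V_cont: "continuous_on {0..x} V"
  unfolding V_def[abs_def] by (rule indefinite_integral_continuous_1[OF y_wall_integrable])

lemma V_deriv: assumes "0 < s" shows "(V has_real_derivative y (s, m)) (at s)"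
proof -
  have "(V has_real_derivative y (s, m)) (at s within {0..s+1})"
    unfolding V_def[abs_def] by (rule integral_has_real_derivative[OF slice_cont(3)]) (use assms in auto)
  then show ?thesis using at_within_Icc_at[of 0 s "s + 1"] assms by simp
qed

text \<open>The difference of the arc lengths is the integral of \<open>slope * y\<close>. Pointwise values of \<open>y\<close> on the wall are not
  controlled by the energy, but \<open>slope\<close> is monotone, so the second mean value theorem replaces the integral
  by increments of the primitive \<open>V\<close>.\<close>

lemma pos_diff:
  assumes x: "x \<in> {0..z}" and N: "\<forall>s\<in>{0..x}. \<bar>V s\<bar> \<le> N"
  shows "\<bar>pos1 x - pos2 x\<bar> \<le> 3 * slope z * N"
proof -
  have x2: "x \<in> {0..\<zeta> l f w2}" using in_z2[OF x] .
  have i1: "(\<lambda>s. 1 / F1.speed s) integrable_on {0..x}" and i2: "(\<lambda>s. 1 / F2.speed s) integrable_on {0..x}"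
    by (rule integrable_continuous_real, rule continuous_on_subset[OF F1.inv_speed_cont], use x in simp)
      (rule integrable_continuous_real, rule continuous_on_subset[OF F2.inv_speed_cont], use x2 in simp)
  have "F1.arc (pos1 x) - F1.arc (pos2 x) = integral {0..x} (\<lambda>s. 1 / F1.speed s - 1 / F2.speed s)"
    using F1.arc_pos[OF x] F2.arc_pos[OF x2] Henstock_Kurzweil_Integration.integral_diff[OF i1 i2] by simp
  also have "\<dots> = integral {0..x} (\<lambda>s. slope s * y (s, m))"
    by (rule Henstock_Kurzweil_Integration.integral_cong) (use speed_diff x in simp)
  finally have e: "F1.arc (pos1 x) - F1.arc (pos2 x) = integral {0..x} (\<lambda>s. slope s * y (s, m))" .
  have mono: "slope s \<le> slope s'" if "0 \<le> s" "s \<le> s'" "s' \<le> x" for s s'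
    using slope_mono[of s s'] that x by simp
  have x0: "0 \<le> x" using x by simp
  obtain k where k: "k \<in> {0..x}" "integral {0..x} (\<lambda>s. slope s * y (s, m))
      = slope 0 * integral {0..k} (\<lambda>s. y (s, m)) + slope x * integral {k..x} (\<lambda>s. y (s, m))"
    by (rule second_mean_value_theorem[OF y_wall_integrable x0 mono])
  have "integral {0..k} (\<lambda>s. y (s, m)) = V k" by (simp add: V_def)
  moreover have "integral {k..x} (\<lambda>s. y (s, m)) = V x - V k" using V_diff[of k x] k(1) by simp
  ultimately have e2: "F1.arc (pos1 x) - F1.arc (pos2 x) = slope 0 * V k + slope x * (V x - V k)" using e k(2) by simp
  have b: "\<bar>V k\<bar> \<le> N" "\<bar>V x - V k\<bar> \<le> 2 * N" using N[rule_format, of k] N[rule_format, of x] k(1) x0 by auto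
  have E: "0 \<le> slope 0" "slope 0 \<le> slope z" "0 \<le> slope x" "slope x \<le> slope z"
    using slope_nonneg[of 0] slope_mono[of 0 z] slope_nonneg[OF x] slope_mono[of x z] x F1.z_pos by auto
  have "\<bar>pos1 x - pos2 x\<bar> \<le> \<bar>F1.arc (pos1 x) - F1.arc (pos2 x)\<bar>"
    by (rule F1.arc_expands[OF F1.pos_range[OF x] F2.pos_range[OF x2]])
  also have "\<dots> \<le> \<bar>slope 0 * V k\<bar> + \<bar>slope x * (V x - V k)\<bar>" unfolding e2 by (rule abs_triangle_ineq)
  also have "\<dots> \<le> slope z * N + slope z * (2 * N)"
    unfolding abs_mult using E b by (intro add_mono mult_mono) auto
  finally show ?thesis by (simp add: algebra_simps)
qed

lemma pos_le_c: assumes "x \<in> {0..z}" shows "0 \<le> pos1 x" "pos1 x \<le> x / c_star \<gamma>" "0 \<le> pos2 x" "pos2 x \<le> x / c_star \<gamma>"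
  using F1.pos_le[OF assms] F2.pos_le[OF in_z2[OF assms]] F1.pos_range[OF assms] F2.pos_range[OF in_z2[OF assms]] by auto

text \<open>The integrand is the curvature times the derivative of \<open>Z\<close>. Integration by parts moves the derivative to the
  curvature, which is a continuously differentiable function of the potential.\<close>

lemma curvature_by_parts:
  assumes ab: "0 \<le> \<alpha>" "\<alpha> \<le> \<beta>" "\<beta> \<le> \<tau>" "\<tau> \<le> z" and N: "\<forall>s\<in>{0..\<tau>}. \<bar>V s\<bar> \<le> N"
  defines "Z \<equiv> \<lambda>s. (V \<tau> - V s)\<^sup>2 / 2"
  shows "integral {\<alpha>..\<beta>} (\<lambda>s. - (F1.curv (pos2 s) * (y (s, m) * (V \<tau> - V s))))
    \<le> F1.curv (pos2 \<beta>) * Z \<beta> - F1.curv (pos2 \<alpha>) * Z \<alpha> + F1.Hc * (\<tau> / c_star \<gamma>) powr (lam - 1) / c_star \<gamma> * (2 * N\<^sup>2) * (\<beta> - \<alpha>)"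
proof -
  let ?h = "\<lambda>s. F1.curv (pos2 s)"
  let ?h' = "\<lambda>s. F1.dcurv (pos2 s) * (F1.cosT (pos2 s) / F2.speed s)"
  let ?G = "\<lambda>s. - (?h s * (y (s, m) * (V \<tau> - V s)))"
  have hc: "continuous_on {\<alpha>..\<beta>} ?h"
    by (rule continuous_on_compose2[OF F1.curv_cont continuous_on_subset[OF F2.pos_cont]])
      (use ab shorter F2.pos_range in auto)
  have Vc: "continuous_on {\<alpha>..\<beta>} V" by (rule continuous_on_subset[OF V_cont[of \<beta>]]) (use ab in auto)
  have Zc: "continuous_on {\<alpha>..\<beta>} Z" unfolding Z_def by (intro continuous_intros Vc) simp
  have "((\<lambda>s. ?h' s * Z s + ?G s) has_integral (?h \<beta> * Z \<beta> - ?h \<alpha> * Z \<alpha>)) {\<alpha>..\<beta>}"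
  proof (rule fundamental_theorem_of_calculus_interior[OF ab(2)])
    show "continuous_on {\<alpha>..\<beta>} (\<lambda>s. ?h s * Z s)" by (intro continuous_on_mult hc Zc)
    fix s assume s: "s \<in> {\<alpha><..<\<beta>}"
    have s0: "0 < s" "s < \<zeta> l f w2" using s ab shorter by auto
    have dZ: "(Z has_real_derivative - (y (s, m) * (V \<tau> - V s))) (at s)"
      unfolding Z_def using V_deriv[OF s0(1)]
      by (auto intro!: derivative_eq_intros simp: field_simps)
    have "((\<lambda>s. ?h s * Z s) has_real_derivative ?h' s * Z s + ?G s) (at s)"
      by (rule DERIV_cong[OF DERIV_mult[OF F2.wall_curv_deriv(1)[OF s0] dZ]]) (simp add: algebra_simps)
    then show "((\<lambda>s. ?h s * Z s) has_vector_derivative ?h' s * Z s + ?G s) (at s)"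
      by (simp only: has_real_derivative_iff_has_vector_derivative)
  qed
  moreover have Gi: "(?G has_integral integral {\<alpha>..\<beta>} ?G) {\<alpha>..\<beta>}"
    by (intro integrable_integral integrable_continuous_real continuous_on_minus continuous_on_mult hc slice_cont
        continuous_on_diff continuous_on_const Vc)
  ultimately have "((\<lambda>s. (?h' s * Z s + ?G s) - ?G s) has_integral (?h \<beta> * Z \<beta> - ?h \<alpha> * Z \<alpha>) - integral {\<alpha>..\<beta>} ?G) {\<alpha>..\<beta>}"
    by (rule has_integral_diff)
  then have hZ: "((\<lambda>s. ?h' s * Z s) has_integral (?h \<beta> * Z \<beta> - ?h \<alpha> * Z \<alpha>) - integral {\<alpha>..\<beta>} ?G) {\<alpha>..\<beta>}" by simp
  let ?B = "F1.Hc * (\<tau> / c_star \<gamma>) powr (lam - 1) / c_star \<gamma> * (2 * N\<^sup>2)"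
  have cp: "0 < c_star \<gamma>" by (rule F1.c_pos)
  have bnd: "\<bar>?h' s * Z s\<bar> \<le> ?B" if s: "s \<in> {\<alpha>..\<beta>} - {\<alpha>, \<beta>}" for s
  proof -
    have s0: "0 < s" "s < \<zeta> l f w2" "s \<le> \<tau>" using s ab shorter by auto
    have "\<bar>?h' s\<bar> \<le> F1.Hc * (s / c_star \<gamma>) powr (lam - 1) / c_star \<gamma>" by (rule F2.wall_curv_deriv(2)[OF s0(1,2)])
    also have "\<dots> \<le> F1.Hc * (\<tau> / c_star \<gamma>) powr (lam - 1) / c_star \<gamma>"
      using F1.Hc_nonneg cp s0 F1.lam by (intro divide_right_mono mult_left_mono powr_mono2) auto
    finally have h: "\<bar>?h' s\<bar> \<le> F1.Hc * (\<tau> / c_star \<gamma>) powr (lam - 1) / c_star \<gamma>" .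
    have "\<bar>V \<tau> - V s\<bar> \<le> 2 * N" using N[rule_format, of \<tau>] N[rule_format, of s] s0 ab by auto
    then have "\<bar>V \<tau> - V s\<bar>\<^sup>2 \<le> (2 * N)\<^sup>2" by (rule power_mono) simp
    then have "\<bar>Z s\<bar> \<le> 2 * N\<^sup>2" by (simp add: Z_def power_mult_distrib)
    with h order_trans[OF abs_ge_zero h] show ?thesis
      unfolding abs_mult[of "?h' s" "Z s"] by (intro mult_mono) simp_all
  qed
  have "norm ((?h \<beta> * Z \<beta> - ?h \<alpha> * Z \<alpha>) - integral {\<alpha>..\<beta>} ?G) \<le> ?B * Henstock_Kurzweil_Integration.content {\<alpha>..\<beta>}"
  proof (rule has_integral_bound_real[OF _ _ hZ])
    show "0 \<le> ?B" using F1.Hc_nonneg cp by simp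
    show "finite {\<alpha>, \<beta>}" by simp
    show "norm (?h' s * Z s) \<le> ?B" if "s \<in> {\<alpha>..\<beta>} - {\<alpha>, \<beta>}" for s using bnd[OF that] by simp
  qed
  then have "\<bar>(?h \<beta> * Z \<beta> - ?h \<alpha> * Z \<alpha>) - integral {\<alpha>..\<beta>} ?G\<bar> \<le> ?B * (\<beta> - \<alpha>)" using ab by simp
  then show ?thesis by linarith
qed

definition "Kw = 8 * slope z * F1.Hc / (c_star \<gamma> powr (lam - 1) * c_star \<gamma>)"

lemma Kw_nonneg: "0 \<le> Kw"
  using F1.Hc_nonneg slope_nonneg[of z] F1.z_pos F1.c_pos by (simp add: Kw_def)

text \<open>The difference of the wall sources splits into a part with the difference of the curvatures, which is
  small because the positions are close, and a part with \<open>slope * y\<close>. In the latter the second mean value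
  theorem removes \<open>slope\<close>, and after integration by parts the boundary terms have a sign since \<open>slope\<close>
  increases. Both parts gain the length \<open>\<tau> - T\<close> of the interval on which \<open>V\<close> may be nonzero.\<close>

lemma wall_estimate:
  assumes T: "0 \<le> T" "T \<le> \<tau>" "0 < \<tau>" "\<tau> \<le> z"
    and V0: "\<forall>s\<in>{0..T}. V s = 0" and N: "\<forall>s\<in>{0..\<tau>}. \<bar>V s\<bar> \<le> N"
  shows "- integral {0..\<tau>} (\<lambda>x. \<Gamma> x * integral {x..\<tau>} (\<lambda>s. y (s, m))) \<le> Kw * \<tau> powr (lam - 1) * (\<tau> - T) * N\<^sup>2"
proof -
  have cp: "0 < c_star \<gamma>" by (rule F1.c_pos)
  let ?h1 = "\<lambda>s. F1.curv (pos1 s)" and ?h2 = "\<lambda>s. F1.curv (pos2 s)"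
  let ?D = "\<lambda>s. V \<tau> - V s"
  define Z where "Z s = (V \<tau> - V s)\<^sup>2 / 2" for s
  define p where "p = (\<tau> / c_star \<gamma>) powr (lam - 1)"
  have p0: "0 \<le> p" by (simp add: p_def)
  have peq: "p = \<tau> powr (lam - 1) / c_star \<gamma> powr (lam - 1)" unfolding p_def using T cp by (simp add: powr_divide)
  have tz: "s \<in> {0..z}" if "s \<in> {0..\<tau>}" for s using that T by simp
  have De: "integral {x..\<tau>} (\<lambda>s. y (s, m)) = ?D x" if "x \<in> {0..\<tau>}" for x using V_diff[of x \<tau>] that by simp
  have Gam: "\<Gamma> s = (?h1 s - ?h2 s) / F1.speed s + ?h2 s * (slope s * y (s, m))" if "s \<in> {0..\<tau>}" for s
    unfolding speed_diff[OF tz[OF that], symmetric] \<Gamma>_def F1.wall_source_def F2.wall_source_def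
    by (simp add: diff_divide_distrib right_diff_distrib)
  have Dc: "continuous_on {0..\<tau>} ?D" by (intro continuous_intros V_cont)
  have Gi: "(\<lambda>x. \<Gamma> x * ?D x) integrable_on {0..\<tau>}"
    by (intro integrable_continuous_real continuous_on_mult Dc continuous_on_subset[OF \<Gamma>_cont]) (use T in auto)
  have N0: "0 \<le> N" using N[rule_format, of 0] T by force
  have E0: "0 \<le> slope z" using slope_nonneg[of z] F1.z_pos by simp
  have first: "integral {0..T} (\<lambda>x. \<Gamma> x * ?D x) = 0"
  proof -
    have "\<Gamma> s * ?D s = 0" if s: "s \<in> {0..T}" "s \<noteq> 0" "s \<noteq> T" for s
    proof -
      have s0: "s \<in> {0..\<tau>}" "s \<in> {0<..<T}" using s T by auto
      have "(V has_real_derivative 0) (at s)"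
      proof (rule has_field_derivative_transform_within_open[of "\<lambda>s. 0" 0 s "{0<..<T}"])
        show "(0::real) = V x" if "x \<in> {0<..<T}" for x using V0 that by simp
      qed (use s0 in auto)
      then have y0: "y (s, m) = 0" using V_deriv[of s] DERIV_unique s0 by fastforce
      have "\<forall>r\<in>{0..s}. \<bar>V r\<bar> \<le> 0" using V0 s by simp
      from pos_diff[OF tz[OF s0(1)] this] have "pos1 s = pos2 s" by simp
      then show ?thesis using Gam[OF s0(1)] y0 by simp
    qed
    then have "integral {0..T} (\<lambda>x. \<Gamma> x * ?D x) = integral {0..T} (\<lambda>x. 0)"
      by (intro integral_spike[of "{0, T}"]) auto
    then show ?thesis by simp
  qed
  have Gi': "(\<lambda>x. \<Gamma> x * ?D x) integrable_on {T..\<tau>}"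
    by (rule integrable_on_subinterval[OF Gi]) (use T in auto)
  have c1: "continuous_on {T..\<tau>} (\<lambda>s. (?h1 s - ?h2 s) / F1.speed s * ?D s)"
  proof -
    have "continuous_on {T..\<tau>} (\<lambda>s. (?h1 s - ?h2 s) * (1 / F1.speed s) * ?D s)"
    proof (intro continuous_on_mult continuous_on_diff[of _ ?h1])
      show "continuous_on {T..\<tau>} ?h1"
        by (rule continuous_on_compose2[OF F1.curv_cont continuous_on_subset[OF F1.pos_cont]]) (use T F1.pos_range in auto)
      show "continuous_on {T..\<tau>} ?h2"
        by (rule continuous_on_compose2[OF F1.curv_cont continuous_on_subset[OF F2.pos_cont]]) (use T shorter F2.pos_range in auto)
      show "continuous_on {T..\<tau>} (\<lambda>s. 1 / F1.speed s)" by (rule continuous_on_subset[OF F1.inv_speed_cont]) (use T in auto)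
      show "continuous_on {T..\<tau>} ?D" by (rule continuous_on_subset[OF Dc]) (use T in auto)
    qed
    then show ?thesis by simp
  qed
  have i1: "(\<lambda>s. (?h1 s - ?h2 s) / F1.speed s * ?D s) integrable_on {T..\<tau>}" by (rule integrable_continuous_real[OF c1])
  define G2 where "G2 s = - (?h2 s * (y (s, m) * ?D s))" for s
  have G2i: "G2 integrable_on {T..\<tau>}"
    unfolding G2_def
  proof (intro integrable_continuous_real continuous_on_minus continuous_on_mult slice_cont)
    show "continuous_on {T..\<tau>} ?h2"
      by (rule continuous_on_compose2[OF F1.curv_cont continuous_on_subset[OF F2.pos_cont]]) (use T shorter F2.pos_range in auto)
    show "continuous_on {T..\<tau>} ?D" by (rule continuous_on_subset[OF Dc]) (use T in auto)
  qed
  have split: "\<Gamma> s * ?D s = (?h1 s - ?h2 s) / F1.speed s * ?D s - slope s * G2 s" if "s \<in> {T..\<tau>}" for s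
  proof -
    have "s \<in> {0..\<tau>}" using that T by simp
    from Gam[OF this] show ?thesis by (simp add: G2_def algebra_simps)
  qed
  have mono: "slope s \<le> slope s'" if "T \<le> s" "s \<le> s'" "s' \<le> \<tau>" for s s'
    using slope_mono[of s s'] that T by simp
  obtain k where k: "k \<in> {T..\<tau>}"
    and kI: "((\<lambda>s. slope s * G2 s) has_integral (slope T * integral {T..k} G2 + slope \<tau> * integral {k..\<tau>} G2)) {T..\<tau>}"
    by (rule second_mean_value_theorem_full[OF G2i T(2) mono])
  define B where "B = F1.Hc * p / c_star \<gamma> * (2 * N\<^sup>2)"
  have B0: "0 \<le> B" using F1.Hc_nonneg p0 cp by (simp add: B_def)
  have b1: "integral {T..k} G2 \<le> ?h2 k * Z k - ?h2 T * Z T + B * (k - T)"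
    unfolding B_def p_def Z_def G2_def using curvature_by_parts[of T k \<tau> N] T k N by simp
  have b2: "integral {k..\<tau>} G2 \<le> ?h2 \<tau> * Z \<tau> - ?h2 k * Z k + B * (\<tau> - k)"
    unfolding B_def p_def Z_def G2_def using curvature_by_parts[of k \<tau> \<tau> N] T k N by simp
  have Z\<tau>: "Z \<tau> = 0" and Zn: "0 \<le> Z s" for s by (simp_all add: Z_def)
  have hn: "0 \<le> ?h2 s" if "s \<in> {0..\<tau>}" for s
    by (rule F1.curv_nonneg[OF F2.pos_range[OF in_z2[OF tz[OF that]]]])
  have sl: "0 \<le> slope T" "slope T \<le> slope \<tau>" "slope \<tau> \<le> slope z" "slope T \<le> slope z"
    using slope_nonneg[of T] mono[of T \<tau>] slope_mono[of \<tau> z] slope_mono[of T z] T by auto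
  have second: "integral {T..\<tau>} (\<lambda>s. slope s * G2 s) \<le> slope z * B * (\<tau> - T)"
  proof -
    define a where "a = ?h2 k * Z k"
    have a0: "0 \<le> a" unfolding a_def using hn[of k] Zn[of k] k T by simp
    have hT: "0 \<le> ?h2 T * Z T" using hn[of T] Zn[of T] T by simp
    have "integral {T..k} G2 \<le> a + B * (k - T)" using b1 hT unfolding a_def by linarith
    then have i: "slope T * integral {T..k} G2 \<le> slope T * (a + B * (k - T))" using sl(1) by (rule mult_left_mono)
    have "integral {k..\<tau>} G2 \<le> - a + B * (\<tau> - k)" using b2 Z\<tau> unfolding a_def by simp
    then have ii: "slope \<tau> * integral {k..\<tau>} G2 \<le> slope \<tau> * (- a + B * (\<tau> - k))" using sl by (intro mult_left_mono) auto
    have iii: "slope T * a \<le> slope \<tau> * a" using sl(2) a0 by (rule mult_right_mono)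
    have iv: "slope T * (B * (k - T)) \<le> slope z * (B * (k - T))" "slope \<tau> * (B * (\<tau> - k)) \<le> slope z * (B * (\<tau> - k))"
      using sl B0 k by (auto intro!: mult_right_mono)
    have "integral {T..\<tau>} (\<lambda>s. slope s * G2 s) = slope T * integral {T..k} G2 + slope \<tau> * integral {k..\<tau>} G2"
      by (rule integral_unique[OF kI])
    also have "\<dots> \<le> slope T * (a + B * (k - T)) + slope \<tau> * (- a + B * (\<tau> - k))" using i ii by linarith
    also have "\<dots> \<le> slope z * (B * (k - T)) + slope z * (B * (\<tau> - k))"
    proof -
      have "slope \<tau> * (- a + B * (\<tau> - k)) = - (slope \<tau> * a) + slope \<tau> * (B * (\<tau> - k))"
        "slope T * (a + B * (k - T)) = slope T * a + slope T * (B * (k - T))"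
        by (simp_all only: distrib_left mult_minus_right)
      then show ?thesis using iii iv by linarith
    qed
    also have "\<dots> = slope z * B * (\<tau> - T)" by (simp add: algebra_simps)
    finally show ?thesis .
  qed
  have third: "\<bar>integral {T..\<tau>} (\<lambda>s. (?h1 s - ?h2 s) / F1.speed s * ?D s)\<bar>
      \<le> F1.Hc * p * (3 * slope z * N) / c_star \<gamma> * (2 * N) * (\<tau> - T)"
  proof (rule abs_integral_le[OF T(2) i1])
    fix s assume s: "s \<in> {T..\<tau>}"
    have s0: "s \<in> {0..\<tau>}" and sz: "s \<in> {0..z}" using s T by auto
    have le: "s / c_star \<gamma> \<le> \<tau> / c_star \<gamma>" using s cp by (simp add: divide_right_mono)
    have "\<bar>?h1 s - ?h2 s\<bar> \<le> F1.Hc * (\<tau> / c_star \<gamma>) powr (lam - 1) * \<bar>pos1 s - pos2 s\<bar>"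
      by (rule F1.curv_diff[OF F1.pos_range[OF sz] F2.pos_range[OF in_z2[OF sz]]])
        (use pos_le_c[OF sz] le in linarith)+
    also have "\<dots> \<le> F1.Hc * p * (3 * slope z * N)"
      unfolding p_def using pos_diff[OF sz, of N] N s T F1.Hc_nonneg by (intro mult_left_mono) auto
    finally have h: "\<bar>?h1 s - ?h2 s\<bar> \<le> F1.Hc * p * (3 * slope z * N)" .
    have sp: "c_star \<gamma> \<le> F1.speed s" by (rule F1.speed_ge[OF sz])
    have hs: "\<bar>(?h1 s - ?h2 s) / F1.speed s\<bar> \<le> F1.Hc * p * (3 * slope z * N) / c_star \<gamma>"
      unfolding abs_divide by (rule frac_le[OF order_trans[OF abs_ge_zero h] h cp]) (use sp in linarith)
    have "\<bar>?D s\<bar> \<le> 2 * N" using N[rule_format, of \<tau>] N[rule_format, of s] s0 T by auto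
    then show "\<bar>(?h1 s - ?h2 s) / F1.speed s * ?D s\<bar> \<le> F1.Hc * p * (3 * slope z * N) / c_star \<gamma> * (2 * N)"
      unfolding abs_mult[of "(?h1 s - ?h2 s) / F1.speed s"]
      by (rule mult_mono[OF hs _ order_trans[OF abs_ge_zero hs] abs_ge_zero])
  qed
  have "integral {0..\<tau>} (\<lambda>x. \<Gamma> x * integral {x..\<tau>} (\<lambda>s. y (s, m))) = integral {0..\<tau>} (\<lambda>x. \<Gamma> x * ?D x)"
    by (rule Henstock_Kurzweil_Integration.integral_cong) (use De in simp)
  also have "\<dots> = integral {T..\<tau>} (\<lambda>x. \<Gamma> x * ?D x)"
    using Henstock_Kurzweil_Integration.integral_combine[OF T(1,2) Gi] first by simp
  also have "\<dots> = integral {T..\<tau>} (\<lambda>s. (?h1 s - ?h2 s) / F1.speed s * ?D s - slope s * G2 s)"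
    by (rule Henstock_Kurzweil_Integration.integral_cong) (use split in simp)
  also have "\<dots> = integral {T..\<tau>} (\<lambda>s. (?h1 s - ?h2 s) / F1.speed s * ?D s) - integral {T..\<tau>} (\<lambda>s. slope s * G2 s)"
    by (rule Henstock_Kurzweil_Integration.integral_diff[OF i1 has_integral_integrable[OF kI]])
  finally have "- integral {0..\<tau>} (\<lambda>x. \<Gamma> x * integral {x..\<tau>} (\<lambda>s. y (s, m)))
      \<le> F1.Hc * p * (3 * slope z * N) / c_star \<gamma> * (2 * N) * (\<tau> - T) + slope z * B * (\<tau> - T)"
    using second third by linarith
  also have "\<dots> = (8 * slope z * F1.Hc / c_star \<gamma>) * p * (\<tau> - T) * N\<^sup>2"
    by (simp add: B_def power2_eq_square divide_inverse algebra_simps)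
  also have "\<dots> = Kw * \<tau> powr (lam - 1) * (\<tau> - T) * N\<^sup>2"
    unfolding peq Kw_def by (simp add: mult_ac)
  finally show ?thesis .
qed

section \<open>Uniqueness\<close>

text \<open>The energy controls \<open>u y\<close>, hence \<open>y\<^sup>2\<close> up to the factor \<open>s powr (- (lam / 2 + 1))\<close>, which the wall estimate
  compensates: the remaining power \<open>lam / 2 - 1\<close> is nonnegative. Inserted into the trace estimate this bounds
  \<open>V\<close> at \<open>\<tau>\<close> by its own maximum times the length of the interval.\<close>

lemma trace_bound:
  obtains Kt where "0 \<le> Kt"
    "\<forall>T \<tau> N. 0 \<le> T \<longrightarrow> T \<le> \<tau> \<longrightarrow> 0 < \<tau> \<longrightarrow> \<tau> \<le> z \<longrightarrow> (\<forall>s\<in>{0..T}. V s = 0) \<longrightarrow> (\<forall>s\<in>{0..\<tau>}. \<bar>V s\<bar> \<le> N) \<longrightarrow>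
      (V \<tau>)\<^sup>2 \<le> Kt * (\<tau> - T) * N\<^sup>2"
    "\<forall>\<tau>. 0 < \<tau> \<longrightarrow> \<tau> \<le> z \<longrightarrow> (\<forall>s\<in>{0..\<tau>}. V s = 0) \<longrightarrow> (\<forall>t\<in>{0..m}. u (\<tau>, t) = 0)"
proof -
  have m: "0 < m" by (rule F1.m_pos)
  obtain k where k: "0 \<le> k"
    "\<forall>s\<in>{0<..z}. \<forall>t\<in>{0..m}. (y (s, t))\<^sup>2 \<le> k * s powr (- (lam / 2 + 1)) * (u (s, t) * y (s, t)) \<and>
      0 \<le> u (s, t) * y (s, t) \<and> (u (s, t) * y (s, t) = 0 \<longrightarrow> u (s, t) = 0)"
    by (rule secant_bound)
  let ?U = "\<lambda>\<tau>. integral {0..m} (\<lambda>t. u (\<tau>, t) * y (\<tau>, t))"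
  let ?Y = "\<lambda>\<tau>. integral {0..m} (\<lambda>t. (y (\<tau>, t))\<^sup>2)"
  let ?I = "\<lambda>\<tau>. integral {0..m} (\<lambda>t. (integral {0..\<tau>} (\<lambda>s. y (s, t)))\<^sup>2)"
  have uyi: "(\<lambda>t. u (\<tau>, t) * y (\<tau>, t)) integrable_on {0..m}" for \<tau>
    by (intro integrable_continuous_real continuous_on_mult slice_cont)
  have y2i: "(\<lambda>t. (y (\<tau>, t))\<^sup>2) integrable_on {0..m}" for \<tau>
    by (intro integrable_continuous_real continuous_on_power slice_cont)
  have Un: "0 \<le> ?U \<tau>" if "0 < \<tau>" "\<tau> \<le> z" for \<tau>
    by (rule Henstock_Kurzweil_Integration.integral_nonneg[OF uyi]) (use k(2) that in simp)
  have Vc2: "continuous_on UNIV (\<lambda>t. integral {0..\<tau>} (\<lambda>s. y (s, t)))" for \<tau>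
  proof -
    have "continuous_on UNIV (\<lambda>t. integral (cbox 0 \<tau>) (\<lambda>s. y (s, t)))"
      by (intro integral_continuous_on_param)
        (auto intro!: continuous_on_compose2[OF y_cont] continuous_intros simp: case_prod_beta')
    then show ?thesis by simp
  qed
  define Ky where "Ky = 2 * k * Kw * z powr (lam / 2 - 1)"
  have Ky0: "0 \<le> Ky" using k Kw_nonneg by (simp add: Ky_def)
  have energy: "?U \<tau> / 2 \<le> Kw * \<tau> powr (lam - 1) * (\<tau> - T) * N\<^sup>2"
    and trace: "m * (V \<tau>)\<^sup>2 \<le> 2 * ?I \<tau> + 4 * m\<^sup>2 * (Kw * \<tau> powr (lam - 1) * (\<tau> - T) * N\<^sup>2)"
    if "0 \<le> T" "T \<le> \<tau>" "0 < \<tau>" "\<tau> \<le> z" "\<forall>s\<in>{0..T}. V s = 0" "\<forall>s\<in>{0..\<tau>}. \<bar>V s\<bar> \<le> N" for T \<tau> N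
  proof -
    let ?rhs = "- integral {0..\<tau>} (\<lambda>x. \<Gamma> x * integral {x..\<tau>} (\<lambda>s. y (s, m)))"
    have w: "?rhs \<le> Kw * \<tau> powr (lam - 1) * (\<tau> - T) * N\<^sup>2" by (rule wall_estimate[OF that])
    show "?U \<tau> / 2 \<le> Kw * \<tau> powr (lam - 1) * (\<tau> - T) * N\<^sup>2"
      using energy_inequality(1)[OF that(3,4)] w by linarith
    have "?rhs - ?U \<tau> / 2 \<le> Kw * \<tau> powr (lam - 1) * (\<tau> - T) * N\<^sup>2" using w Un[OF that(3,4)] by linarith
    then have "4 * m\<^sup>2 * (?rhs - ?U \<tau> / 2) \<le> 4 * m\<^sup>2 * (Kw * \<tau> powr (lam - 1) * (\<tau> - T) * N\<^sup>2)"
      by (rule mult_left_mono) simp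
    then show "m * (V \<tau>)\<^sup>2 \<le> 2 * ?I \<tau> + 4 * m\<^sup>2 * (Kw * \<tau> powr (lam - 1) * (\<tau> - T) * N\<^sup>2)"
      using energy_inequality(2)[OF that(3,4)] by linarith
  qed
  have Y_le: "?Y s \<le> k * s powr (- (lam / 2 + 1)) * ?U s" if s: "0 < s" "s \<le> z" for s
  proof -
    have "?Y s \<le> integral {0..m} (\<lambda>t. k * s powr (- (lam / 2 + 1)) * (u (s, t) * y (s, t)))"
    proof (rule integral_le[OF y2i])
      show "(\<lambda>t. k * s powr (- (lam / 2 + 1)) * (u (s, t) * y (s, t))) integrable_on {0..m}"
        by (rule integrable_on_mult_right[OF uyi])
      show "(y (s, t))\<^sup>2 \<le> k * s powr (- (lam / 2 + 1)) * (u (s, t) * y (s, t))" if "t \<in> {0..m}" for t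
        using k(2)[rule_format, of s t] that s by simp
    qed
    then show ?thesis by simp
  qed
  have Yz: "?Y 0 = 0"
  proof -
    have "y (0, t) = 0" if "t \<in> {0..m}" for t
      using u_zero[OF that] by (simp add: u_def y_def F1.\<Lambda>_def F2.\<Lambda>_def)
    then have "?Y 0 = integral {0..m} (\<lambda>t. 0)" by (intro Henstock_Kurzweil_Integration.integral_cong) simp
    then show ?thesis by simp
  qed
  have Yc: "continuous_on S ?Y" for S
  proof -
    have "continuous_on S (\<lambda>s. integral (cbox 0 m) (\<lambda>t. (y (s, t))\<^sup>2))"
      by (intro integral_continuous_on_param)
        (auto intro!: continuous_on_power continuous_on_compose2[OF y_cont] continuous_intros simp: case_prod_beta')
    then show ?thesis by simp
  qed
  have step: "(V \<tau>)\<^sup>2 \<le> (2 * z * Ky + 4 * m\<^sup>2 * (Kw * z powr (lam - 1))) / m * (\<tau> - T) * N\<^sup>2"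
    if h: "0 \<le> T" "T \<le> \<tau>" "0 < \<tau>" "\<tau> \<le> z" "\<forall>s\<in>{0..T}. V s = 0" "\<forall>s\<in>{0..\<tau>}. \<bar>V s\<bar> \<le> N" for T \<tau> N
  proof -
    have Y1: "?Y s \<le> 0" if s: "s \<in> {0..T}" for s
    proof (cases "s = 0")
      case False
      then have s0: "0 < s" "s \<le> s" "0 \<le> s" "s \<le> z" using s h by auto
      have Vs: "\<forall>r\<in>{0..s}. V r = 0" using h(5) s by simp
      have Vb: "\<forall>r\<in>{0..s}. \<bar>V r\<bar> \<le> N" using h(2,6) s by simp
      from energy[OF s0(3,2,1,4) Vs Vb] have "?U s \<le> 0" by simp
      then have "k * s powr (- (lam / 2 + 1)) * ?U s \<le> 0" using k(1) by (intro mult_nonneg_nonpos) simp_all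
      then show ?thesis using Y_le[OF s0(1,4)] by linarith
    qed (simp add: Yz)
    have Y2: "?Y s \<le> Ky * N\<^sup>2" if s: "s \<in> {T..\<tau>}" for s
    proof (cases "s = 0")
      case True
      then show ?thesis unfolding True Yz using Ky0 by simp
    next
      case False
      then have s0: "0 < s" "T \<le> s" "s \<le> z" using s h by auto
      have "\<forall>r\<in>{0..s}. \<bar>V r\<bar> \<le> N" using h(6) s by simp
      from energy[OF h(1) s0(2,1,3) h(5) this]
      have "?U s \<le> 2 * (Kw * s powr (lam - 1) * (s - T) * N\<^sup>2)" by linarith
      also have "\<dots> \<le> 2 * (Kw * s powr (lam - 1) * s * N\<^sup>2)"
        using Kw_nonneg h(1) by (intro mult_left_mono mult_right_mono) auto
      finally have U: "?U s \<le> 2 * (Kw * s powr (lam - 1) * s * N\<^sup>2)" .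
      have "?Y s \<le> k * s powr (- (lam / 2 + 1)) * ?U s" by (rule Y_le[OF s0(1,3)])
      also have "\<dots> \<le> k * s powr (- (lam / 2 + 1)) * (2 * (Kw * s powr (lam - 1) * s * N\<^sup>2))"
        using U k(1) by (intro mult_left_mono) auto
      also have "\<dots> = 2 * k * Kw * (s powr (- (lam / 2 + 1)) * s powr (lam - 1) * s powr 1) * N\<^sup>2"
        using s0 by (simp add: mult_ac)
      also have "s powr (- (lam / 2 + 1)) * s powr (lam - 1) * s powr 1 = s powr (lam / 2 - 1)"
      proof -
        have e: "- (lam / 2 + 1) + (lam - 1) + 1 = lam / 2 - 1" by simp
        show ?thesis unfolding powr_add[symmetric] e ..
      qed
      also have "2 * k * Kw * s powr (lam / 2 - 1) * N\<^sup>2 \<le> Ky * N\<^sup>2"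
        unfolding Ky_def using k(1) Kw_nonneg s0 F1.lam by (intro mult_right_mono mult_left_mono powr_mono2) auto
      finally show ?thesis .
    qed
    have Yi: "?Y integrable_on {a..a'}" for a a' by (rule integrable_continuous_real[OF Yc])
    have "integral {0..\<tau>} ?Y = integral {0..T} ?Y + integral {T..\<tau>} ?Y"
      by (rule Henstock_Kurzweil_Integration.integral_combine[symmetric, OF h(1,2) Yi])
    moreover have "integral {0..T} ?Y \<le> integral {0..T} (\<lambda>s. 0)"
      by (rule integral_le[OF Yi]) (use Y1 in auto)
    moreover have "integral {T..\<tau>} ?Y \<le> integral {T..\<tau>} (\<lambda>s. Ky * N\<^sup>2)"
      by (rule integral_le[OF Yi]) (use Y2 in auto)
    moreover have "integral {T..\<tau>} (\<lambda>s. Ky * N\<^sup>2) = Ky * N\<^sup>2 * (\<tau> - T)" using h(2) by (simp add: mult_ac)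
    moreover have "integral {0..T} (\<lambda>s. 0 :: real) = 0" by simp
    ultimately have IY: "integral {0..\<tau>} ?Y \<le> Ky * N\<^sup>2 * (\<tau> - T)" by linarith
    have pt: "(integral {0..\<tau>} (\<lambda>s. y (s, t)))\<^sup>2 \<le> \<tau> * integral {0..\<tau>} (\<lambda>s. (y (s, t))\<^sup>2)" for t
      using integral_power2_le[of 0 \<tau> "\<lambda>s. y (s, t)"] h(3)
        integrable_continuous_real[OF slice_cont(3)] integrable_continuous_real[OF continuous_on_power[OF slice_cont(3)]]
      by simp
    have y2c: "continuous_on UNIV (\<lambda>p. (y p)\<^sup>2)" by (rule continuous_on_power[OF y_cont])
    have sw: "integral {0..m} (\<lambda>t. integral {0..\<tau>} (\<lambda>s. (y (s, t))\<^sup>2)) = integral {0..\<tau>} ?Y"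
      using integral_swap_continuous[of 0 0 \<tau> m "\<lambda>s t. (y (s, t))\<^sup>2"] continuous_on_subset[OF y2c] by simp
    have y2s: "continuous_on {0..m} (\<lambda>t. integral {0..\<tau>} (\<lambda>s. (y (s, t))\<^sup>2))"
    proof -
      have "continuous_on {0..m} (\<lambda>t. integral (cbox 0 \<tau>) (\<lambda>s. (y (s, t))\<^sup>2))"
        by (intro integral_continuous_on_param)
          (auto intro!: continuous_on_power continuous_on_compose2[OF y_cont] continuous_intros simp: case_prod_beta')
      then show ?thesis by simp
    qed
    have "?I \<tau> \<le> integral {0..m} (\<lambda>t. \<tau> * integral {0..\<tau>} (\<lambda>s. (y (s, t))\<^sup>2))"
    proof (rule integral_le)
      show "(\<lambda>t. (integral {0..\<tau>} (\<lambda>s. y (s, t)))\<^sup>2) integrable_on {0..m}"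
        by (intro integrable_continuous_real continuous_on_power continuous_on_subset[OF Vc2]) simp
      show "(\<lambda>t. \<tau> * integral {0..\<tau>} (\<lambda>s. (y (s, t))\<^sup>2)) integrable_on {0..m}"
        by (intro integrable_continuous_real continuous_on_mult continuous_on_const y2s)
    qed (rule pt)
    also have "\<dots> = \<tau> * integral {0..\<tau>} ?Y" by (simp add: sw)
    also have "\<dots> \<le> \<tau> * (Ky * N\<^sup>2 * (\<tau> - T))" using IY h(3) by (intro mult_left_mono) auto
    also have "\<dots> \<le> z * (Ky * N\<^sup>2 * (\<tau> - T))" using h Ky0 by (intro mult_right_mono mult_nonneg_nonneg) auto
    finally have I: "?I \<tau> \<le> z * (Ky * N\<^sup>2 * (\<tau> - T))" .
    have "\<tau> powr (lam - 1) \<le> z powr (lam - 1)" using h F1.lam by (intro powr_mono2) auto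
    then have "4 * m\<^sup>2 * (Kw * \<tau> powr (lam - 1) * (\<tau> - T) * N\<^sup>2) \<le> 4 * m\<^sup>2 * (Kw * z powr (lam - 1) * (\<tau> - T) * N\<^sup>2)"
      using Kw_nonneg h(2) by (intro mult_left_mono mult_right_mono) auto
    then have "m * (V \<tau>)\<^sup>2 \<le> 2 * (z * (Ky * N\<^sup>2 * (\<tau> - T))) + 4 * m\<^sup>2 * (Kw * z powr (lam - 1) * (\<tau> - T) * N\<^sup>2)"
      using trace[OF h] I by linarith
    also have "\<dots> = (2 * z * Ky + 4 * m\<^sup>2 * (Kw * z powr (lam - 1))) * (\<tau> - T) * N\<^sup>2"
      by (simp only: distrib_left distrib_right mult_ac)
    finally have "(V \<tau>)\<^sup>2 \<le> (2 * z * Ky + 4 * m\<^sup>2 * (Kw * z powr (lam - 1))) * (\<tau> - T) * N\<^sup>2 / m"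
      using m by (simp add: pos_le_divide_eq mult.commute)
    then show ?thesis by simp
  qed
  show thesis
  proof (rule that[of "(2 * z * Ky + 4 * m\<^sup>2 * (Kw * z powr (lam - 1))) / m"])
    show "0 \<le> (2 * z * Ky + 4 * m\<^sup>2 * (Kw * z powr (lam - 1))) / m"
      using Ky0 Kw_nonneg m F1.z_pos by simp
    show "\<forall>T \<tau> N. 0 \<le> T \<longrightarrow> T \<le> \<tau> \<longrightarrow> 0 < \<tau> \<longrightarrow> \<tau> \<le> z \<longrightarrow> (\<forall>s\<in>{0..T}. V s = 0) \<longrightarrow> (\<forall>s\<in>{0..\<tau>}. \<bar>V s\<bar> \<le> N) \<longrightarrow>
      (V \<tau>)\<^sup>2 \<le> (2 * z * Ky + 4 * m\<^sup>2 * (Kw * z powr (lam - 1))) / m * (\<tau> - T) * N\<^sup>2"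
      by (intro allI impI step)
    show "\<forall>\<tau>. 0 < \<tau> \<longrightarrow> \<tau> \<le> z \<longrightarrow> (\<forall>s\<in>{0..\<tau>}. V s = 0) \<longrightarrow> (\<forall>t\<in>{0..m}. u (\<tau>, t) = 0)"
    proof (intro allI impI ballI)
      fix \<tau> t assume \<tau>: "0 < \<tau>" "\<tau> \<le> z" and V: "\<forall>s\<in>{0..\<tau>}. V s = 0" and t: "t \<in> {0..m}"
      have "\<forall>s\<in>{0..\<tau>}. \<bar>V s\<bar> \<le> 0" using V by simp
      from energy[OF less_imp_le[OF \<tau>(1)] order_refl \<tau> V this] have "?U \<tau> = 0" using Un[OF \<tau>] by simp
      moreover have "continuous_on {0..m} (\<lambda>t. u (\<tau>, t) * y (\<tau>, t))" by (intro continuous_on_mult slice_cont)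
      moreover have "0 \<le> u (\<tau>, t) * y (\<tau>, t)" if "t \<in> {0..m}" for t using k(2) \<tau> that by simp
      ultimately have uy: "u (\<tau>, t) * y (\<tau>, t) = 0" using integral_eq_0_iff[OF _ m] t by blast
      have "\<tau> \<in> {0<..z}" using \<tau> by simp
      from k(2)[rule_format, OF this t] uy show "u (\<tau>, t) = 0" by iprover
    qed
  qed
qed

text \<open>On an interval so short that the constant in \<open>trace_bound\<close> times its length is at most one half, \<open>V\<close> vanishes
  once it vanishes before; the length does not depend on the position, so finitely many steps reach the end.\<close>

lemma V_zero: "\<forall>s\<in>{0..z}. V s = 0"
proof -
  obtain Kt where Kt: "0 \<le> Kt"
    "\<forall>T \<tau> N. 0 \<le> T \<longrightarrow> T \<le> \<tau> \<longrightarrow> 0 < \<tau> \<longrightarrow> \<tau> \<le> z \<longrightarrow> (\<forall>s\<in>{0..T}. V s = 0) \<longrightarrow> (\<forall>s\<in>{0..\<tau>}. \<bar>V s\<bar> \<le> N) \<longrightarrow>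
      (V \<tau>)\<^sup>2 \<le> Kt * (\<tau> - T) * N\<^sup>2"
    "\<forall>\<tau>. 0 < \<tau> \<longrightarrow> \<tau> \<le> z \<longrightarrow> (\<forall>s\<in>{0..\<tau>}. V s = 0) \<longrightarrow> (\<forall>t\<in>{0..m}. u (\<tau>, t) = 0)"
    by (rule trace_bound)
  define e where "e = 1 / (2 * (Kt + 1))"
  have e: "0 < e" "Kt * e \<le> 1 / 2" using Kt(1) by (simp_all add: e_def field_simps)
  have adv: "\<forall>s\<in>{0..min (real n * e) z}. V s = 0" for n
  proof (induction n)
    case 0
    then show ?case using V_0 F1.z_pos by simp
  next
    case (Suc n)
    define T where "T = min (real n * e) z"
    define T' where "T' = min (real (Suc n) * e) z"
    have TT: "0 \<le> T" "T \<le> T'" "T' \<le> z" "T' - T \<le> e" "0 \<le> T'"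
      using e F1.z_pos by (auto simp: T_def T'_def algebra_simps min_def)
    have "continuous_on {0..T'} (\<lambda>s. \<bar>V s\<bar>)" by (intro continuous_on_rabs V_cont)
    then obtain x where x: "x \<in> {0..T'}" "\<forall>s\<in>{0..T'}. \<bar>V s\<bar> \<le> \<bar>V x\<bar>"
      using continuous_attains_sup[of "{0..T'}" "\<lambda>s. \<bar>V s\<bar>"] TT by auto
    have "V x = 0"
    proof (cases "x \<le> T")
      case True
      then show ?thesis using Suc x unfolding T_def[symmetric] by simp
    next
      case False
      have xs: "0 < x" "T \<le> x" "x \<le> z" using False TT x by auto
      have xb: "\<forall>s\<in>{0..x}. \<bar>V s\<bar> \<le> \<bar>V x\<bar>" using x by simp
      have V0: "\<forall>s\<in>{0..T}. V s = 0" using Suc unfolding T_def .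
      have "(V x)\<^sup>2 \<le> Kt * (x - T) * \<bar>V x\<bar>\<^sup>2"
        using Kt(2)[rule_format, of T x "\<bar>V x\<bar>"] xs TT(1) V0 xb by blast
      also have "\<dots> \<le> (1 / 2) * \<bar>V x\<bar>\<^sup>2"
      proof (rule mult_right_mono)
        have "Kt * (x - T) \<le> Kt * e" using Kt(1) x TT by (intro mult_left_mono) auto
        then show "Kt * (x - T) \<le> 1 / 2" using e(2) by linarith
      qed simp
      finally show ?thesis by simp
    qed
    then show ?case using x(2) unfolding T'_def[symmetric] by simp
  qed
  obtain n where "z / e < real n" using reals_Archimedean2 by blast
  then have "z \<le> real n * e" using e(1) by (simp add: field_simps)
  then show ?thesis using adv[of n] by (simp add: min_absorb2)
qed

lemma Q_equal: assumes "s \<in> {0..z}" "t \<in> {0..m}" shows "Q1 (s, t) = Q2 (s, t)"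
proof (cases "s = 0")
  case True
  then show ?thesis using F1.Q_zero[OF assms(2)] F2.Q_zero[OF assms(2)] by simp
next
  case False
  then have s: "s \<in> {0<..z}" using assms by auto
  obtain Kt where "0 \<le> Kt"
    "\<forall>T \<tau> N. 0 \<le> T \<longrightarrow> T \<le> \<tau> \<longrightarrow> 0 < \<tau> \<longrightarrow> \<tau> \<le> z \<longrightarrow> (\<forall>s\<in>{0..T}. V s = 0) \<longrightarrow> (\<forall>s\<in>{0..\<tau>}. \<bar>V s\<bar> \<le> N) \<longrightarrow>
      (V \<tau>)\<^sup>2 \<le> Kt * (\<tau> - T) * N\<^sup>2"
    and Kt: "\<forall>\<tau>. 0 < \<tau> \<longrightarrow> \<tau> \<le> z \<longrightarrow> (\<forall>s\<in>{0..\<tau>}. V s = 0) \<longrightarrow> (\<forall>t\<in>{0..m}. u (\<tau>, t) = 0)"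
    by (rule trace_bound)
  have "u (s, t) = 0" using Kt V_zero s assms(2) by simp
  then show ?thesis using y_K(2)[OF s assms(2)] by simp
qed

lemma pos_equal: assumes "x \<in> {0..z}" shows "pos1 x = pos2 x"
proof -
  have "\<forall>s\<in>{0..x}. \<bar>V s\<bar> \<le> 0" using V_zero assms by simp
  from pos_diff[OF assms this] show ?thesis by simp
qed

lemma unique:
  "\<zeta> l f w1 = \<zeta> l f w2" "\<forall>x\<in>{0..l}. w1 x = w2 x"
  "\<forall>p\<in>{0..z} \<times> {0..m}. Q1 p = Q2 p"
proof -
  have l: "l \<in> {0..l}" using F1.l by simp
  have zz: "z \<in> {0..z}" using F1.z_pos by simp
  have "pos2 z = pos1 z" using pos_equal[OF zz] by simp
  also have "pos1 z = l" using F1.pos_pot[OF l] by (simp add: F1.z_eq)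
  finally have "\<Phi> l f w2 l = z" using F2.pot_pos[OF in_z2[OF zz]] by simp
  then show "\<zeta> l f w1 = \<zeta> l f w2" using F2.z_eq by simp
  have "w1 x = w2 x" if x: "x \<in> {0..l}" for x
  proof -
    have p: "\<Phi> l f w1 x \<in> {0..z}" by (rule F1.pot_range[OF x])
    have "pos2 (\<Phi> l f w1 x) = x" using pos_equal[OF p] F1.pos_pot[OF x] by simp
    then have "\<Phi> l f w2 x = \<Phi> l f w1 x" using F2.pot_pos[OF in_z2[OF p]] by simp
    then show ?thesis
      using F1.w_eq[OF x] F2.w_eq[OF x] Q_equal[OF p, of m] F1.m_pos by simp
  qed
  then show "\<forall>x\<in>{0..l}. w1 x = w2 x" by blast
  show "\<forall>p\<in>{0..z} \<times> {0..m}. Q1 p = Q2 p" using Q_equal by auto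
qed

end

theorem theorem3p4:
  fixes \<gamma> lam \<delta>1 \<delta>2 \<delta>3 l C1 C2 :: real
    and f w1 w2 :: "real \<Rightarrow> real"
    and Q1 Q2 :: "real \<times> real \<Rightarrow> real"
  assumes "\<gamma> > 1" "lam > 2" "0 < \<delta>1" "\<delta>1 \<le> \<delta>2" "\<delta>3 > 0" "0 < l" "l \<le> 1"
    and "f 0 > 0" "deriv_Icc l 1 f 0 = 0" "\<forall>x\<in>{0<..l}. deriv_Icc l 1 f x > 0"
    and "C_Icc 4 l f"
    and "\<forall>x\<in>{0..l}. \<delta>1 * x powr lam \<le> deriv_Icc l 2 f x \<and> deriv_Icc l 2 f x \<le> \<delta>2 * x powr lam"
    and "\<forall>x\<in>{0..l}. deriv_Icc l 3 f x \<ge> 0 \<and> \<bar>deriv_Icc l 3 f x\<bar> \<le> \<delta>3 * x powr (lam - 1)"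
    and "C1 > 0" "C2 > 0"
    and "weak_solution \<gamma> l f w1 Q1" "growth_bounds lam C1 C2 (\<zeta> l f w1) (flux \<gamma> f) Q1"
    and "weak_solution \<gamma> l f w2 Q2" "growth_bounds lam C1 C2 (\<zeta> l f w2) (flux \<gamma> f) Q2"
  shows "(\<forall>x\<in>{0..l}. w1 x = w2 x) \<and> \<zeta> l f w1 = \<zeta> l f w2 \<and>
    (\<forall>p\<in>{0..\<zeta> l f w1} \<times> {0..flux \<gamma> f}. Q1 p = Q2 p)"
proof -
  have f2: "0 \<le> deriv_Icc l 2 f x \<and> deriv_Icc l 2 f x \<le> \<delta>2 * x powr lam" if x: "x \<in> {0..l}" for x
  proof -
    have "0 \<le> \<delta>1 * x powr lam" using assms(3) by simp
    moreover have "\<delta>1 * x powr lam \<le> deriv_Icc l 2 f x \<and> deriv_Icc l 2 f x \<le> \<delta>2 * x powr lam"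
      by (rule assms(12)[rule_format, OF x])
    ultimately show ?thesis by linarith
  qed
  have f3: "\<bar>deriv_Icc l 3 f x\<bar> \<le> \<delta>3 * x powr (lam - 1)" if x: "x \<in> {0..l}" for x
    by (rule conjunct2[OF assms(13)[rule_format, OF x]])
  have nz: "nozzle \<gamma> lam \<delta>2 \<delta>3 l C1 C2 f"
    by (intro nozzle.intro gas_law.intro nozzle_axioms.intro f2 f3 assms)
  have flow1: "flow \<gamma> lam \<delta>2 \<delta>3 l C1 C2 f w1 Q1"
    by (intro flow.intro nz flow_axioms.intro assms)
  have flow2: "flow \<gamma> lam \<delta>2 \<delta>3 l C1 C2 f w2 Q2"
    by (intro flow.intro nz flow_axioms.intro assms)
  show ?thesis
  proof (cases "\<zeta> l f w1 \<le> \<zeta> l f w2")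
    case True
    note pair = flow_pair.intro[OF flow1 flow2 flow_pair_axioms.intro[OF True]]
    show ?thesis using flow_pair.unique[OF pair] by blast
  next
    case False
    then have "\<zeta> l f w2 \<le> \<zeta> l f w1" by simp
    note pair = flow_pair.intro[OF flow2 flow1 flow_pair_axioms.intro[OF this]]
    show ?thesis using flow_pair.unique[OF pair] by simp
  qed
qed

end
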